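(* There exist a function $f$ with $f(n)=o(n)$ and a constant $C$ such that for all integers $m\ge1$, $0\le n\le m$, and every $S\subseteq[m]$ with $|S|=n$, there is an indexable dictionary for $S$ (supporting $\mathrm{rank}(x,S)$ and $\mathrm{select}(i,S)$ in constant time on the word RAM with word size $\Theta(\lg m)$) that uses at most $n\lceil\lg m\rceil+f(n)+C\lg\lg m$ bits of space.
   Context: $[m]=\{0,\dots,m-1\}$, $\lg=\log_2$. $\mathrm{rank}(x,S)$ returns $-1$ if $x\notin S$ and $|\{y\in S:y<x\}|$ otherwise; $\mathrm{select}(i,S)$ returns the $i$-th smallest element of $S$. Word RAM: words of $w$ bits with constant-time arithmetic and bitwise operations; constant time means independent of $n,m,S$. *)

theory Defs
  imports Complex_Main "HOL-Library.Landau_Symbols"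
begin

definition set_rank :: "nat \<Rightarrow> nat set \<Rightarrow> int" where
  "set_rank x S = (if x \<in> S then int (card {y \<in> S. y < x}) else - 1)"

text \<open>The \<open>i\<close>-th smallest element, counting from \<open>i = 1\<close>.\<close>

definition set_select :: "nat \<Rightarrow> nat set \<Rightarrow> nat" where
  "set_select i S = sorted_list_of_set S ! (i - 1)"

text \<open>
  Word RAM with word size \<open>w\<close>: registers and memory cells hold natural numbers below \<open>2 ^ w\<close>,
  and arithmetic is modulo \<open>2 ^ w\<close>. Registers are named by constants of the program, so a program
  has only a fixed finite number of words of working storage. The memory holds the data structure
  and can only be read. Destination registers come first.
\<close>

datatype binop = Add | Sub | Mul | Div | Mod | And | Or | Xor | Shl | Shr

datatype instr =
    Const nat nat
  | WordSize nat
  | Move nat nat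
  | Not nat nat
  | Bin binop nat nat nat
  | Load nat nat
  | Jump nat
  | JumpEq nat nat nat
  | JumpLess nat nat nat

type_synonym prog = "instr list"

text \<open>Both operands are below \<open>2 ^ w\<close>; division by zero follows the conventions of HOL.\<close>

fun eval_binop :: "nat \<Rightarrow> binop \<Rightarrow> nat \<Rightarrow> nat \<Rightarrow> nat" where
  "eval_binop w Add a b = (a + b) mod 2 ^ w"
| "eval_binop w Sub a b = (a + (2 ^ w - b)) mod 2 ^ w"
| "eval_binop w Mul a b = (a * b) mod 2 ^ w"
| "eval_binop w Div a b = a div b"
| "eval_binop w Mod a b = a mod b"
| "eval_binop w And a b = Bit_Operations.and a b"
| "eval_binop w Or a b = Bit_Operations.or a b"
| "eval_binop w Xor a b = Bit_Operations.xor a b"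
| "eval_binop w Shl a b = push_bit b a mod 2 ^ w"
| "eval_binop w Shr a b = drop_bit b a"

text \<open>A configuration consists of the program counter and the register contents.\<close>

type_synonym config = "nat \<times> (nat \<Rightarrow> nat)"

fun exec_instr :: "nat \<Rightarrow> (nat \<Rightarrow> nat) \<Rightarrow> instr \<Rightarrow> config \<Rightarrow> config" where
  "exec_instr w M (Const r k) (pc, R) = (pc + 1, R(r := k mod 2 ^ w))"
| "exec_instr w M (WordSize r) (pc, R) = (pc + 1, R(r := w))"
| "exec_instr w M (Move r s) (pc, R) = (pc + 1, R(r := R s))"
| "exec_instr w M (Not r s) (pc, R) = (pc + 1, R(r := 2 ^ w - 1 - R s))"
| "exec_instr w M (Bin f r s t) (pc, R) = (pc + 1, R(r := eval_binop w f (R s) (R t)))"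
| "exec_instr w M (Load r s) (pc, R) = (pc + 1, R(r := M (R s)))"
| "exec_instr w M (Jump l) (pc, R) = (l, R)"
| "exec_instr w M (JumpEq s t l) (pc, R) = (if R s = R t then l else pc + 1, R)"
| "exec_instr w M (JumpLess s t l) (pc, R) = (if R s < R t then l else pc + 1, R)"

text \<open>The machine halts by leaving the program text.\<close>

definition step :: "nat \<Rightarrow> prog \<Rightarrow> (nat \<Rightarrow> nat) \<Rightarrow> config \<Rightarrow> config" where
  "step w P M c = (if fst c < length P then exec_instr w M (P ! fst c) c else c)"

text \<open>
  A bit string is packed into consecutive words, least significant bit first. Cells beyond its end
  read as zero, so its length is not observable.
\<close>

definition pack :: "nat \<Rightarrow> bool list \<Rightarrow> nat \<Rightarrow> nat" where
  "pack w D j = horner_sum of_bool 2 (take w (drop (j * w) D))"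

text \<open>The argument and the result are passed in register 0; all other registers start at zero.\<close>

definition answers_within :: "nat \<Rightarrow> prog \<Rightarrow> bool list \<Rightarrow> nat \<Rightarrow> nat \<Rightarrow> nat \<Rightarrow> bool" where
  "answers_within w P D T q a \<longleftrightarrow>
     (\<exists>t\<le>T. \<exists>pc R. (step w P (pack w D) ^^ t) (0, (\<lambda>_. 0)(0 := q)) = (pc, R) \<and>
        length P \<le> pc \<and> R 0 = a)"

text \<open>Two's complement; in particular \<open>- 1\<close> is the word all of whose bits are set.\<close>

definition word_of_integer :: "nat \<Rightarrow> int \<Rightarrow> nat" where
  "word_of_integer w z = nat (z mod 2 ^ w)"

definition indexable_dictionary ::
  "nat \<Rightarrow> prog \<Rightarrow> prog \<Rightarrow> nat \<Rightarrow> nat \<Rightarrow> nat set \<Rightarrow> bool list \<Rightarrow> bool" where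
  "indexable_dictionary w P_rank P_select T m S D \<longleftrightarrow>
     (\<forall>x<m. answers_within w P_rank D T x (word_of_integer w (set_rank x S))) \<and>
     (\<forall>i\<in>{1..card S}. answers_within w P_select D T i (set_select i S))"

end

theory Submission
  imports Defs "HOL-Library.Log_Nat"
begin

text \<open>
  Let \<open>n = |S|\<close> and let \<open>S\<close> be sparse, that is, \<open>512 n \<le> m\<close>. The elements are kept in sorted order, split into
  \<open>lg m - lg n\<close> low bits, stored explicitly, and high bits, which form a monotone sequence and cost \<open>O(n)\<close> bits.
  To find the rank of \<open>x\<close>, a perfect hash function costing \<open>O(n)\<close> bits maps \<open>S\<close> to \<open>{0..<n}\<close>, and a table at the hash
  value gives \<open>rank x div 2\<^sup>k\<close> with \<open>lg n - k\<close> bits per element, for a constant \<open>k\<close>; the \<open>2\<^sup>k\<close> candidates are then compared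
  with \<open>x\<close>. In total this takes \<open>n lg m - k n + O(n)\<close> bits, so a large enough \<open>k\<close> pays for all linear terms.

  The hash function first reduces \<open>x\<close> modulo two small numbers that are injective on \<open>S\<close>; they exist because
  \<open>lcm(1..2q) \<ge> 2\<^sup>q\<close> and have \<open>O(lg n + lg lg m)\<close> bits. Two levels of multiply-shift hashing follow, where the
  buckets of the second level share a list of \<open>O(lg n)\<close> seeds; every seed serves half of the buckets that are left, so the
  seed numbers are written in unary with \<open>O(n)\<close> bits altogether. Dense sets are stored as rank and select structures with
  \<open>O(m)\<close> bits, which is at most \<open>n lg m\<close> when \<open>n\<close> is large, and if the word size is below a constant a table of all ranks is used.
\<close>

section \<open>Compiling expressions to RAM programs\<close>

text \<open>One pair of programs serves every \<open>m\<close> and \<open>S\<close>, so all that a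
  query needs besides the word size is read from the structure. Storing \<open>m\<close> would take
  lg m bits and break the bound; the parameters must fit into O(lg n + lg lg m) bits, which is why
  keys are shrunk by moduli before they are hashed. A single modulus would leave lg lg m bits in
  each of the O(lg n) seeds. After the second one a seed has 2 lg n + e bits with e = O(lg (lg n +
  lg lg m)), and e lg n <= e^2 + (lg n)^2 separates the two parameters.

  Dropping \<open>k\<close> bits of each rank is affordable because candidates have to be compared
  with the stored elements anyway: the hash function promises nothing for queries outside
  \<open>S\<close>. As \<open>k\<close> exceeds all linear coefficients, the function
  \<open>f\<close> of the theorem is a constant for small \<open>n\<close> and 0 beyond. Programs
  have no loops; every search is a nested conditional of constant size.\<close>

datatype expr = Arg | Wsize | Cst nat | Op binop expr expr | Ld expr
  | Cond bool expr expr expr expr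

fun test :: "bool \<Rightarrow> nat \<Rightarrow> nat \<Rightarrow> bool" where
  "test True x y \<longleftrightarrow> x = y"
| "test False x y \<longleftrightarrow> x < y"

fun jump_if :: "bool \<Rightarrow> nat \<Rightarrow> nat \<Rightarrow> nat \<Rightarrow> instr" where
  "jump_if True = JumpEq"
| "jump_if False = JumpLess"

lemma exec_jump_if:
  "exec_instr w M (jump_if c s t l) (pc, R) = (if test c (R s) (R t) then l else pc + 1, R)"
  by (cases c) auto

fun ev :: "nat \<Rightarrow> (nat \<Rightarrow> nat) \<Rightarrow> nat \<Rightarrow> expr \<Rightarrow> nat" where
  "ev w M q Arg = q"
| "ev w M q Wsize = w"
| "ev w M q (Cst c) = c mod 2 ^ w"
| "ev w M q (Op f a b) = eval_binop w f (ev w M q a) (ev w M q b)"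
| "ev w M q (Ld a) = M (ev w M q a)"
| "ev w M q (Cond t a b c d) = (if test t (ev w M q a) (ev w M q b) then ev w M q c else ev w M q d)"

fun code_size :: "expr \<Rightarrow> nat" where
  "code_size (Op f a b) = code_size a + code_size b + 1"
| "code_size (Ld a) = code_size a + 1"
| "code_size (Cond t a b c d) = code_size a + code_size b + code_size c + code_size d + 2"
| "code_size _ = 1"

text \<open>\<open>compile e p k\<close> is the code for \<open>e\<close> at address \<open>p\<close>: it leaves the value in register \<open>k\<close> and
  changes no register below \<open>k\<close>.\<close>

fun compile :: "expr \<Rightarrow> nat \<Rightarrow> nat \<Rightarrow> instr list" where
  "compile Arg p k = [Move k 0]"
| "compile Wsize p k = [WordSize k]"
| "compile (Cst c) p k = [Const k c]"
| "compile (Op f a b) p k =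
     compile a p k @ compile b (p + code_size a) (k + 1) @ [Bin f k k (k + 1)]"
| "compile (Ld a) p k = compile a p k @ [Load k k]"
| "compile (Cond t a b c d) p k = (let p1 = p + code_size a + code_size b in
     compile a p k @ compile b (p + code_size a) (k + 1) @ [jump_if t k (k + 1) (p1 + code_size d + 2)] @
     compile d (p1 + 1) k @ [Jump (p1 + code_size d + code_size c + 2)] @ compile c (p1 + code_size d + 2) k)"

lemma length_compile [simp]: "length (compile e p k) = code_size e"
  by (induction e arbitrary: p k) (auto simp: Let_def)

definition reaches :: "nat \<Rightarrow> prog \<Rightarrow> (nat \<Rightarrow> nat) \<Rightarrow> config \<Rightarrow> nat \<Rightarrow> config \<Rightarrow> bool" where
  "reaches w P M c T c' \<longleftrightarrow> (\<exists>t\<le>T. (step w P M ^^ t) c = c')"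

lemma reaches_trans:
  assumes "reaches w P M c T c'" "reaches w P M c' T' c''"
  shows "reaches w P M c (T + T') c''"
proof -
  obtain t t' where "t \<le> T" "(step w P M ^^ t) c = c'" "t' \<le> T'" "(step w P M ^^ t') c' = c''"
    using assms by (auto simp: reaches_def)
  then have "(step w P M ^^ (t' + t)) c = c''" "t' + t \<le> T + T'" by (auto simp: funpow_add)
  then show ?thesis unfolding reaches_def by blast
qed

lemma reaches_mono: "reaches w P M c T c' \<Longrightarrow> T \<le> T' \<Longrightarrow> reaches w P M c T' c'"
  unfolding reaches_def using le_trans by blast

lemma reaches_step:
  assumes "P = pre @ i # post" "p = length pre"
  shows "reaches w P M (p, R) 1 (exec_instr w M i (p, R))"
  unfolding reaches_def by (rule exI[of _ 1]) (simp add: step_def assms nth_append)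

text \<open>\<open>n\<close> is both the length of the code and the time bound: compiled code jumps
  only forward, so no instruction runs twice.\<close>

definition computes_at :: "nat \<Rightarrow> prog \<Rightarrow> (nat \<Rightarrow> nat) \<Rightarrow> nat \<Rightarrow> nat \<Rightarrow> nat \<Rightarrow> (nat \<Rightarrow> nat) \<Rightarrow> nat \<Rightarrow> bool" where
  "computes_at w P M p n k R v \<longleftrightarrow>
     (\<exists>R'. reaches w P M (p, R) n (p + n, R') \<and> R' k = v \<and> (\<forall>r<k. R' r = R r))"

lemma compile_correct:
  assumes "P = pre @ compile e p k @ post" "p = length pre" "0 < k"
  shows "computes_at w P M p (code_size e) k R (ev w M (R 0) e)"
  using assms
proof (induction e arbitrary: p k pre post R)
  case Arg
  then show ?case unfolding computes_at_def
    using reaches_step[of P pre "Move k 0" post p w M R] by (intro exI[of _ "R(k := R 0)"]) auto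
next
  case Wsize
  then show ?case unfolding computes_at_def
    using reaches_step[of P pre "WordSize k" post p w M R] by (intro exI[of _ "R(k := w)"]) auto
next
  case (Cst c)
  then show ?case unfolding computes_at_def
    using reaches_step[of P pre "Const k c" post p w M R]
    by (intro exI[of _ "R(k := c mod 2 ^ w)"]) auto
next
  case (Ld a)
  obtain R1 where 1: "reaches w P M (p, R) (code_size a) (p + code_size a, R1)"
    "R1 k = ev w M (R 0) a" "\<forall>r<k. R1 r = R r"
    using Ld.IH[of pre p k "[Load k k] @ post" R] Ld.prems by (auto simp: computes_at_def)
  have "reaches w P M (p + code_size a, R1) 1 (p + code_size a + 1, R1(k := M (R1 k)))"
    using reaches_step[of P "pre @ compile a p k" "Load k k" post "p + code_size a" w M R1] Ld.prems by simp
  from reaches_trans[OF 1(1) this] 1 show ?case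
    unfolding computes_at_def by (intro exI[of _ "R1(k := M (R1 k))"]) (auto simp: add_ac)
next
  case (Op f a b)
  obtain R1 where 1: "reaches w P M (p, R) (code_size a) (p + code_size a, R1)"
    "R1 k = ev w M (R 0) a" "\<forall>r<k. R1 r = R r"
    using Op.IH(1)[of pre p k "compile b (p + code_size a) (k + 1) @ [Bin f k k (k + 1)] @ post" R] Op.prems
    by (auto simp: computes_at_def)
  obtain R2 where 2: "reaches w P M (p + code_size a, R1) (code_size b) (p + code_size a + code_size b, R2)"
    "R2 (k + 1) = ev w M (R1 0) b" "\<forall>r<k+1. R2 r = R1 r"
    using Op.IH(2)[of "pre @ compile a p k" "p + code_size a" "k + 1" "[Bin f k k (k + 1)] @ post" R1] Op.prems
    by (auto simp: computes_at_def)
  let ?R = "R2(k := eval_binop w f (R2 k) (R2 (k + 1)))"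
  have "reaches w P M (p + code_size a + code_size b, R2) 1 (p + code_size a + code_size b + 1, ?R)"
    using reaches_step[of P "pre @ compile a p k @ compile b (p + code_size a) (k + 1)" "Bin f k k (k + 1)" post
        "p + code_size a + code_size b" w M R2] Op.prems by (simp del: fun_upd_apply)
  from reaches_trans[OF reaches_trans[OF 1(1) 2(1)] this] 1 2 \<open>0 < k\<close> show ?case
    unfolding computes_at_def by (intro exI[of _ ?R]) (auto simp: add_ac)
next
  case (Cond t a b c d)
  let ?p1 = "p + code_size a + code_size b"
  let ?A = "compile a p k" and ?B = "compile b (p + code_size a) (k + 1)"
    and ?J = "jump_if t k (k + 1) (?p1 + code_size d + 2)" and ?D = "compile d (?p1 + 1) k"
    and ?E = "Jump (?p1 + code_size d + code_size c + 2)" and ?C = "compile c (?p1 + code_size d + 2) k"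
  have P: "P = pre @ ?A @ ?B @ [?J] @ ?D @ [?E] @ ?C @ post"
    using Cond.prems(1) by (simp add: Let_def)
  have "computes_at w P M p (code_size a) k R (ev w M (R 0) a)"
    by (rule Cond.IH(1)[OF P]) (use Cond.prems in simp_all)
  then obtain R1 where 1: "reaches w P M (p, R) (code_size a) (p + code_size a, R1)"
    "R1 k = ev w M (R 0) a" "\<forall>r<k. R1 r = R r"
    unfolding computes_at_def by blast
  have "computes_at w P M (p + code_size a) (code_size b) (k + 1) R1 (ev w M (R1 0) b)"
    by (rule Cond.IH(2)[of "pre @ ?A" _ _ "[?J] @ ?D @ [?E] @ ?C @ post"])
       (use Cond.prems in \<open>simp_all add: P\<close>)
  then obtain R2 where 2: "reaches w P M (p + code_size a, R1) (code_size b) (?p1, R2)"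
    "R2 (k + 1) = ev w M (R1 0) b" "\<forall>r<k+1. R2 r = R1 r"
    unfolding computes_at_def by blast
  have "reaches w P M (?p1, R2) 1 (exec_instr w M ?J (?p1, R2))"
    by (rule reaches_step[of P "pre @ ?A @ ?B" ?J "?D @ [?E] @ ?C @ post"])
       (simp_all add: P Cond.prems(2))
  then have J: "reaches w P M (?p1, R2) 1
     (if test t (R2 k) (R2 (k + 1)) then ?p1 + code_size d + 2 else ?p1 + 1, R2)"
    unfolding exec_jump_if .
  note start = reaches_trans[OF reaches_trans[OF 1(1) 2(1)] J]
  have eqs: "R2 k = ev w M (R 0) a" "R2 (k + 1) = ev w M (R 0) b" "R2 0 = R 0" "\<forall>r<k. R2 r = R r"
    using 1 2 \<open>0 < k\<close> by auto
  have fin: ?case if "reaches w P M (p, R) (code_size a + code_size b + 1 + T) (?p1 + code_size d + code_size c + 2, R3)"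
    "T \<le> code_size c + code_size d + 1" "R3 k = ev w M (R 0) (Cond t a b c d)" "\<forall>r<k. R3 r = R2 r" for T R3
    unfolding computes_at_def using reaches_mono[OF that(1), of "code_size (Cond t a b c d)"] that(2-4) eqs(4)
    by (intro exI[of _ R3]) (simp add: add_ac)
  show ?case
  proof (cases "test t (R2 k) (R2 (k + 1))")
    case True
    have "computes_at w P M (?p1 + code_size d + 2) (code_size c) k R2 (ev w M (R2 0) c)"
      by (rule Cond.IH(3)[of "pre @ ?A @ ?B @ [?J] @ ?D @ [?E]" _ _ post])
         (use Cond.prems in \<open>simp_all add: P\<close>)
    then obtain R3 where 3: "reaches w P M (?p1 + code_size d + 2, R2) (code_size c) (?p1 + code_size d + 2 + code_size c, R3)"
      "R3 k = ev w M (R2 0) c" "\<forall>r<k. R3 r = R2 r"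
      unfolding computes_at_def by blast
    show ?thesis
      using reaches_trans[OF start[unfolded if_P[OF True]] 3(1)] 3(2,3) eqs True
      by (intro fin[of "code_size c"]) (simp_all add: add_ac)
  next
    case False
    have "computes_at w P M (?p1 + 1) (code_size d) k R2 (ev w M (R2 0) d)"
      by (rule Cond.IH(4)[of "pre @ ?A @ ?B @ [?J]" _ _ "[?E] @ ?C @ post"])
         (use Cond.prems in \<open>simp_all add: P\<close>)
    then obtain R3 where 3: "reaches w P M (?p1 + 1, R2) (code_size d) (?p1 + 1 + code_size d, R3)"
      "R3 k = ev w M (R2 0) d" "\<forall>r<k. R3 r = R2 r"
      unfolding computes_at_def by blast
    have E: "reaches w P M (?p1 + 1 + code_size d, R3) 1 (?p1 + code_size d + code_size c + 2, R3)"
      using reaches_step[of P "pre @ ?A @ ?B @ [?J] @ ?D" ?E "?C @ post" "?p1 + 1 + code_size d" w M R3] Cond.prems(2)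
      by (simp add: P)
    show ?thesis
      using reaches_trans[OF reaches_trans[OF start[unfolded if_not_P[OF False]] 3(1)] E] 3(2,3) eqs False
      by (intro fin[of "code_size d + 1"]) (simp_all add: add_ac)
  qed
qed

definition program :: "expr \<Rightarrow> prog" where
  "program e = compile e 0 1 @ [Move 0 1]"

lemma program_answers:
  "answers_within w (program e) D (code_size e + 1) q (ev w (pack w D) q e)"
proof -
  let ?R = "(\<lambda>_. 0)(0 := q)"
  obtain R where R: "reaches w (program e) (pack w D) (0, ?R) (code_size e) (code_size e, R)"
    "R 1 = ev w (pack w D) q e"
    using compile_correct[of "program e" "[]" e 0 1 "[Move 0 1]" w "pack w D" ?R]
    by (auto simp: program_def computes_at_def)
  have "reaches w (program e) (pack w D) (code_size e, R) 1 (code_size e + 1, R(0 := R 1))"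
    using reaches_step[of "program e" "compile e 0 1" "Move 0 1" "[]"] by (simp add: program_def)
  from reaches_trans[OF R(1) this] R(2) show ?thesis
    unfolding answers_within_def reaches_def by (auto simp: program_def)
qed

section \<open>Computable quantities and packed arrays\<close>

definition num :: "bool list \<Rightarrow> nat" where
  "num D = horner_sum of_bool 2 D"

text \<open>Reading the whole structure as one little-endian number turns unaligned access into
  division and remainder. Positions past the end read as zero, as in \<open>pack\<close>.\<close>

definition field :: "bool list \<Rightarrow> nat \<Rightarrow> nat \<Rightarrow> nat" where
  "field D p b = num D div 2 ^ p mod 2 ^ b"

lemma num_less: "num D < 2 ^ length D"
  unfolding num_def by (rule horner_sum_of_bool_2_less)

lemma num_append: "num (X @ Y) = num X + 2 ^ length X * num Y"
  by (simp add: num_def horner_sum_append)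

lemma pack_eq_field: "pack w D j = field D (j * w) w"
proof -
  have "num (take w (drop (j * w) D)) = num D div 2 ^ (j * w) mod 2 ^ w"
    unfolding drop_bit_eq_div[symmetric] take_bit_eq_mod[symmetric]
    by (rule bit_eqI) (auto simp: num_def bit_horner_sum_bit_iff bit_take_bit_iff bit_drop_bit_eq add_ac)
  then show ?thesis by (simp add: pack_def field_def num_def)
qed

lemma field_append: "field (X @ Y) (length X + p) b = field Y p b"
proof -
  have "num (X @ Y) div 2 ^ length X = num Y"
    using num_less[of X] by (simp add: num_append)
  then show ?thesis by (simp add: field_def power_add div_mult2_eq)
qed

definition encode :: "nat \<Rightarrow> nat list \<Rightarrow> bool list" where
  "encode b A = concat (map (\<lambda>a. map (bit a) [0..<b]) A)"

lemma length_encode [simp]: "length (encode b A) = length A * b"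
  by (induction A) (auto simp: encode_def)

lemma encode_Cons: "encode b (a # A) = map (bit a) [0..<b] @ encode b A"
  by (simp add: encode_def)

lemma field_encode:
  assumes "i < length A" "A ! i < 2 ^ b"
  shows "field (encode b A @ Y) (i * b) b = A ! i"
  using assms
proof (induction A arbitrary: i)
  case (Cons a A)
  show ?case
  proof (cases i)
    case 0
    have "num (map (bit a) [0..<b]) = a"
      using Cons.prems 0 by (simp add: num_def horner_sum_bit_eq_take_bit take_bit_nat_eq_self)
    then show ?thesis
      using 0 Cons.prems by (simp add: field_def encode_Cons num_append)
  next
    case (Suc k)
    then show ?thesis
      using Cons field_append[of "map (bit a) [0..<b]" "encode b A @ Y" "k * b" b]
      by (simp add: encode_Cons)
  qed
qed simp

section \<open>A header from which the program learns the layout\<close>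

definition header_fields :: "(nat \<times> nat list) list \<Rightarrow> nat list" where
  "header_fields arrs = map fst arrs @ map (length \<circ> snd) arrs"

definition field_width :: "(nat \<times> nat list) list \<Rightarrow> nat" where
  "field_width arrs = floorlog 2 (Max (set (0 # header_fields arrs)))"

text \<open>The first word starts with \<open>l\<close> in unary, where \<open>l\<close> is large enough for both \<open>l\<close> itself and the width
  of the header fields to be written with \<open>l\<close> bits.\<close>

definition layout :: "(nat \<times> nat list) list \<Rightarrow> bool list" where
  "layout arrs = (let b = field_width arrs; l = floorlog 2 b in
     replicate l True @ [False] @ encode l [l, b] @ encode b (header_fields arrs) @
     concat (map (\<lambda>(b, A). encode b A) arrs))"

text \<open>The two spare words keep the index of the word after any bit position below 2^w; a field
  may straddle two words. With \<open>64 <= w\<close> the unary prefix and the two numbers behind it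
  lie in the first word.\<close>

definition fits :: "nat \<Rightarrow> (nat \<times> nat list) list \<Rightarrow> bool" where
  "fits w arrs \<longleftrightarrow> 64 \<le> w \<and> length (layout arrs) + 2 * w \<le> w * 2 ^ w \<and>
     (\<forall>(b, A) \<in> set arrs. b \<le> w \<and> length A < 2 ^ w \<and> (\<forall>a\<in>set A. a < 2 ^ b))"

lemma less_floorlog: "n < 2 ^ floorlog 2 n"
proof (cases "n = 0")
  case False
  then show ?thesis using floorlog_bounds[of n 2] by simp
qed simp

lemma floorlog_power_le: "0 < n \<Longrightarrow> 2 ^ floorlog 2 n \<le> 2 * n"
  using floorlog_bounds[of n 2] by (cases "floorlog 2 n") (auto simp: floorlog_eq_zero_iff)

lemma floorlog_le: "n < 2 ^ k \<Longrightarrow> floorlog 2 n \<le> k"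
  using floorlog_leD floorlog_le_iff by auto

lemma floorlog_three: assumes "64 \<le> w" shows "3 * floorlog 2 w + 1 \<le> w"
proof (cases "floorlog 2 w \<le> 7")
  case True
  then show ?thesis using assms by linarith
next
  case False
  have *: "3 * (k + 8) + 1 \<le> (128::nat) * 2 ^ k" for k by (induction k) auto
  define k where "k = floorlog 2 w - 8"
  have k: "floorlog 2 w = k + 8" using False by (simp add: k_def)
  moreover have "2 ^ (floorlog 2 w - 1) \<le> w" using floorlog_bounds[of w 2] assms by simp
  ultimately have "128 * 2 ^ k \<le> w" by (simp add: power_add)
  then show ?thesis using *[of k] k by simp
qed

text \<open>A number whose lowest zero bit is at position \<open>l\<close> differs from its
  successor exactly in the bits 0 to \<open>l\<close>. This reads the unary prefix in constant time,
  although no instruction finds a bit.\<close>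

lemma xor_succ: "xor (2 ^ Suc l * R + (2 ^ l - 1)) (2 ^ Suc l * R + 2 ^ l) = (2 ^ Suc l - 1 :: nat)"
proof (induction l)
  case 0
  show ?case by (simp add: xor_nat_unfold[of _ "Suc _"])
next
  case (Suc l)
  let ?x = "2 ^ Suc l * R + (2 ^ l - 1) :: nat" and ?y = "2 ^ Suc l * R + 2 ^ l :: nat"
  have "2 ^ Suc (Suc l) * R + (2 ^ Suc l - 1) = 2 * ?x + 1" "2 ^ Suc (Suc l) * R + 2 ^ Suc l = 2 * ?y"
    by (cases "(2::nat) ^ l"; simp add: algebra_simps)+
  moreover have "xor (2 * x + 1) (2 * y) = 2 * xor x y + 1" for x y :: nat
    by (subst xor_nat_unfold) auto
  ultimately have "xor (2 ^ Suc (Suc l) * R + (2 ^ Suc l - 1)) (2 ^ Suc (Suc l) * R + 2 ^ Suc l) = 2 * (2 ^ Suc l - 1) + (1::nat)"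
    by (simp only: Suc)
  also have "\<dots> = 2 ^ Suc (Suc l) - 1" by (cases "(2::nat) ^ l"; simp)
  finally show ?case .
qed

section \<open>Quantities computed by one expression on a whole family of instances\<close>

locale ram =
  fixes wd :: "'i \<Rightarrow> nat" and dat :: "'i \<Rightarrow> bool list" and qry :: "'i \<Rightarrow> nat"
begin

text \<open>The expression is chosen before the instance, so uniformity and constant running time
  are part of the notion. The family \<open>F\<close> is explicit because the branch of a
  conditional has to be correct only on the instances that reach it.\<close>

definition comp :: "'i set \<Rightarrow> ('i \<Rightarrow> nat) \<Rightarrow> bool" where
  "comp F \<phi> \<longleftrightarrow> (\<exists>e. \<forall>I\<in>F. ev (wd I) (pack (wd I) (dat I)) (qry I) e = \<phi> I)"

lemma comp_cong: "comp F \<phi> \<Longrightarrow> (\<And>I. I \<in> F \<Longrightarrow> \<phi> I = \<psi> I) \<Longrightarrow> comp F \<psi>"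
  unfolding comp_def by metis

lemma comp_subset: "comp F \<phi> \<Longrightarrow> F' \<subseteq> F \<Longrightarrow> comp F' \<phi>"
  unfolding comp_def by blast

lemma comp_qry: "comp F qry"
  unfolding comp_def by (intro exI[of _ Arg]) simp

lemma comp_wd: "comp F wd"
  unfolding comp_def by (intro exI[of _ Wsize]) simp

lemma comp_const: "(\<And>I. I \<in> F \<Longrightarrow> c < 2 ^ wd I) \<Longrightarrow> comp F (\<lambda>_. c)"
  unfolding comp_def by (intro exI[of _ "Cst c"]) simp

lemma comp_binop:
  assumes "comp F \<phi>" "comp F \<psi>" shows "comp F (\<lambda>I. eval_binop (wd I) f (\<phi> I) (\<psi> I))"
proof -
  obtain a b where "\<forall>I\<in>F. ev (wd I) (pack (wd I) (dat I)) (qry I) a = \<phi> I"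
    "\<forall>I\<in>F. ev (wd I) (pack (wd I) (dat I)) (qry I) b = \<psi> I"
    using assms by (auto simp: comp_def)
  then show ?thesis unfolding comp_def by (intro exI[of _ "Op f a b"]) simp
qed

lemma comp_load:
  assumes "comp F \<phi>" shows "comp F (\<lambda>I. pack (wd I) (dat I) (\<phi> I))"
proof -
  obtain a where "\<forall>I\<in>F. ev (wd I) (pack (wd I) (dat I)) (qry I) a = \<phi> I"
    using assms by (auto simp: comp_def)
  then show ?thesis unfolding comp_def by (intro exI[of _ "Ld a"]) simp
qed

lemma comp_add:
  "comp F \<phi> \<Longrightarrow> comp F \<psi> \<Longrightarrow> (\<And>I. I \<in> F \<Longrightarrow> \<phi> I + \<psi> I < 2 ^ wd I) \<Longrightarrow> comp F (\<lambda>I. \<phi> I + \<psi> I)"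
  by (rule comp_cong, rule comp_binop[where f = Add and \<phi> = \<phi> and \<psi> = \<psi>]) auto

lemma comp_mult:
  "comp F \<phi> \<Longrightarrow> comp F \<psi> \<Longrightarrow> (\<And>I. I \<in> F \<Longrightarrow> \<phi> I * \<psi> I < 2 ^ wd I) \<Longrightarrow> comp F (\<lambda>I. \<phi> I * \<psi> I)"
  by (rule comp_cong, rule comp_binop[where f = Mul and \<phi> = \<phi> and \<psi> = \<psi>]) auto

lemma comp_diff:
  assumes "comp F \<phi>" "comp F \<psi>" "\<And>I. I \<in> F \<Longrightarrow> \<psi> I \<le> \<phi> I" "\<And>I. I \<in> F \<Longrightarrow> \<phi> I < 2 ^ wd I"
  shows "comp F (\<lambda>I. \<phi> I - \<psi> I)"
proof (rule comp_cong, rule comp_binop[where f = Sub, OF assms(1,2)])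
  fix I assume I: "I \<in> F"
  have "\<phi> I + (2 ^ wd I - \<psi> I) = 2 ^ wd I + (\<phi> I - \<psi> I)"
    using assms(3,4)[OF I] by simp
  then show "eval_binop (wd I) Sub (\<phi> I) (\<psi> I) = \<phi> I - \<psi> I"
    using assms(4)[OF I] by (simp only: eval_binop.simps mod_add_self1) (simp add: less_imp_diff_less)
qed

lemma comp_div: "comp F \<phi> \<Longrightarrow> comp F \<psi> \<Longrightarrow> comp F (\<lambda>I. \<phi> I div \<psi> I)"
  by (rule comp_cong, rule comp_binop[where f = Div and \<phi> = \<phi> and \<psi> = \<psi>]) auto

lemma comp_mod: "comp F \<phi> \<Longrightarrow> comp F \<psi> \<Longrightarrow> comp F (\<lambda>I. \<phi> I mod \<psi> I)"
  by (rule comp_cong, rule comp_binop[where f = Mod and \<phi> = \<phi> and \<psi> = \<psi>]) auto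

lemma comp_shl: "comp F \<phi> \<Longrightarrow> comp F \<psi> \<Longrightarrow> comp F (\<lambda>I. \<phi> I * 2 ^ \<psi> I mod 2 ^ wd I)"
  by (rule comp_cong, rule comp_binop[where f = Shl and \<phi> = \<phi> and \<psi> = \<psi>]) (auto simp: push_bit_eq_mult)

lemma comp_shr: "comp F \<phi> \<Longrightarrow> comp F \<psi> \<Longrightarrow> comp F (\<lambda>I. \<phi> I div 2 ^ \<psi> I)"
  by (rule comp_cong, rule comp_binop[where f = Shr and \<phi> = \<phi> and \<psi> = \<psi>]) (auto simp: drop_bit_eq_div)

lemma comp_cond:
  assumes "comp F \<phi>" "comp F \<psi>" "comp {I\<in>F. test t (\<phi> I) (\<psi> I)} \<alpha>" "comp {I\<in>F. \<not> test t (\<phi> I) (\<psi> I)} \<beta>"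
  shows "comp F (\<lambda>I. if test t (\<phi> I) (\<psi> I) then \<alpha> I else \<beta> I)"
proof -
  let ?ev = "\<lambda>I. ev (wd I) (pack (wd I) (dat I)) (qry I)"
  obtain a b where "\<And>I. I \<in> F \<Longrightarrow> ?ev I a = \<phi> I" "\<And>I. I \<in> F \<Longrightarrow> ?ev I b = \<psi> I"
    using assms(1,2) by (auto simp: comp_def)
  moreover obtain c where "\<And>I. I \<in> F \<Longrightarrow> test t (\<phi> I) (\<psi> I) \<Longrightarrow> ?ev I c = \<alpha> I"
    using assms(3) by (auto simp: comp_def)
  moreover obtain d where "\<And>I. I \<in> F \<Longrightarrow> \<not> test t (\<phi> I) (\<psi> I) \<Longrightarrow> ?ev I d = \<beta> I"
    using assms(4) by (auto simp: comp_def)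
  ultimately show ?thesis unfolding comp_def by (intro exI[of _ "Cond t a b c d"]) simp
qed

lemmas comp_if_eq = comp_cond[where t = True, simplified]
lemmas comp_if_less = comp_cond[where t = False, simplified]

text \<open>Bit positions may exceed the word size, so they are handled as pairs of a word index and an offset.\<close>

definition comp_pos :: "'i set \<Rightarrow> ('i \<Rightarrow> nat) \<Rightarrow> bool" where
  "comp_pos F p \<longleftrightarrow> comp F (\<lambda>I. p I div wd I) \<and> comp F (\<lambda>I. p I mod wd I)"

text \<open>The product \<open>i * b\<close> may overflow, so \<open>i\<close> is first divided by
  the word size w: the quotient contributes \<open>(i div w) * b\<close> whole words, and the
  remainder at most \<open>(w - 1) * w\<close> bits, which is less than 2^w.\<close>

lemma comp_pos_add:
  assumes "comp_pos F p" "comp F i" "comp F b"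
    and "\<And>I. I \<in> F \<Longrightarrow> b I \<le> wd I" "\<And>I. I \<in> F \<Longrightarrow> 64 \<le> wd I"
    and "\<And>I. I \<in> F \<Longrightarrow> (p I + i I * b I) div wd I < 2 ^ wd I"
  shows "comp_pos F (\<lambda>I. p I + i I * b I)"
proof -
  let ?s = "\<lambda>I. (i I mod wd I) * b I + p I mod wd I"
  have small: "?s I < 2 ^ wd I" if "I \<in> F" for I
  proof -
    let ?w = "wd I"
    have w: "?w > 0" using assms(5)[OF that] by simp
    have "(i I mod ?w) * b I \<le> (?w - 1) * ?w"
      using w assms(4)[OF that] by (intro mult_le_mono) (auto simp: Suc_leI less_Suc_eq_le[symmetric])
    moreover have "p I mod ?w < ?w" using w by simp
    moreover have "(?w - 1) * ?w + ?w = ?w * ?w" using w by (cases ?w) auto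
    ultimately have "?s I < ?w * ?w" by linarith
    also have "\<dots> \<le> 2 ^ ?w"
    proof -
      have "(k + 4) * (k + 4) \<le> 16 * (2::nat) ^ k" for k
      proof (induction k)
        case (Suc k)
        have "(Suc k + 4) * (Suc k + 4) \<le> 2 * ((k + 4) * (k + 4))" by (simp add: algebra_simps)
        then show ?case using Suc by simp
      qed simp
      from this[of "?w - 4"] show ?thesis
        using assms(5)[OF that] power_add[of "2::nat" "?w - 4" 4] by simp
    qed
    finally show ?thesis .
  qed
  have P: "comp F (\<lambda>I. p I div wd I)" "comp F (\<lambda>I. p I mod wd I)"
    using assms(1) by (auto simp: comp_pos_def)
  have s: "comp F ?s"
    by (rule comp_add[OF comp_mult[OF comp_mod[OF assms(2) comp_wd] assms(3)] P(2)])
       (use small in \<open>auto intro: le_less_trans[OF _ small]\<close>)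
  have eq: "p I + i I * b I = ((p I div wd I) + (i I div wd I) * b I) * wd I + ?s I" for I
  proof -
    have "p I + i I * b I = (p I div wd I * wd I + p I mod wd I) + (i I div wd I * wd I + i I mod wd I) * b I"
      by simp
    then show ?thesis by (simp only: algebra_simps)
  qed
  have eq1: "(p I + i I * b I) div wd I = (p I div wd I + (i I div wd I) * b I) + ?s I div wd I"
    and eq2: "(p I + i I * b I) mod wd I = ?s I mod wd I" if "I \<in> F" for I
  proof -
    have "wd I \<noteq> 0" using assms(5)[OF that] by simp
    then show "(p I + i I * b I) div wd I = (p I div wd I + (i I div wd I) * b I) + ?s I div wd I"
      unfolding eq by (rule div_mult_self3)
    show "(p I + i I * b I) mod wd I = ?s I mod wd I" unfolding eq by (rule mod_mult_self3)
  qed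
  have "comp F (\<lambda>I. (p I div wd I + (i I div wd I) * b I) + ?s I div wd I)"
  proof (rule comp_add[OF comp_add[OF P(1) comp_mult[OF comp_div[OF assms(2) comp_wd] assms(3)]]
        comp_div[OF s comp_wd]])
    fix I assume I: "I \<in> F"
    have *: "(p I div wd I + (i I div wd I) * b I) + ?s I div wd I < 2 ^ wd I"
      using assms(6)[OF I] eq1[OF I] by simp
    show "i I div wd I * b I < 2 ^ wd I"
      "p I div wd I + (i I div wd I) * b I < 2 ^ wd I"
      "(p I div wd I + (i I div wd I) * b I) + ?s I div wd I < 2 ^ wd I" using * by linarith+
  qed
  moreover have "comp F (\<lambda>I. ?s I mod wd I)" by (intro comp_mod s comp_wd)
  ultimately show ?thesis unfolding comp_pos_def
    using comp_cong[of F _ "\<lambda>I. (p I + i I * b I) div wd I", OF _ eq1[symmetric]]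
      comp_cong[of F _ "\<lambda>I. (p I + i I * b I) mod wd I", OF _ eq2[symmetric]] by simp
qed

text \<open>A field meets at most two consecutive words, and their shifted parts occupy disjoint
  bits, so the sum cannot overflow. For \<open>t = 0\<close> the second word is shifted by
  \<open>w\<close> positions and vanishes.\<close>

lemma word_pair_field:
  fixes V w P t b :: nat
  assumes "t < w" "b \<le> w"
  shows "(V div 2 ^ (P * w) mod 2 ^ w div 2 ^ t +
     (V div 2 ^ ((P + 1) * w) mod 2 ^ w) * 2 ^ (w - t) mod 2 ^ w) mod 2 ^ b = V div 2 ^ (P * w + t) mod 2 ^ b"
    and "V div 2 ^ (P * w) mod 2 ^ w div 2 ^ t +
     (V div 2 ^ ((P + 1) * w) mod 2 ^ w) * 2 ^ (w - t) mod 2 ^ w < 2 ^ w"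
proof -
  define U where "U = V div 2 ^ (P * w)"
  have U1: "V div 2 ^ ((P + 1) * w) = U div 2 ^ w"
    by (simp add: U_def power_add div_mult2_eq[symmetric] mult.commute)
  have w: "(2::nat) ^ w = 2 ^ (w - t) * 2 ^ t" using assms by (simp add: power_add[symmetric])
  have hi: "(U div 2 ^ w mod 2 ^ w) * 2 ^ (w - t) mod 2 ^ w = 2 ^ (w - t) * (U div 2 ^ w mod 2 ^ t)"
  proof -
    have "(U div 2 ^ w mod 2 ^ w) * 2 ^ (w - t) mod 2 ^ w = 2 ^ (w - t) * (U div 2 ^ w) mod (2 ^ (w - t) * 2 ^ t)"
      unfolding w[symmetric] by (simp add: mod_mult_right_eq mult.commute)
    then show ?thesis by (simp only: mult_mod_right)
  qed
  have "U div 2 ^ t = (U mod 2 ^ w + (U div 2 ^ w * 2 ^ (w - t)) * 2 ^ t) div 2 ^ t"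
    by (simp only: mult.assoc w[symmetric]) (simp add: mult.commute)
  also have "\<dots> = U mod 2 ^ w div 2 ^ t + U div 2 ^ w * 2 ^ (w - t)" by simp
  finally have Ut: "U div 2 ^ t = U mod 2 ^ w div 2 ^ t + 2 ^ (w - t) * (U div 2 ^ w)" by simp
  have "U div 2 ^ w = U div 2 ^ w mod 2 ^ t + 2 ^ t * (U div 2 ^ w div 2 ^ t)" by simp
  then have "U div 2 ^ t = U mod 2 ^ w div 2 ^ t + 2 ^ (w - t) * (U div 2 ^ w mod 2 ^ t) + 2 ^ w * (U div 2 ^ w div 2 ^ t)"
    using Ut by (simp only: w mult.assoc distrib_left[symmetric] add.assoc)
  moreover have "(2::nat) ^ w = 2 ^ b * 2 ^ (w - b)" using assms by (simp add: power_add[symmetric])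
  ultimately have "U div 2 ^ t mod 2 ^ b = (U mod 2 ^ w div 2 ^ t + 2 ^ (w - t) * (U div 2 ^ w mod 2 ^ t)) mod 2 ^ b"
    by (simp only: mult.assoc mod_mult_self2)
  moreover have "V div 2 ^ (P * w + t) = U div 2 ^ t" by (simp add: U_def power_add div_mult2_eq)
  ultimately show "(V div 2 ^ (P * w) mod 2 ^ w div 2 ^ t +
     (V div 2 ^ ((P + 1) * w) mod 2 ^ w) * 2 ^ (w - t) mod 2 ^ w) mod 2 ^ b = V div 2 ^ (P * w + t) mod 2 ^ b"
    unfolding U1 U_def[symmetric] hi by simp
  have "U mod 2 ^ w div 2 ^ t < 2 ^ (w - t)"
    by (metis less_mult_imp_div_less mod_less_divisor w zero_less_numeral zero_less_power)
  moreover have "2 ^ (w - t) * (U div 2 ^ w mod 2 ^ t) \<le> 2 ^ (w - t) * (2 ^ t - 1)"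
    by (intro mult_le_mono) (auto simp: Suc_leI less_Suc_eq_le[symmetric])
  moreover have "2 ^ (w - t) * (2 ^ t - 1) + 2 ^ (w - t) = (2::nat) ^ w"
    unfolding w by (simp add: algebra_simps diff_mult_distrib2)
  ultimately show "V div 2 ^ (P * w) mod 2 ^ w div 2 ^ t +
     (V div 2 ^ ((P + 1) * w) mod 2 ^ w) * 2 ^ (w - t) mod 2 ^ w < 2 ^ w"
    unfolding U1 U_def[symmetric] hi by linarith
qed

lemma comp_field:
  assumes "comp_pos F p" "comp F b"
    and "\<And>I. I \<in> F \<Longrightarrow> b I \<le> wd I" "\<And>I. I \<in> F \<Longrightarrow> 1 \<le> wd I"
    and "\<And>I. I \<in> F \<Longrightarrow> p I div wd I + 1 < 2 ^ wd I"
  shows "comp F (\<lambda>I. field (dat I) (p I) (b I))"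
proof -
  let ?lo = "\<lambda>I. pack (wd I) (dat I) (p I div wd I) div 2 ^ (p I mod wd I)"
  let ?hi = "\<lambda>I. pack (wd I) (dat I) (p I div wd I + 1) * 2 ^ (wd I - p I mod wd I) mod 2 ^ wd I"
  have one: "comp F (\<lambda>_. 1)" by (intro comp_const one_less_power) (use assms(4) in \<open>auto simp: Suc_le_eq\<close>)
  have P: "comp F (\<lambda>I. p I div wd I)" "comp F (\<lambda>I. p I mod wd I)"
    using assms(1) by (auto simp: comp_pos_def)
  have t: "p I mod wd I < wd I" if "I \<in> F" for I using assms(4)[OF that] by simp
  have eq: "(?lo I + ?hi I) mod 2 ^ b I = field (dat I) (p I) (b I)" and lt: "?lo I + ?hi I < 2 ^ wd I"
    if "I \<in> F" for I
    unfolding pack_eq_field field_def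
    using word_pair_field[OF t[OF that] assms(3)[OF that], of "num (dat I)" "p I div wd I"] by auto
  have lo: "comp F ?lo" by (rule comp_shr[OF comp_load[OF P(1)] P(2)])
  have "comp F (\<lambda>I. p I div wd I + 1)" by (rule comp_add[OF P(1) one]) (use assms in auto)
  moreover have "comp F (\<lambda>I. wd I - p I mod wd I)"
    by (rule comp_diff[OF comp_wd P(2)]) (use t in \<open>auto intro: less_imp_le\<close>)
  ultimately have hi: "comp F ?hi" by (rule comp_shl[OF comp_load])
  \<comment> \<open>For \<open>b I = wd I\<close> the divisor wraps around to 0, and the convention
    \<open>x mod 0 = x\<close> gives the right value.\<close>
  have "comp F (\<lambda>I. (?lo I + ?hi I) mod (1 * 2 ^ b I mod 2 ^ wd I))"
    by (rule comp_mod[OF comp_add[OF lo hi lt] comp_shl[OF one assms(2)]])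
  then show ?thesis
  proof (rule comp_cong)
    fix I assume I: "I \<in> F"
    show "(?lo I + ?hi I) mod (1 * 2 ^ b I mod 2 ^ wd I) = field (dat I) (p I) (b I)"
    proof (cases "b I = wd I")
      case True
      then show ?thesis using eq[OF I] lt[OF I] by simp
    next
      case False
      then have "(2::nat) ^ b I < 2 ^ wd I" using assms(3)[OF I] by simp
      then show ?thesis using eq[OF I] by simp
    qed
  qed
qed

text \<open>Nothing is promised for an index out of range. An access that may fail is put under a
  conditional and considered on the subfamily where the index is valid.\<close>

definition readable :: "'i set \<Rightarrow> ('i \<Rightarrow> nat list) \<Rightarrow> bool" where
  "readable F A \<longleftrightarrow> (\<forall>i. comp F i \<longrightarrow> (\<forall>I\<in>F. i I < length (A I)) \<longrightarrow> comp F (\<lambda>I. A I ! i I))"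

lemma readableD:
  "readable F A \<Longrightarrow> comp F i \<Longrightarrow> (\<And>I. I \<in> F \<Longrightarrow> i I < length (A I)) \<Longrightarrow> comp F (\<lambda>I. A I ! i I)"
  by (simp add: readable_def)

end

section \<open>Random access to the arrays of a layout\<close>

definition start :: "(nat \<times> nat list) list \<Rightarrow> nat \<Rightarrow> nat" where
  "start arrs j = (let b = field_width arrs; l = floorlog 2 b in
     3 * l + 1 + 2 * length arrs * b + length (concat (map (\<lambda>(b, A). encode b A) (take j arrs))))"

lemma header_fields_length [simp]: "length (header_fields arrs) = 2 * length arrs"
  by (simp add: header_fields_def)

lemma start_Suc:
  assumes "j < length arrs"
  shows "start arrs (Suc j) = start arrs j + length (snd (arrs ! j)) * fst (arrs ! j)"
  using assms by (simp add: start_def Let_def take_Suc_conv_app_nth split: prod.splits)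

lemma start_length: "start arrs (length arrs) = length (layout arrs)"
  by (simp add: start_def layout_def Let_def)

lemma start_mono: "j \<le> k \<Longrightarrow> k \<le> length arrs \<Longrightarrow> start arrs j \<le> start arrs k"
proof (induction k)
  case (Suc k)
  then show ?case by (cases "j = Suc k") (auto simp: start_Suc le_Suc_eq)
qed simp

lemma field_array:
  assumes "j < length arrs" "i < length (snd (arrs ! j))" "snd (arrs ! j) ! i < 2 ^ fst (arrs ! j)"
  shows "field (layout arrs) (start arrs j + i * fst (arrs ! j)) (fst (arrs ! j)) = snd (arrs ! j) ! i"
proof -
  let ?c = "\<lambda>xs. concat (map (\<lambda>(b, A). encode b A) xs)"
  let ?b = "field_width arrs" let ?l = "floorlog 2 ?b"
  let ?H = "replicate ?l True @ [False] @ encode ?l [?l, ?b] @ encode ?b (header_fields arrs) @ ?c (take j arrs)"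
  have "?c arrs = ?c (take j arrs) @ encode (fst (arrs ! j)) (snd (arrs ! j)) @ ?c (drop (Suc j) arrs)"
    using id_take_nth_drop[OF assms(1)] by (metis (no_types, lifting) concat.simps(2) concat_append list.simps(9) map_append split_beta)
  then have "layout arrs = ?H @ (encode (fst (arrs ! j)) (snd (arrs ! j)) @ ?c (drop (Suc j) arrs))"
    by (simp add: layout_def Let_def)
  moreover have "start arrs j = length ?H" by (simp add: start_def Let_def)
  ultimately show ?thesis
    using field_append[of ?H] field_encode[OF assms(2,3)] by simp
qed

lemma field_header:
  assumes "i < 2 * length arrs"
  shows "field (layout arrs) (3 * floorlog 2 (field_width arrs) + 1 + i * field_width arrs) (field_width arrs)
    = header_fields arrs ! i"
proof -
  let ?b = "field_width arrs" let ?l = "floorlog 2 ?b"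
  let ?H = "replicate ?l True @ [False] @ encode ?l [?l, ?b]"
  have "header_fields arrs ! i \<in> set (header_fields arrs)" using assms by (intro nth_mem) simp
  then have "header_fields arrs ! i \<le> Max (set (0 # header_fields arrs))" by (intro Max_ge) auto
  also have "\<dots> < 2 ^ ?b" unfolding field_width_def by (rule less_floorlog)
  finally have "field (encode ?b (header_fields arrs) @ Y) (i * ?b) ?b = header_fields arrs ! i" for Y
    using assms by (intro field_encode) auto
  then show ?thesis
    using field_append[of ?H "encode ?b (header_fields arrs) @ concat (map (\<lambda>(b, A). encode b A) arrs)" "i * ?b" ?b]
    by (simp add: layout_def Let_def eval_nat_numeral add_ac)
qed

lemma fits_field_width:
  assumes "fits w arrs"
  shows "field_width arrs \<le> w" "3 * floorlog 2 (field_width arrs) + 1 \<le> w"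
proof -
  have w: "w < 2 ^ w" by simp
  have "x < 2 ^ w" if "x \<in> set (0 # header_fields arrs)" for x
    using that assms le_less_trans[OF _ w] by (fastforce simp: fits_def header_fields_def)
  then have "Max (set (0 # header_fields arrs)) < 2 ^ w" by (subst Max_less_iff) auto
  then show le: "field_width arrs \<le> w" unfolding field_width_def by (rule floorlog_le)
  have "floorlog 2 (field_width arrs) \<le> floorlog 2 w" using le by (rule floorlog_mono)
  then show "3 * floorlog 2 (field_width arrs) + 1 \<le> w"
    using floorlog_three[of w] assms by (simp add: fits_def)
qed

lemma div_mod_power_split: "x mod (2 ^ p * 2 ^ k) div 2 ^ p = x div 2 ^ p mod (2 ^ k :: nat)"
  by (simp add: mod_mult2_eq)

text \<open>The unary prefix yields only the mask 2^l. The number \<open>l\<close> itself follows in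
  binary because no instruction computes it from 2^l.\<close>

lemma first_word:
  fixes arrs defines "b \<equiv> field_width arrs"
  defines "l \<equiv> floorlog 2 b"
  assumes "fits w arrs"
  defines "x \<equiv> pack w (layout arrs) 0"
  shows "xor x (x + 1) + 1 = 2 ^ (l + 1)" "x + 1 < 2 ^ w"
    "x div 2 ^ (l + 1) mod 2 ^ l = l" "x div 2 ^ (2 * l + 1) mod 2 ^ l = b"
proof -
  define N where "N = num (layout arrs)"
  have lw: "3 * l + 1 \<le> w" using fits_field_width(2)[OF assms(3)] by (simp add: l_def b_def)
  have x: "x = N mod 2 ^ w" by (simp add: x_def pack_eq_field field_def N_def)
  let ?Y = "encode l [l, b] @ encode b (header_fields arrs) @ concat (map (\<lambda>(b, A). encode b A) arrs)"
  have lay: "layout arrs = (replicate l True @ [False]) @ ?Y"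
    by (simp add: layout_def Let_def l_def b_def)
  have "num (replicate l True) = 2 ^ l - 1"
  proof (induction l)
    case (Suc l)
    then have "num (replicate (Suc l) True) = 1 + 2 * (2 ^ l - 1)" by (simp add: num_def)
    then show ?case by (cases "(2::nat) ^ l"; simp)
  qed (simp add: num_def)
  then have one: "num (replicate l True @ [False]) = 2 ^ l - 1" by (simp add: num_append) (simp add: num_def)
  have N: "N = 2 ^ l - 1 + 2 ^ (l + 1) * num ?Y"
    unfolding N_def lay num_append[of "replicate l True @ [False]"] one by simp
  define R where "R = num ?Y mod 2 ^ (w - (l + 1))"
  have wsplit: "(2::nat) ^ w = 2 ^ (l + 1) * 2 ^ (w - (l + 1))"
    using lw by (simp only: power_add[symmetric]) simp
  have lt: "2 ^ l - 1 < (2::nat) ^ (l + 1)" by (simp add: less_imp_diff_less)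
  have "x mod 2 ^ (l + 1) = 2 ^ l - 1"
  proof -
    have "x mod 2 ^ (l + 1) = N mod 2 ^ (l + 1)"
      unfolding x wsplit by (rule mod_mod_cancel) simp
    also have "\<dots> = 2 ^ l - 1" unfolding N mod_mult_self2 using lt by (rule mod_less)
    finally show ?thesis .
  qed
  then have xR: "x = 2 ^ Suc l * (x div 2 ^ Suc l) + (2 ^ l - 1)"
    using mult_div_mod_eq[of "2 ^ Suc l" x] by simp
  have x1: "x + 1 = 2 ^ Suc l * (x div 2 ^ Suc l) + 2 ^ l"
  proof -
    have "(2 ^ l - 1) + 1 = (2::nat) ^ l" by simp
    then show ?thesis using xR by (metis add.assoc)
  qed
  have "xor x (x + 1) = 2 ^ Suc l - 1"
    using xor_succ[of l "x div 2 ^ Suc l"] unfolding xR[symmetric] x1[symmetric] .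
  then show "xor x (x + 1) + 1 = 2 ^ (l + 1)" by simp
  have "x < 2 ^ w" by (simp add: x)
  \<comment> \<open>The zero bit at position \<open>l\<close> lies inside the word, so
    \<open>x\<close> is not the word of all ones.\<close>
  moreover have "x + 1 \<noteq> 2 ^ w"
  proof
    assume "x + 1 = 2 ^ w"
    then have "2 ^ Suc l dvd x + 1" using wsplit by simp
    then have "(2::nat) ^ Suc l dvd 2 ^ l" unfolding x1 by (simp add: dvd_add_right_iff)
    then have "(2::nat) ^ Suc l \<le> 2 ^ l" by (rule dvd_imp_le) simp
    then show False by simp
  qed
  ultimately show "x + 1 < 2 ^ w" by simp
  have fld: "x div 2 ^ p mod 2 ^ l = field (layout arrs) p l" if "p + l \<le> w" for p
  proof -
    have e: "(2::nat) ^ w = 2 ^ p * 2 ^ (w - p)" using that by (simp add: power_add[symmetric])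
    have "x div 2 ^ p mod 2 ^ l = N div 2 ^ p mod 2 ^ (w - p) mod 2 ^ l"
      unfolding x e by (simp only: div_mod_power_split)
    also have "\<dots> = N div 2 ^ p mod 2 ^ l"
      using that by (intro mod_mod_cancel le_imp_power_dvd) simp
    finally show ?thesis by (simp add: field_def N_def)
  qed
  have small: "[l, b] ! i < 2 ^ l" if "i < 2" for i
    using that less_floorlog[of b] by (cases i) (auto simp: l_def)
  have "field (layout arrs) (l + 1 + i * l) l = [l, b] ! i" if "i < 2" for i
    using field_append[of "replicate l True @ [False]" ?Y "i * l" l] field_encode[of i "[l, b]" l] small[OF that] that
    by (simp add: lay)
  from this[of 0] this[of 1] fld[of "l + 1"] fld[of "2 * l + 1"] lw
  show "x div 2 ^ (l + 1) mod 2 ^ l = l" "x div 2 ^ (2 * l + 1) mod 2 ^ l = b"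
    by (simp_all add: mult_2)
qed

lemma (in ram) comp_pos_cong:
  assumes "comp_pos F p" "\<And>I. I \<in> F \<Longrightarrow> p I = p' I" shows "comp_pos F p'"
  using assms unfolding comp_pos_def
  by (auto intro: comp_cong[of F "\<lambda>I. p I div wd I"] comp_cong[of F "\<lambda>I. p I mod wd I"])

locale stored = ram +
  fixes F :: "'a set" and arrs :: "'a \<Rightarrow> (nat \<times> nat list) list" and J :: nat
  assumes dat: "I \<in> F \<Longrightarrow> dat I = layout (arrs I)"
    and fits: "I \<in> F \<Longrightarrow> fits (wd I) (arrs I)"
    and len: "I \<in> F \<Longrightarrow> length (arrs I) = J"
begin

lemma wd_ge: "I \<in> F \<Longrightarrow> 64 \<le> wd I"
  using fits by (auto simp: fits_def)

lemma small_const: "c \<le> 64 \<Longrightarrow> comp F (\<lambda>_. c)"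
proof (rule comp_const)
  fix I assume "c \<le> 64" "I \<in> F"
  then have "c \<le> wd I" using wd_ge by fastforce
  then show "c < 2 ^ wd I" by (rule le_less_trans) simp
qed

lemma comp_header_width:
  "comp F (\<lambda>I. floorlog 2 (field_width (arrs I)))" "comp F (\<lambda>I. field_width (arrs I))"
proof -
  let ?x = "\<lambda>I. pack (wd I) (dat I) 0" let ?l = "\<lambda>I. floorlog 2 (field_width (arrs I))"
  have x: "comp F ?x" by (rule comp_load[OF small_const]) simp
  have fw: "xor (?x I) (?x I + 1) + 1 = 2 ^ (?l I + 1)" "?x I + 1 < 2 ^ wd I"
    "?x I div 2 ^ (?l I + 1) mod 2 ^ ?l I = ?l I" "?x I div 2 ^ (2 * ?l I + 1) mod 2 ^ ?l I = field_width (arrs I)"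
    "3 * ?l I + 1 \<le> wd I" if "I \<in> F" for I
    using first_word[OF fits[OF that]] fits_field_width[OF fits[OF that]] unfolding dat[OF that] by auto
  have x1: "comp F (\<lambda>I. ?x I + 1)" by (rule comp_add[OF x small_const]) (use fw in auto)
  have "comp F (\<lambda>I. eval_binop (wd I) Xor (?x I) (?x I + 1) + 1)"
  proof (rule comp_add[OF comp_binop[OF x x1] small_const])
    fix I assume I: "I \<in> F"
    have "(2::nat) ^ (?l I + 1) < 2 ^ wd I" using fw(5)[OF I] wd_ge[OF I] by (intro power_strict_increasing) auto
    then show "eval_binop (wd I) Xor (?x I) (?x I + 1) + 1 < 2 ^ wd I" using fw(1)[OF I] by simp
  qed simp
  then have T: "comp F (\<lambda>I. 2 ^ (?l I + 1))" by (rule comp_cong) (use fw(1) in auto)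
  have "comp F (\<lambda>I. 2 ^ (?l I + 1) div 2)" by (rule comp_div[OF T small_const]) simp
  then have H: "comp F (\<lambda>I. 2 ^ ?l I)" by (rule comp_cong) simp
  have "comp F (\<lambda>I. ?x I div 2 ^ (?l I + 1) mod 2 ^ ?l I)" by (rule comp_mod[OF comp_div[OF x T] H])
  then show "comp F ?l" by (rule comp_cong) (use fw(3) in auto)
  have "comp F (\<lambda>I. ?x I div 2 ^ (?l I + 1) div 2 ^ ?l I mod 2 ^ ?l I)"
    by (rule comp_mod[OF comp_div[OF comp_div[OF x T] H] H])
  then show "comp F (\<lambda>I. field_width (arrs I))"
  proof (rule comp_cong)
    fix I assume I: "I \<in> F"
    have "?x I div 2 ^ (?l I + 1) div 2 ^ ?l I = ?x I div 2 ^ (2 * ?l I + 1)"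
      by (simp add: div_mult2_eq[symmetric] power_add[symmetric] mult_2 power_Suc[symmetric] del: power_Suc)
    then show "?x I div 2 ^ (?l I + 1) div 2 ^ ?l I mod 2 ^ ?l I = field_width (arrs I)" using fw(4)[OF I] by simp
  qed
qed

lemma pos_in_range:
  assumes "I \<in> F" "p \<le> length (layout (arrs I))"
  shows "p div wd I + 1 < 2 ^ wd I"
proof -
  have "p + 2 * wd I \<le> wd I * 2 ^ wd I" using fits[OF assms(1)] assms(2) by (auto simp: fits_def)
  then have "(p + 2 * wd I) div wd I \<le> 2 ^ wd I"
    by (metis div_le_mono nonzero_mult_div_cancel_left wd_ge[OF assms(1)] le_zero_eq zero_neq_numeral)
  moreover have "(p + 2 * wd I) div wd I = p div wd I + 2" using wd_ge[OF assms(1)] by simp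
  ultimately show ?thesis by simp
qed

lemma comp_pos_header: "comp_pos F (\<lambda>I. 3 * floorlog 2 (field_width (arrs I)) + 1)"
proof -
  let ?l = "\<lambda>I. floorlog 2 (field_width (arrs I))"
  have "comp F (\<lambda>I. 3 * ?l I + 1)"
  proof (rule comp_add[OF comp_mult[OF small_const comp_header_width(1)] small_const])
    fix I assume I: "I \<in> F"
    have "3 * ?l I + 1 < 2 ^ wd I"
      using fits_field_width(2)[OF fits[OF I]] by (rule le_less_trans) simp
    then show "3 * ?l I + 1 < 2 ^ wd I" "3 * ?l I < 2 ^ wd I" by auto
  qed auto
  then show ?thesis unfolding comp_pos_def by (intro conjI comp_div comp_mod comp_wd)
qed

lemma header_pos_in_range:
  assumes "I \<in> F" "n \<le> 2 * J"
  shows "3 * floorlog 2 (field_width (arrs I)) + 1 + n * field_width (arrs I) \<le> length (layout (arrs I))"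
    (is "?p \<le> _")
proof -
  have "n * field_width (arrs I) \<le> 2 * length (arrs I) * field_width (arrs I)"
    using assms len by (intro mult_le_mono) auto
  then have "?p \<le> start (arrs I) 0" by (simp add: start_def Let_def)
  also have "\<dots> \<le> length (layout (arrs I))"
    using start_mono[of 0 "length (arrs I)" "arrs I"] by (simp add: start_length)
  finally show ?thesis .
qed

lemma comp_header_pos:
  "n \<le> 2 * J \<Longrightarrow> comp_pos F (\<lambda>I. 3 * floorlog 2 (field_width (arrs I)) + 1 + n * field_width (arrs I))"
proof (induction n)
  case 0
  then show ?case using comp_pos_header by simp
next
  case (Suc n)
  let ?b = "\<lambda>I. field_width (arrs I)"
  let ?p = "\<lambda>I. 3 * floorlog 2 (?b I) + 1 + n * ?b I"
  have "comp_pos F (\<lambda>I. ?p I + 1 * ?b I)"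
  proof (rule comp_pos_add)
    show "comp_pos F ?p" using Suc by simp
    show "(?p I + 1 * ?b I) div wd I < 2 ^ wd I" if "I \<in> F" for I
      using pos_in_range[OF that header_pos_in_range[OF that Suc.prems]] by (simp add: add_ac)
    show "?b I \<le> wd I" if "I \<in> F" for I using fits_field_width(1)[OF fits[OF that]] .
  qed (use comp_header_width small_const[of 1] wd_ge in auto)
  then show ?case by (simp add: add_ac)
qed

lemma comp_header_field:
  assumes "i < 2 * J"
  shows "comp F (\<lambda>I. header_fields (arrs I) ! i)"
proof -
  let ?b = "\<lambda>I. field_width (arrs I)"
  let ?p = "\<lambda>I. 3 * floorlog 2 (?b I) + 1 + i * ?b I"
  have "comp F (\<lambda>I. field (dat I) (?p I) (?b I))"
  proof (rule comp_field[OF comp_header_pos comp_header_width(2)])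
    fix I assume I: "I \<in> F"
    show "?b I \<le> wd I" using fits_field_width(1)[OF fits[OF I]] .
    show "1 \<le> wd I" using wd_ge[OF I] by simp
    show "?p I div wd I + 1 < 2 ^ wd I"
      by (rule pos_in_range[OF I header_pos_in_range[OF I]]) (use assms in simp)
  qed (use assms in simp)
  then show ?thesis
  proof (rule comp_cong)
    fix I assume I: "I \<in> F"
    show "field (dat I) (?p I) (?b I) = header_fields (arrs I) ! i"
      using field_header[of i "arrs I"] assms by (simp add: dat[OF I] len[OF I])
  qed
qed

lemma comp_width: "j < J \<Longrightarrow> comp F (\<lambda>I. fst (arrs I ! j))"
  by (rule comp_cong[OF comp_header_field[of j]]) (auto simp: header_fields_def nth_append len)

lemma comp_length: "j < J \<Longrightarrow> comp F (\<lambda>I. length (snd (arrs I ! j)))"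
  by (rule comp_cong[OF comp_header_field[of "J + j"]]) (auto simp: header_fields_def nth_append len)

lemma array_fits:
  assumes "I \<in> F" "j < J"
  shows "fst (arrs I ! j) \<le> wd I" "length (snd (arrs I ! j)) < 2 ^ wd I"
    "i < length (snd (arrs I ! j)) \<Longrightarrow> snd (arrs I ! j) ! i < 2 ^ fst (arrs I ! j)"
proof -
  have "arrs I ! j \<in> set (arrs I)" using assms len[OF assms(1)] by simp
  then show "fst (arrs I ! j) \<le> wd I" "length (snd (arrs I ! j)) < 2 ^ wd I"
    "i < length (snd (arrs I ! j)) \<Longrightarrow> snd (arrs I ! j) ! i < 2 ^ fst (arrs I ! j)"
    using fits[OF assms(1)] by (auto simp: fits_def split_beta)
qed

text \<open>The induction unrolls into \<open>J\<close> additions, and \<open>J\<close> is the same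
  for all instances.\<close>

lemma comp_start: "j \<le> J \<Longrightarrow> comp_pos F (\<lambda>I. start (arrs I) j)"
proof (induction j)
  case 0
  let ?p = "\<lambda>I. 3 * floorlog 2 (field_width (arrs I)) + 1 + 2 * J * field_width (arrs I)"
  have eq: "?p I = start (arrs I) 0" if "I \<in> F" for I
    by (simp add: start_def Let_def len[OF that])
  have "comp_pos F ?p" by (rule comp_header_pos) simp
  then show ?case by (rule comp_pos_cong) (rule eq)
next
  case (Suc j)
  have "comp_pos F (\<lambda>I. start (arrs I) j + length (snd (arrs I ! j)) * fst (arrs I ! j))"
  proof (rule comp_pos_add)
    show "comp_pos F (\<lambda>I. start (arrs I) j)" using Suc by simp
    show "comp F (\<lambda>I. length (snd (arrs I ! j)))" "comp F (\<lambda>I. fst (arrs I ! j))"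
      using Suc comp_length comp_width by auto
    fix I assume I: "I \<in> F"
    show "fst (arrs I ! j) \<le> wd I" "64 \<le> wd I" using I Suc array_fits wd_ge by auto
    show "(start (arrs I) j + length (snd (arrs I ! j)) * fst (arrs I ! j)) div wd I < 2 ^ wd I"
      using pos_in_range[OF I, of "start (arrs I) (Suc j)"] Suc.prems start_mono[of "Suc j" J "arrs I"] start_length[of "arrs I"] len[OF I]
      by (simp add: start_Suc)
  qed
  then show ?case by (rule comp_pos_cong) (use Suc.prems in \<open>simp add: start_Suc len\<close>)
qed

lemma readable_array: assumes "j < J" shows "readable F (\<lambda>I. snd (arrs I ! j))"
  unfolding readable_def
proof (intro allI impI)
  fix i assume i: "comp F i" "\<forall>I\<in>F. i I < length (snd (arrs I ! j))"
  let ?p = "\<lambda>I. start (arrs I) j + i I * fst (arrs I ! j)"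
  have rng: "?p I div wd I + 1 < 2 ^ wd I" if "I \<in> F" for I
  proof -
    have "?p I \<le> start (arrs I) j + length (snd (arrs I ! j)) * fst (arrs I ! j)"
      using i that by (intro add_mono mult_le_mono) (auto intro: less_imp_le)
    also have "\<dots> = start (arrs I) (Suc j)" using assms len[OF that] by (simp add: start_Suc)
    also have "\<dots> \<le> length (layout (arrs I))"
      using start_mono[of "Suc j" J "arrs I"] start_length[of "arrs I"] len[OF that] assms by simp
    finally show ?thesis by (rule pos_in_range[OF that])
  qed
  have "comp_pos F ?p"
    by (rule comp_pos_add[OF comp_start i(1) comp_width])
      (use assms array_fits(1) wd_ge rng in \<open>auto intro: less_trans[OF _ rng]\<close>)
  then have "comp F (\<lambda>I. field (dat I) (?p I) (fst (arrs I ! j)))"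
    by (rule comp_field[OF _ comp_width[OF assms]])
       (use assms array_fits(1) wd_ge rng in \<open>auto intro: order_trans[OF _ wd_ge]\<close>)
  then show "comp F (\<lambda>I. snd (arrs I ! j) ! i I)"
    by (rule comp_cong) (use assms i array_fits(3) field_array len in \<open>auto simp: dat\<close>)
qed

end

section \<open>Monotone sequences in linearly many bits\<close>

lemma finite_sorted_nth_card:
  fixes A :: "nat set"
  assumes "finite A" "a \<in> A"
  shows "sorted_list_of_set A ! card {b\<in>A. b < a} = a" "card {b\<in>A. b < a} < card A"
proof -
  let ?xs = "sorted_list_of_set A"
  have xs: "sorted_wrt (<) ?xs" "set ?xs = A" "length ?xs = card A"
    using assms by auto
  obtain k where k: "k < length ?xs" "?xs ! k = a" using assms xs(2) by (metis in_set_conv_nth)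
  have "{b\<in>A. b < a} = (!) ?xs ` {..<k}"
  proof (intro equalityI subsetI)
    fix b assume "b \<in> {b\<in>A. b < a}"
    then obtain j where j: "j < length ?xs" "?xs ! j = b" "b < a" using xs(2) in_set_conv_nth[of b ?xs] by auto
    have "j < k" using j k sorted_wrt_nth_less[OF xs(1), of k j] by (metis linorder_neqE_nat order_less_asym')
    then show "b \<in> (!) ?xs ` {..<k}" using j by auto
  next
    fix b assume "b \<in> (!) ?xs ` {..<k}"
    then obtain j where "j < k" "b = ?xs ! j" by auto
    then show "b \<in> {b\<in>A. b < a}" using k sorted_wrt_nth_less[OF xs(1), of j k] xs(2) nth_mem[of j ?xs] by auto
  qed
  moreover have "inj_on ((!) ?xs) {..<k}" using k by (intro inj_on_nth) auto
  ultimately have "card {b\<in>A. b < a} = k" by (simp add: card_image)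
  then show "?xs ! card {b\<in>A. b < a} = a" "card {b\<in>A. b < a} < card A" using k xs(3) by auto
qed

definition set_code :: "nat \<Rightarrow> nat set \<Rightarrow> nat" where
  "set_code g A = num (map (\<lambda>j. j \<in> A) [0..<g])"

lemma bit_set_code: "bit (set_code g A) i \<longleftrightarrow> i < g \<and> i \<in> A"
  by (auto simp: set_code_def num_def bit_horner_sum_bit_iff)

lemma set_code_less: "set_code g A < 2 ^ g"
  using num_less[of "map (\<lambda>j. j \<in> A) [0..<g]"] by (simp add: set_code_def)

text \<open>The index \<open>c * g + j\<close> stands for a bit mask \<open>c\<close> and a position
  \<open>j < g\<close>, so a single load counts the ones of \<open>c\<close> below \<open>j\<close>.
  There are 2^g masks; taking \<open>g\<close> near half the logarithm of the size keeps the table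
  linear.\<close>

definition pop_table :: "nat \<Rightarrow> nat list" where
  "pop_table g = map (\<lambda>x. card {i. i < x mod g \<and> bit (x div g) i}) [0..<2 ^ g * g]"

definition select_table :: "nat \<Rightarrow> nat list" where
  "select_table g = map (\<lambda>x. let s = sorted_list_of_set {i. i < g \<and> bit (x div g) i} in
     if x mod g < length s then s ! (x mod g) else 0) [0..<2 ^ g * g]"

lemma table_index: "c < 2 ^ g \<Longrightarrow> j < g \<Longrightarrow> c * g + j < 2 ^ g * (g::nat)"
  by (metis add_less_mono1 add.commute mult_Suc mult_le_mono1 order_less_le_trans Suc_leI)

lemma pop_table_nth:
  "c < 2 ^ g \<Longrightarrow> j < g \<Longrightarrow> pop_table g ! (c * g + j) = card {i. i < j \<and> bit c i}"
  using table_index[of c g j] by (simp add: pop_table_def)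

lemma select_table_nth:
  assumes "A \<subseteq> {..<g}" "a \<in> A"
  shows "select_table g ! (set_code g A * g + card {b\<in>A. b < a}) = a"
proof -
  have fin: "finite A" using assms finite_subset by blast
  have c: "card {b\<in>A. b < a} < card A" using finite_sorted_nth_card[OF fin assms(2)] by simp
  also have "\<dots> \<le> g" using assms card_mono[of "{..<g}" A] by simp
  finally have j: "card {b\<in>A. b < a} < g" .
  have "{i. i < g \<and> bit (set_code g A) i} = A" using assms by (auto simp: bit_set_code)
  then show ?thesis
    using table_index[OF set_code_less j] j c finite_sorted_nth_card[OF fin assms(2)]
    by (simp add: select_table_def Let_def)
qed

text \<open>Up to its first value, such a list is the rank function of the bit string that marks its
  increases.\<close>

definition slow :: "nat list \<Rightarrow> bool" where
  "slow R \<longleftrightarrow> (\<forall>i. Suc i < length R \<longrightarrow> R ! Suc i = R ! i \<or> R ! Suc i = Suc (R ! i))"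

definition rank_base :: "nat \<Rightarrow> nat list \<Rightarrow> nat list" where
  "rank_base g R = map (\<lambda>u. R ! (u * g)) [0..<(length R + g - 1) div g]"

text \<open>In the last block the comparison may go past the end of \<open>R\<close>. The bits that
  result are unspecified, but a query counts only bits strictly below its own position, and those
  compare entries of \<open>R\<close>.\<close>

definition rank_code :: "nat \<Rightarrow> nat list \<Rightarrow> nat list" where
  "rank_code g R = map (\<lambda>u. set_code g {j. R ! (u * g + j) \<noteq> R ! Suc (u * g + j)}) [0..<(length R + g - 1) div g]"

lemma block_index:
  fixes i N g :: nat
  assumes "0 < g" shows "i < N \<Longrightarrow> i div g < (N + g - 1) div g" "i < (N + g - 1) div g \<Longrightarrow> i * g < N"
proof -
  assume "i < N"
  then have "(i + g) div g \<le> (N + g - 1) div g" by (intro div_le_mono) simp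
  then show "i div g < (N + g - 1) div g" using assms by simp
next
  assume "i < (N + g - 1) div g"
  then have "Suc i * g \<le> (N + g - 1) div g * g" by (intro mult_le_mono) auto
  also have "\<dots> \<le> N + g - 1" by simp
  finally show "i * g < N" using assms by simp
qed

lemma rank_decomp:
  assumes "slow R" "i < length R" "0 < g"
  shows "R ! i = rank_base g R ! (i div g) + pop_table g ! (rank_code g R ! (i div g) * g + i mod g)"
proof -
  define u where "u = i div g"
  let ?C = "{j. R ! (u * g + j) \<noteq> R ! Suc (u * g + j)}"
  have *: "u * g + j < length R \<Longrightarrow> R ! (u * g + j) = R ! (u * g) + card {i. i < j \<and> i \<in> ?C}" for j
  proof (induction j)
    case (Suc j)
    have "{i. i < Suc j \<and> i \<in> ?C} = {i. i < j \<and> i \<in> ?C} \<union> (if j \<in> ?C then {j} else {})"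
      by (auto simp: less_Suc_eq)
    then have "card {i. i < Suc j \<and> i \<in> ?C} = card {i. i < j \<and> i \<in> ?C} + (if j \<in> ?C then 1 else 0)"
      by auto
    moreover have "R ! (u * g + Suc j) = R ! (u * g + j) + (if j \<in> ?C then 1 else 0)"
      using assms(1) Suc.prems by (auto simp: slow_def)
    ultimately show ?case using Suc by simp
  qed simp
  have "u < (length R + g - 1) div g" using block_index(1)[OF assms(3,2)] by (simp add: u_def)
  then have "rank_base g R ! u = R ! (u * g)" "rank_code g R ! u = set_code g ?C"
    by (auto simp: rank_base_def rank_code_def)
  moreover have "i mod g < g" using assms by simp
  moreover from this have "{j. j < i mod g \<and> bit (set_code g ?C) j} = {j. j < i mod g \<and> j \<in> ?C}"
    by (auto simp: bit_set_code)
  moreover have "u * g + i mod g = i" by (simp add: u_def)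
  ultimately show ?thesis
    using *[of "i mod g"] assms(2) pop_table_nth[OF set_code_less \<open>i mod g < g\<close>, of ?C]
    by (simp add: u_def[symmetric])
qed

text \<open>Selection from an increasing list \<open>p\<close>: values are cut into aligned chunks
  of length \<open>g\<close>, and each nonempty chunk keeps its number, the index of its first
  element and the mask of its members. \<open>segments\<close> sends an index to its chunk. It grows
  by at most one per step, so a rank structure represents it.\<close>

definition segments :: "nat \<Rightarrow> nat list \<Rightarrow> nat list" where
  "segments g p = map (\<lambda>i. card {j. j < i \<and> p ! j div g \<noteq> p ! Suc j div g}) [0..<length p]"

definition heads :: "nat \<Rightarrow> nat list \<Rightarrow> nat list" where
  "heads g p = filter (\<lambda>i. i = 0 \<or> p ! (i - 1) div g \<noteq> p ! i div g) [0..<length p]"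

definition chunk_ids :: "nat \<Rightarrow> nat list \<Rightarrow> nat list" where
  "chunk_ids g p = map (\<lambda>i. p ! i div g) (heads g p)"

definition chunk_codes :: "nat \<Rightarrow> nat list \<Rightarrow> nat list" where
  "chunk_codes g p = map (\<lambda>i. set_code g {x mod g | x. x \<in> set p \<and> x div g = p ! i div g}) (heads g p)"

lemma slow_segments: "slow (segments g p)"
proof -
  have "{j. j < Suc i \<and> p ! j div g \<noteq> p ! Suc j div g} =
    {j. j < i \<and> p ! j div g \<noteq> p ! Suc j div g} \<union> (if p ! i div g \<noteq> p ! Suc i div g then {i} else {})" for i
    by (auto simp: less_Suc_eq)
  then show ?thesis by (auto simp: slow_def segments_def)
qed

lemma heads_segments:
  fixes g :: nat
  assumes "sorted_wrt (<) p" "i < length p"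
  defines "t \<equiv> segments g p ! i"
  shows "t < length (heads g p)" "heads g p ! t \<le> i" "p ! (heads g p ! t) div g = p ! i div g"
    "heads g p ! t = 0 \<or> p ! (heads g p ! t - 1) div g \<noteq> p ! (heads g p ! t) div g"
proof -
  let ?P = "\<lambda>i. i = 0 \<or> p ! (i - 1) div g \<noteq> p ! i div g"
  let ?T = "\<lambda>i. card {j. j < i \<and> p ! j div g \<noteq> p ! Suc j div g}"
  let ?H = "\<lambda>i. filter ?P [0..<i]"
  have *: "length (?H (Suc i)) = Suc (?T i) \<and> ?H (Suc i) ! ?T i \<le> i
    \<and> p ! (?H (Suc i) ! ?T i) div g = p ! i div g" for i
  proof (induction i)
    case (Suc i)
    have T: "?T (Suc i) = ?T i + (if p ! i div g \<noteq> p ! Suc i div g then 1 else 0)"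
    proof -
      have "{j. j < Suc i \<and> p ! j div g \<noteq> p ! Suc j div g} =
        {j. j < i \<and> p ! j div g \<noteq> p ! Suc j div g} \<union> (if p ! i div g \<noteq> p ! Suc i div g then {i} else {})"
        by (auto simp: less_Suc_eq)
      then show ?thesis by auto
    qed
    have H: "?H (Suc (Suc i)) = ?H (Suc i) @ (if p ! i div g \<noteq> p ! Suc i div g then [Suc i] else [])"
      by simp
    show ?case
    proof (cases "p ! i div g = p ! Suc i div g")
      case True
      then have "?H (Suc (Suc i)) = ?H (Suc i)" "?T (Suc i) = ?T i" using H T by auto
      moreover have "?H (Suc i) ! ?T i \<le> Suc i" using Suc by (intro le_SucI) blast
      ultimately show ?thesis using Suc True by (simp only:)
    next
      case False
      then have "?H (Suc (Suc i)) = ?H (Suc i) @ [Suc i]" "?T (Suc i) = Suc (?T i)" using H T by auto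
      moreover have "length (?H (Suc i)) = Suc (?T i)" using Suc by blast
      ultimately show ?thesis by (simp only: nth_append) simp
    qed
  qed simp
  have "[0..<length p] = [0..<Suc i] @ [Suc i..<length p]"
    by (metis Suc_leI assms(2) le0 le_add_diff_inverse upt_add_eq_append)
  then have hd: "heads g p = ?H (Suc i) @ filter ?P [Suc i..<length p]"
    unfolding heads_def by (simp only: filter_append)
  have t: "t = ?T i" using assms(2) by (simp add: t_def segments_def)
  have lt: "t < length (?H (Suc i))" using *[of i] t by simp
  then show t': "t < length (heads g p)" unfolding hd by simp
  have "heads g p ! t = ?H (Suc i) ! t" unfolding hd using lt by (simp only: nth_append if_True)
  then show "heads g p ! t \<le> i" "p ! (heads g p ! t) div g = p ! i div g" using *[of i] t by auto
  have "heads g p ! t \<in> set (heads g p)" using t' by simp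
  then show "heads g p ! t = 0 \<or> p ! (heads g p ! t - 1) div g \<noteq> p ! (heads g p ! t) div g"
    by (auto simp: heads_def)
qed

text \<open>As \<open>p\<close> increases strictly, the members of the chunk below
  \<open>p ! i\<close> are the entries from the head up to \<open>i - 1\<close>. So \<open>i\<close>
  minus the index of the head is the rank of \<open>p ! i\<close> inside the mask.\<close>

lemma increasing_decomp:
  fixes g :: nat
  assumes p: "sorted_wrt (<) p" and i: "i < length p" and g: "0 < g"
  defines "t \<equiv> segments g p ! i"
  shows "p ! i = chunk_ids g p ! t * g + select_table g ! (chunk_codes g p ! t * g + (i - heads g p ! t))"
    "i - heads g p ! t < g"
proof -
  define f where "f = heads g p ! t"
  note hs = heads_segments[OF p i, of g, folded t_def f_def]
  have mono: "j \<le> k \<Longrightarrow> k < length p \<Longrightarrow> p ! j \<le> p ! k" for j k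
    using sorted_wrt_nth_less[OF p, of j k] by (cases "j = k") auto
  define A where "A = {x mod g | x. x \<in> set p \<and> x div g = p ! i div g}"
  let ?a = "p ! i mod g"
  have a: "?a \<in> A" using i by (auto simp: A_def)
  have same: "p ! j div g = p ! i div g" if "f \<le> j" "j \<le> i" for j
    using hs(3) div_le_mono[OF mono[of f j], of g] div_le_mono[OF mono[of j i], of g] that i by simp
  have eqA: "{b\<in>A. b < ?a} = (\<lambda>j. p ! j mod g) ` {f..<i}"
  proof (intro equalityI subsetI)
    fix b assume "b \<in> {b\<in>A. b < ?a}"
    then obtain j where j: "j < length p" "b = p ! j mod g" "p ! j div g = p ! i div g" "b < ?a"
      by (auto simp: A_def in_set_conv_nth)
    then have "p ! j < p ! i" by (metis add_strict_left_mono div_mult_mod_eq)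
    then have "j < i" using mono[of i j] j by (metis not_le)
    moreover have "f \<le> j"
    proof (rule ccontr)
      assume "\<not> f \<le> j"
      then have "f > 0" "j \<le> f - 1" by auto
      then have "p ! j div g \<le> p ! (f - 1) div g" "p ! (f - 1) div g \<le> p ! f div g"
        using mono hs(2) i by (intro div_le_mono; simp)+
      then show False using hs(3,4) j(3) \<open>f > 0\<close> by simp
    qed
    ultimately show "b \<in> (\<lambda>j. p ! j mod g) ` {f..<i}" using j by auto
  next
    fix b assume "b \<in> (\<lambda>j. p ! j mod g) ` {f..<i}"
    then obtain j where j: "f \<le> j" "j < i" "b = p ! j mod g" by auto
    have "p ! j < p ! i" using sorted_wrt_nth_less[OF p j(2) i] .
    then have "b < ?a" using same[of j] j by (metis add_less_cancel_left div_mult_mod_eq less_imp_le)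
    then show "b \<in> {b\<in>A. b < ?a}" using j same[of j] i by (auto simp: A_def)
  qed
  have "inj_on (\<lambda>j. p ! j mod g) {f..<i}"
  proof (rule inj_onI)
    fix j k assume jk: "j \<in> {f..<i}" "k \<in> {f..<i}" "p ! j mod g = p ! k mod g"
    then have "p ! j = p ! k" using same[of j] same[of k] by (metis atLeastLessThan_iff div_mult_mod_eq less_imp_le)
    then show "j = k" using jk i sorted_wrt_nth_less[OF p, of j k] sorted_wrt_nth_less[OF p, of k j]
      by (cases j k rule: linorder_cases) auto
  qed
  then have card: "card {b\<in>A. b < ?a} = i - f" unfolding eqA by (simp add: card_image)
  have Ag: "A \<subseteq> {..<g}" using g by (auto simp: A_def)
  have "select_table g ! (set_code g A * g + (i - f)) = ?a"
    using select_table_nth[OF Ag a] card by simp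
  moreover have "chunk_ids g p ! t = p ! i div g" "chunk_codes g p ! t = set_code g A"
    using hs by (auto simp: chunk_ids_def chunk_codes_def f_def[symmetric] A_def)
  ultimately show "p ! i = chunk_ids g p ! t * g + select_table g ! (chunk_codes g p ! t * g + (i - heads g p ! t))"
    by (simp add: f_def[symmetric])
  have "i - f < card A" using card finite_sorted_nth_card(2)[OF finite_subset[OF Ag] a] by simp
  also have "\<dots> \<le> g" using card_mono[OF _ Ag] by simp
  finally show "i - heads g p ! t < g" by (simp add: f_def)
qed

text \<open>Different heads have different chunk numbers, and none exceeds
  \<open>M div g\<close>.\<close>

lemma length_heads:
  assumes "sorted_wrt (<) p" "\<And>x. x \<in> set p \<Longrightarrow> x < M"
  shows "length (heads g p) \<le> M div g + 1"
proof -
  have mono: "j \<le> k \<Longrightarrow> k < length p \<Longrightarrow> p ! j \<le> p ! k" for j k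
    using sorted_wrt_nth_less[OF assms(1), of j k] by (cases "j = k") auto
  have less: "p ! j div g < p ! k div g" if "j < k" "k \<in> set (heads g p)" for j k
  proof -
    have k: "k < length p" "p ! (k - 1) div g \<noteq> p ! k div g" using that by (auto simp: heads_def)
    have "p ! j div g \<le> p ! (k - 1) div g" "p ! (k - 1) div g \<le> p ! k div g"
      using that k by (auto intro!: div_le_mono mono)
    then show ?thesis using k by simp
  qed
  have "inj_on (\<lambda>i. p ! i div g) (set (heads g p))"
    by (rule inj_onI) (metis less linorder_neqE_nat less_irrefl)
  then have "card (set (heads g p)) = card ((\<lambda>i. p ! i div g) ` set (heads g p))" by (simp add: card_image)
  also have "\<dots> \<le> card {..M div g}"
  proof (rule card_mono)
    have "p ! i div g \<le> M div g" if "i < length p" for i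
      using assms(2)[of "p ! i"] that by (intro div_le_mono) simp
    then show "(\<lambda>i. p ! i div g) ` set (heads g p) \<subseteq> {..M div g}"
      by (auto simp: heads_def)
  qed simp
  also have "card (set (heads g p)) = length (heads g p)"
    by (rule distinct_card) (simp add: heads_def)
  finally show ?thesis by simp
qed

lemma tabulated_bounds: "x \<in> set (pop_table g) \<Longrightarrow> x < 2 ^ g" "x \<in> set (select_table g) \<Longrightarrow> x < 2 ^ g"
proof -
  assume "x \<in> set (pop_table g)"
  then obtain y where y: "x = card {i. i < y mod g \<and> bit (y div g) i}" "y < 2 ^ g * g" by (auto simp: pop_table_def)
  have "x \<le> card {..<y mod g}" unfolding y(1) by (rule card_mono) auto
  also have "\<dots> \<le> g" using y(2) by (cases "g = 0") (auto intro: less_imp_le)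
  also have "g < 2 ^ g" by simp
  finally show "x < 2 ^ g" .
next
  assume "x \<in> set (select_table g)"
  then obtain y where y: "x = (let s = sorted_list_of_set {i. i < g \<and> bit (y div g) i} in
     if y mod g < length s then s ! (y mod g) else 0)" unfolding select_table_def set_map by blast
  show "x < 2 ^ g"
  proof (cases "y mod g < length (sorted_list_of_set {i. i < g \<and> bit (y div g) i})")
    case True
    then have "x \<in> set (sorted_list_of_set {i. i < g \<and> bit (y div g) i})" using nth_mem[OF True] y True by (simp only: Let_def if_True)
    then have "x < g" by simp
    also have "g < 2 ^ g" by simp
    finally show ?thesis .
  qed (use y in simp)
qed

context ram
begin

lemma readable_slow:
  assumes "readable F (\<lambda>I. rank_base (g I) (R I))" "readable F (\<lambda>I. rank_code (g I) (R I))"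
    "readable F (\<lambda>I. pop_table (g I))" "comp F g"
    and "\<And>I. I \<in> F \<Longrightarrow> 0 < g I" "\<And>I. I \<in> F \<Longrightarrow> slow (R I)" "\<And>I. I \<in> F \<Longrightarrow> 2 ^ g I * g I < 2 ^ wd I"
    "\<And>I x. I \<in> F \<Longrightarrow> x \<in> set (R I) \<Longrightarrow> x < 2 ^ wd I"
  shows "readable F R"
  unfolding readable_def
proof (intro allI impI)
  fix i assume i: "comp F i" "\<forall>I\<in>F. i I < length (R I)"
  let ?u = "\<lambda>I. i I div g I"
  have u: "comp F ?u" by (rule comp_div[OF i(1) assms(4)])
  have ul: "?u I < (length (R I) + g I - 1) div g I" if "I \<in> F" for I
    using block_index(1)[OF assms(5)[OF that]] i that by blast
  have c: "comp F (\<lambda>I. rank_code (g I) (R I) ! ?u I)"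
    by (rule readableD[OF assms(2) u]) (use ul in \<open>simp add: rank_code_def\<close>)
  have idx: "rank_code (g I) (R I) ! ?u I * g I + i I mod g I < 2 ^ g I * g I" if "I \<in> F" for I
    using ul[OF that] assms(5)[OF that] by (intro table_index) (auto simp: rank_code_def set_code_less)
  have b: "comp F (\<lambda>I. rank_base (g I) (R I) ! ?u I)"
    by (rule readableD[OF assms(1) u]) (use ul in \<open>simp add: rank_base_def\<close>)
  have "comp F (\<lambda>I. rank_code (g I) (R I) ! ?u I * g I + i I mod g I)"
    by (rule comp_add[OF comp_mult[OF c assms(4)] comp_mod[OF i(1) assms(4)]])
       (use less_trans[OF idx assms(7)] in \<open>auto intro: le_less_trans[OF le_add1]\<close>)
  then have "comp F (\<lambda>I. pop_table (g I) ! (rank_code (g I) (R I) ! ?u I * g I + i I mod g I))"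
    by (rule readableD[OF assms(3)]) (use idx in \<open>simp add: pop_table_def\<close>)
  from comp_add[OF b this]
  have "(\<And>I. I \<in> F \<Longrightarrow> R I ! i I < 2 ^ wd I) \<Longrightarrow> comp F (\<lambda>I. R I ! i I)"
    using rank_decomp[OF assms(6) _ assms(5)] i(2) comp_cong by fastforce
  then show "comp F (\<lambda>I. R I ! i I)" using assms(8) i(2) by simp
qed

lemma readable_increasing:
  assumes "readable F (\<lambda>I. rank_base (g I) (segments (g I) (p I)))"
    "readable F (\<lambda>I. rank_code (g I) (segments (g I) (p I)))"
    "readable F (\<lambda>I. pop_table (g I))" "readable F (\<lambda>I. heads (g I) (p I))" "readable F (\<lambda>I. chunk_ids (g I) (p I))"
    "readable F (\<lambda>I. chunk_codes (g I) (p I))" "readable F (\<lambda>I. select_table (g I))" "comp F g"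
    and "\<And>I. I \<in> F \<Longrightarrow> 0 < g I" "\<And>I. I \<in> F \<Longrightarrow> sorted_wrt (<) (p I)" "\<And>I. I \<in> F \<Longrightarrow> 2 ^ g I * g I < 2 ^ wd I"
    "\<And>I x. I \<in> F \<Longrightarrow> x \<in> set (p I) \<Longrightarrow> x < 2 ^ wd I" "\<And>I. I \<in> F \<Longrightarrow> length (p I) < 2 ^ wd I"
  shows "readable F p"
  unfolding readable_def
proof (intro allI impI)
  fix i assume i: "comp F i" "\<forall>I\<in>F. i I < length (p I)"
  have "readable F (\<lambda>I. segments (g I) (p I))"
  proof (rule readable_slow[OF assms(1-3,8,9) slow_segments assms(11)])
    fix I x assume I: "I \<in> F" "x \<in> set (segments (g I) (p I))"
    then obtain j where j: "j < length (p I)" "x = card {k. k < j \<and> p I ! k div g I \<noteq> p I ! Suc k div g I}"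
      by (auto simp: segments_def)
    have "x \<le> card {..<j}" unfolding j(2) by (intro card_mono) auto
    then show "x < 2 ^ wd I" using j(1) assms(13)[OF I(1)] by simp
  qed
  then have t: "comp F (\<lambda>I. segments (g I) (p I) ! i I)"
    by (rule readableD[OF _ i(1)]) (use i(2) in \<open>simp add: segments_def\<close>)
  let ?t = "\<lambda>I. segments (g I) (p I) ! i I"
  have il: "i I < length (p I)" if "I \<in> F" for I using i that by blast
  note hs = heads_segments[OF assms(10) il]
  note dec = increasing_decomp[OF assms(10) il assms(9)]
  have h: "comp F (\<lambda>I. heads (g I) (p I) ! ?t I)" "comp F (\<lambda>I. chunk_ids (g I) (p I) ! ?t I)"
    "comp F (\<lambda>I. chunk_codes (g I) (p I) ! ?t I)"
    by (rule readableD[OF assms(4) t], simp add: hs(1))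
       (rule readableD[OF assms(5) t], simp add: hs(1) chunk_ids_def,
        rule readableD[OF assms(6) t], simp add: hs(1) chunk_codes_def)
  let ?j = "\<lambda>I. chunk_codes (g I) (p I) ! ?t I * g I + (i I - heads (g I) (p I) ! ?t I)"
  have d: "comp F (\<lambda>I. i I - heads (g I) (p I) ! ?t I)"
    by (rule comp_diff[OF i(1) h(1)]) (use hs(2) less_trans[OF il assms(13)] in auto)
  have idx: "?j I < 2 ^ g I * g I" if "I \<in> F" for I
    using that dec(2) hs(1)[OF that that] by (intro table_index) (auto simp: chunk_codes_def set_code_less)
  have "comp F ?j"
    by (rule comp_add[OF comp_mult[OF h(3) assms(8)] d])
       (use less_trans[OF idx assms(11)] in \<open>auto intro: le_less_trans[OF le_add1]\<close>)
  then have s: "comp F (\<lambda>I. select_table (g I) ! ?j I)"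
    by (rule readableD[OF assms(7)]) (use idx in \<open>simp add: select_table_def\<close>)
  have pl: "p I ! i I < 2 ^ wd I" if "I \<in> F" for I using assms(12)[OF that] il[OF that] by simp
  have val: "chunk_ids (g I) (p I) ! ?t I * g I + select_table (g I) ! ?j I = p I ! i I" if "I \<in> F" for I
    using dec(1)[OF that that that] by simp
  have "comp F (\<lambda>I. chunk_ids (g I) (p I) ! ?t I * g I + select_table (g I) ! ?j I)"
  proof (rule comp_add[OF comp_mult[OF h(2) assms(8)] s])
    fix I assume I: "I \<in> F"
    show lt: "chunk_ids (g I) (p I) ! ?t I * g I + select_table (g I) ! ?j I < 2 ^ wd I"
      unfolding val[OF I] by (rule pl[OF I])
    then show "chunk_ids (g I) (p I) ! ?t I * g I < 2 ^ wd I" by (rule le_less_trans[OF le_add1])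
  qed
  then show "comp F (\<lambda>I. p I ! i I)" by (rule comp_cong) (rule val)
qed

end

section \<open>Space used by the rank and select structures\<close>

definition array_bits :: "(nat \<times> nat list) list \<Rightarrow> nat" where
  "array_bits arrs = (\<Sum>(b, A)\<leftarrow>arrs. b * length A)"

lemma length_layout:
  "length (layout arrs) = 3 * floorlog 2 (field_width arrs) + 1 + 2 * length arrs * field_width arrs + array_bits arrs"
proof -
  have "length (concat (map (\<lambda>(b, A). encode b A) arrs)) = array_bits arrs"
    by (induction arrs) (auto simp: array_bits_def)
  then show ?thesis by (simp add: layout_def Let_def)
qed

definition rank_arrays :: "nat \<Rightarrow> nat \<Rightarrow> nat list \<Rightarrow> (nat \<times> nat list) list" where
  "rank_arrays g b R = [(b, rank_base g R), (g, rank_code g R), (g, pop_table g)]"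

definition increasing_arrays :: "nat \<Rightarrow> nat \<Rightarrow> nat list \<Rightarrow> (nat \<times> nat list) list" where
  "increasing_arrays g b p = rank_arrays g b (segments g p) @
     [(b, heads g p), (b, chunk_ids g p), (g, chunk_codes g p), (g, select_table g)]"

definition well_sized :: "nat \<Rightarrow> nat \<Rightarrow> (nat \<times> nat list) list \<Rightarrow> bool" where
  "well_sized B X arrs \<longleftrightarrow> (\<forall>(b, A)\<in>set arrs. b \<le> B \<and> length A \<le> X \<and> (\<forall>a\<in>set A. a < 2 ^ b))"

lemma block_count: "0 < g \<Longrightarrow> (N + g - 1) div g \<le> (N::nat)" "0 < g \<Longrightarrow> (N + g - 1) div g * g \<le> N + g"
proof -
  assume g: "0 < g"
  show "(N + g - 1) div g * g \<le> N + g" by (rule order_trans[OF div_times_less_eq_dividend]) simp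
  show "(N + g - 1) div g \<le> N"
  proof (cases "N = 0")
    case False
    have "N + g - 1 \<le> N * g" using False g by (cases N; cases g) auto
    then have "(N + g - 1) div g \<le> N * g div g" by (rule div_le_mono)
    then show ?thesis using g by simp
  qed (use g in simp)
qed

lemma rank_arrays_sized:
  assumes "0 < g" "\<And>x. x \<in> set R \<Longrightarrow> x < 2 ^ b" "b \<le> B" "g \<le> B" "length R \<le> X" "2 ^ g * g \<le> X"
  shows "well_sized B X (rank_arrays g b R)"
proof -
  have "x < 2 ^ b" if "x \<in> set (rank_base g R)" for x
    using that assms(1,2) block_index(2) by (auto simp: rank_base_def)
  then show ?thesis using assms block_count(1)[OF assms(1), of "length R"] tabulated_bounds
    by (auto simp: well_sized_def rank_arrays_def rank_base_def rank_code_def set_code_less pop_table_def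
        intro: order_trans)
qed

text \<open>With \<open>b <= B * g\<close> a block of \<open>g\<close> positions costs O(g) bits,
  that is, O(1) bits per position. The last term is the table.\<close>

lemma rank_arrays_bits:
  assumes "0 < g" "b \<le> B * g"
  shows "array_bits (rank_arrays g b R) \<le> (length R + g) * (B + 1) + 2 ^ g * g\<^sup>2"
proof -
  let ?u = "(length R + g - 1) div g"
  have "(b + g) * ?u \<le> ((B + 1) * g) * ?u" using assms by (intro mult_le_mono) auto
  also have "\<dots> = ?u * g * (B + 1)" by (simp only: mult.commute mult.left_commute)
  also have "\<dots> \<le> (length R + g) * (B + 1)" using block_count(2)[OF assms(1)] by (rule mult_le_mono1)
  finally show ?thesis
    by (simp add: array_bits_def rank_arrays_def rank_base_def rank_code_def pop_table_def power2_eq_square algebra_simps)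
qed

lemma segments_bound: "x \<in> set (segments g p) \<Longrightarrow> x < length p"
proof -
  assume "x \<in> set (segments g p)"
  then obtain j where j: "j < length p" "x = card {k. k < j \<and> p ! k div g \<noteq> p ! Suc k div g}"
    by (auto simp: segments_def)
  have "x \<le> card {..<j}" unfolding j(2) by (intro card_mono) auto
  then show "x < length p" using j(1) by simp
qed

lemma increasing_length:
  assumes "sorted_wrt (<) p" "\<And>x. x \<in> set p \<Longrightarrow> x < M"
  shows "length p \<le> M"
proof -
  have "distinct p" using assms(1) by (auto simp: strict_sorted_iff)
  then have "length p = card (set p)" by (simp add: distinct_card)
  also have "\<dots> \<le> card {..<M}" using assms(2) by (intro card_mono) auto
  finally show ?thesis by simp
qed

lemma increasing_arrays_sized:
  assumes "0 < g" "sorted_wrt (<) p" "\<And>x. x \<in> set p \<Longrightarrow> x < M" "M \<le> 2 ^ b" "b \<le> B" "g \<le> B" "M \<le> X" "2 ^ g * g \<le> X"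
  shows "well_sized B X (increasing_arrays g b p)"
proof -
  have len: "length p \<le> M" by (rule increasing_length[OF assms(2,3)])
  have "well_sized B X (rank_arrays g b (segments g p))"
  proof (rule rank_arrays_sized)
    show "x < 2 ^ b" if "x \<in> set (segments g p)" for x
      using segments_bound[OF that] len assms(4) by simp
    show "length (segments g p) \<le> X" using len assms(7) by (simp add: segments_def)
  qed (use assms in auto)
  moreover have "length (heads g p) \<le> X"
  proof -
    have "length (heads g p) \<le> length [0..<length p]" unfolding heads_def by (rule length_filter_le)
    then show ?thesis using len assms(7) by simp
  qed
  moreover have "x < 2 ^ b" if "x \<in> set (heads g p)" for x
    using that len assms(4) by (auto simp: heads_def)
  moreover have "x < 2 ^ b" if x: "x \<in> set (chunk_ids g p)" for x
  proof -
    obtain i where i: "i < length p" "x = p ! i div g" using x by (auto simp: chunk_ids_def heads_def)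
    then have "x \<le> p ! i" by simp
    also have "p ! i < M" using assms(3) i by simp
    finally show ?thesis using assms(4) by simp
  qed
  ultimately show ?thesis using assms tabulated_bounds(2)
    by (auto simp: well_sized_def increasing_arrays_def chunk_ids_def chunk_codes_def set_code_less select_table_def)
qed

lemma increasing_arrays_bits:
  assumes "0 < g" "sorted_wrt (<) p" "\<And>x. x \<in> set p \<Longrightarrow> x < M" "b \<le> B * g"
  shows "array_bits (increasing_arrays g b p) \<le> (M + g) * (3 * B + 2) + 2 * (2 ^ g * g\<^sup>2)"
proof -
  have "length (segments g p) \<le> M" using increasing_length[OF assms(2,3)] by (simp add: segments_def)
  then have "(length (segments g p) + g) * (B + 1) \<le> (M + g) * (B + 1)" by (intro mult_le_mono) auto
  then have 1: "array_bits (rank_arrays g b (segments g p)) \<le> (M + g) * (B + 1) + 2 ^ g * g\<^sup>2"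
    using rank_arrays_bits[OF assms(1,4), of "segments g p"] by linarith
  let ?h = "length (heads g p)"
  have "(2 * b + g) * ?h \<le> ((2 * B + 1) * g) * (M div g + 1)"
    using assms(4) length_heads[OF assms(2,3)] by (intro mult_le_mono) auto
  also have "\<dots> = (2 * B + 1) * (M div g * g + g)" by (simp add: algebra_simps)
  also have "\<dots> \<le> (2 * B + 1) * (M + g)" by (intro mult_le_mono) auto
  finally have "(2 * b + g) * ?h \<le> (2 * B + 1) * (M + g)" .
  with 1 show ?thesis
    by (simp add: array_bits_def increasing_arrays_def chunk_ids_def chunk_codes_def select_table_def
        power2_eq_square algebra_simps)
qed

definition prefix_sums :: "nat list \<Rightarrow> nat list" where
  "prefix_sums xs = map (\<lambda>i. sum_list (take i xs)) [0..<Suc (length xs)]"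

text \<open>Prefix sums may stay constant, while the select structure needs a strictly increasing
  list. Adding the index makes them strict; it is subtracted again on access.\<close>

definition shifted_sums :: "nat list \<Rightarrow> nat list" where
  "shifted_sums xs = map (\<lambda>i. i + sum_list (take i xs)) [0..<Suc (length xs)]"

lemma sum_take_mono: "i \<le> j \<Longrightarrow> sum_list (take i xs) \<le> sum_list (take j (xs :: nat list))"
  by (metis le_add1 sum_list_append take_add le_add_diff_inverse)

lemma shifted_sums_increasing: "sorted_wrt (<) (shifted_sums xs)"
  by (auto simp: shifted_sums_def sorted_wrt_iff_nth_less simp del: upt_Suc intro!: add_less_le_mono sum_take_mono)

lemma shifted_sums_less: "x \<in> set (shifted_sums xs) \<Longrightarrow> x < length xs + sum_list xs + 1"
proof -
  assume "x \<in> set (shifted_sums xs)"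
  then obtain i where "i < Suc (length xs)" "x = i + sum_list (take i xs)"
    by (auto simp: shifted_sums_def simp del: upt_Suc)
  then show ?thesis using sum_take_mono[of i "length xs" xs] by simp
qed

lemma (in ram) readable_prefix_sums:
  assumes "readable F (\<lambda>I. shifted_sums (xs I))" "\<And>I. I \<in> F \<Longrightarrow> length (xs I) + sum_list (xs I) < 2 ^ wd I"
  shows "readable F (\<lambda>I. prefix_sums (xs I))"
  unfolding readable_def
proof (intro allI impI)
  fix i assume i: "comp F i" "\<forall>I\<in>F. i I < length (prefix_sums (xs I))"
  have eq: "shifted_sums (xs I) ! i I = i I + prefix_sums (xs I) ! i I" "shifted_sums (xs I) ! i I < 2 ^ wd I"
    if "I \<in> F" for I
  proof -
    have il: "i I < Suc (length (xs I))" using i that by (auto simp: prefix_sums_def)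
    then show eq: "shifted_sums (xs I) ! i I = i I + prefix_sums (xs I) ! i I"
      by (simp add: prefix_sums_def shifted_sums_def del: upt_Suc)
    have "shifted_sums (xs I) ! i I \<in> set (shifted_sums (xs I))" using il by (simp add: shifted_sums_def del: upt_Suc)
    from shifted_sums_less[OF this] show "shifted_sums (xs I) ! i I < 2 ^ wd I" using assms(2)[OF that] by simp
  qed
  have "comp F (\<lambda>I. shifted_sums (xs I) ! i I)"
    by (rule readableD[OF assms(1) i(1)]) (use i(2) in \<open>simp add: shifted_sums_def prefix_sums_def del: upt_Suc\<close>)
  then have "comp F (\<lambda>I. shifted_sums (xs I) ! i I - i I)"
    by (rule comp_diff[OF _ i(1)]) (use eq in auto)
  then show "comp F (\<lambda>I. prefix_sums (xs I) ! i I)" by (rule comp_cong) (use eq in simp)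
qed

section \<open>Perfect hashing with shared seeds\<close>

text \<open>Induction along the recursion of Leibniz' harmonic triangle, whose entries are the numbers \<open>1 / (k (n choose k))\<close>.\<close>

lemma leibniz_triangle_integral:
  fixes c :: nat
  assumes "\<And>i. 1 \<le> i \<Longrightarrow> i \<le> N \<Longrightarrow> i dvd c" "1 \<le> k" "k \<le> n" "n \<le> N"
  shows "real c / (real k * real (n choose k)) \<in> \<int>"
  using assms(2-4)
proof (induction k arbitrary: n)
  case (Suc k)
  show ?case
  proof (cases "k = 0")
    case True
    then obtain d where "c = n * d" using assms(1)[of n] Suc.prems by (auto elim: dvdE)
    then show ?thesis using True Suc.prems by simp
  next
    case False
    define u v where "u = real (n choose k)" and "v = real (n - k)"
    have n: "n \<ge> 1" "k < n" using Suc.prems by auto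
    have uv: "u > 0" "v > 0" "real k > 0" using n False by (auto simp: u_def v_def)
    have "(n - k) * (n choose k) = Suc k * (n choose Suc k)"
      using binomial_absorb_comp[of n k] binomial_absorption[of k n] n by (metis Suc_pred' less_eq_Suc_le One_nat_def)
    then have 1: "real (Suc k) * real (n choose Suc k) = v * u" unfolding u_def v_def by (metis of_nat_mult)
    have "(n - k) * (n choose k) = n * ((n - 1) choose k)" by (rule binomial_absorb_comp)
    then have "v * u = real n * real ((n - 1) choose k)" unfolding u_def v_def by (metis of_nat_mult)
    then have 2: "real ((n - 1) choose k) = v * u / real n" using n by (simp add: field_simps)
    have nk: "real n = real k + v" using n by (simp add: v_def of_nat_diff)
    have "real c / (real (Suc k) * real (n choose Suc k)) =
      real c / (real k * real ((n - 1) choose k)) - real c / (real k * real (n choose k))"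
      unfolding 1 2 u_def[symmetric] using uv n by (simp add: field_simps nk)
    moreover have "real c / (real k * real ((n - 1) choose k)) \<in> \<int>" using Suc.IH[of "n - 1"] Suc.prems False by simp
    moreover have "real c / (real k * real (n choose k)) \<in> \<int>" using Suc.IH[of n] Suc.prems False by simp
    ultimately show ?thesis by simp
  qed
qed simp

text \<open>Entry q in row 2q of the Leibniz triangle shows that \<open>c\<close> is a positive
  multiple of q (2q choose q), which is at least 4^q / 2.\<close>

lemma common_multiple_ge:
  fixes c :: nat
  assumes "0 < c" "\<And>i. 1 \<le> i \<Longrightarrow> i \<le> 2 * q \<Longrightarrow> i dvd c" "0 < q"
  shows "2 ^ q \<le> c"
proof -
  let ?b = "real q * real ((2 * q) choose q)"
  have "real c / ?b \<in> \<int>" using leibniz_triangle_integral[of "2 * q" c q "2 * q"] assms by simp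
  moreover have "real c / ?b > 0" using assms by simp
  ultimately have "1 \<le> real c / ?b" by (auto elim!: Ints_cases)
  then have "?b \<le> real c" using assms by (simp add: field_simps)
  moreover have "4 ^ q / 2 \<le> ?b" using central_binomial_lower_bound[OF assms(3)] assms(3) by (simp add: field_simps)
  moreover have "(2::real) ^ q \<le> 4 ^ q / 2"
  proof -
    have "(2::real) * 2 ^ q \<le> 2 ^ q * 2 ^ q" using assms(3) by (intro mult_right_mono) (auto simp: self_le_power)
    also have "\<dots> = 4 ^ q" by (simp add: power_mult_distrib[symmetric])
    finally show ?thesis by simp
  qed
  ultimately have "2 ^ q \<le> real c" by linarith
  then show ?thesis using of_nat_le_iff[of "2 ^ q" c, where 'a = real] by simp
qed

text \<open>A modulus that is not injective on \<open>S\<close> divides the product of all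
  differences, which is less than 2^q. If all numbers up to 2q failed, this product would be a
  common multiple of them and hence at least 2^q. If \<open>m\<close> itself is within the bound, it
  is taken as the modulus; this secures \<open>r <= m\<close>, so that the modulus fits a
  word.\<close>

lemma injective_modulus:
  fixes S :: "nat set"
  assumes "S \<subseteq> {..<m}" "m \<le> 2 ^ k" "0 < m"
  shows "\<exists>r. 0 < r \<and> r \<le> m \<and> r \<le> 2 * ((card S)\<^sup>2 * k + 1) \<and> inj_on (\<lambda>x. x mod r) S"
proof (cases "m \<le> 2 * ((card S)\<^sup>2 * k + 1)")
  case True
  have "inj_on (\<lambda>x. x mod m) S" using assms(1) by (auto simp: inj_on_def subset_iff)
  then show ?thesis using True assms by blast
next
  case False
  have fin: "finite S" using assms(1) finite_subset by blast
  define q where "q = (card S)\<^sup>2 * k + 1"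
  define P where "P = {(x, y) \<in> S \<times> S. x < y}"
  define c where "c = (\<Prod>(x, y)\<in>P. y - x)"
  have finP: "finite P" unfolding P_def using fin by (auto intro: finite_subset[of _ "S \<times> S"])
  have "card P \<le> card (S \<times> S)" unfolding P_def using fin by (intro card_mono) auto
  then have cP: "card P \<le> (card S)\<^sup>2" by (simp add: card_cartesian_product power2_eq_square)
  have "c \<le> (\<Prod>xy\<in>P. 2 ^ k)" unfolding c_def
  proof (rule prod_mono)
    fix xy assume "xy \<in> P"
    then obtain x y where "xy = (x, y)" "y \<in> S" by (auto simp: P_def)
    then show "0 \<le> (case xy of (x, y) \<Rightarrow> y - x) \<and> (case xy of (x, y) \<Rightarrow> y - x) \<le> 2 ^ k" using assms by fastforce
  qed
  also have "\<dots> = (2 ^ k) ^ card P" by simp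
  also have "\<dots> \<le> (2 ^ k) ^ (card S)\<^sup>2" using cP by (intro power_increasing) auto
  also have "\<dots> < 2 ^ q" by (simp add: q_def power_mult[symmetric] mult.commute)
  finally have lt: "c < 2 ^ q" .
  have "0 < c" unfolding c_def by (rule prod_pos) (auto simp: P_def)
  have "\<exists>r. 1 \<le> r \<and> r \<le> 2 * q \<and> inj_on (\<lambda>x. x mod r) S"
  proof (rule ccontr)
    assume *: "\<nexists>r. 1 \<le> r \<and> r \<le> 2 * q \<and> inj_on (\<lambda>x. x mod r) S"
    have "r dvd c" if r: "1 \<le> r" "r \<le> 2 * q" for r
    proof -
      obtain x y where "x \<in> S" "y \<in> S" "x mod r = y mod r" "x < y"
        using * r unfolding inj_on_def by (metis linorder_neqE_nat)
      then have "(x, y) \<in> P" "r dvd y - x" using mod_eq_dvd_iff_nat[where m = y and n = x and q = r] by (auto simp: P_def)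
      then show ?thesis unfolding c_def using dvd_prodI[OF finP, of "(x, y)" "\<lambda>(x, y). y - x"] by (auto intro: dvd_trans)
    qed
    then have "2 ^ q \<le> c" using common_multiple_ge[OF \<open>0 < c\<close>, of q] by (auto simp: q_def)
    then show False using lt by simp
  qed
  then obtain r where "1 \<le> r" "r \<le> 2 * q" "inj_on (\<lambda>x. x mod r) S" by blast
  then show ?thesis using False by (intro exI[of _ r]) (auto simp: q_def)
qed

text \<open>Multiply-shift hashing: the \<open>s\<close> most significant of the \<open>l\<close> bits of \<open>a y mod 2\<^sup>l\<close>.\<close>

definition mshift :: "nat \<Rightarrow> nat \<Rightarrow> nat \<Rightarrow> nat \<Rightarrow> nat" where
  "mshift l a s y = (a * y mod 2 ^ l) * 2 ^ s div 2 ^ l"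

lemma mshift_less: "mshift l a s y < 2 ^ s"
proof -
  have "(a * y mod 2 ^ l) * 2 ^ s < 2 ^ s * 2 ^ l" by (subst mult.commute) simp
  then show ?thesis unfolding mshift_def by (rule less_mult_imp_div_less)
qed

lemma card_odd_less: "card {v. odd v \<and> v < (2::nat) ^ Suc k} = 2 ^ k"
proof -
  have "{v. odd v \<and> v < (2::nat) ^ Suc k} = (\<lambda>j. 2 * j + 1) ` {..<2 ^ k}"
    by (auto elim!: oddE)
  then show ?thesis by (simp add: card_image inj_on_def)
qed

lemma odd_part: "0 < d \<Longrightarrow> \<exists>i u. d = 2 ^ i * u \<and> odd (u::nat)"
proof (induction d rule: less_induct)
  case (less d)
  show ?case
  proof (cases "odd d")
    case True
    then show ?thesis by (intro exI[of _ 0] exI[of _ d]) simp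
  next
    case False
    then obtain e where e: "d = 2 * e" by auto
    then obtain i u where "e = 2 ^ i * u" "odd u" using less.IH[of e] less.prems by auto
    then show ?thesis using e by (intro exI[of _ "Suc i"] exI[of _ u]) simp
  qed
qed

text \<open>Write y - x = 2^i u with u odd. A collision forces a (y - x) mod 2^l to lie, cyclically,
  within 2^(l-s) of 0, so the odd number v = a u mod 2^(l-i) or its negative is below 2^(l-i-s). As
  u is invertible, each v arises from at most 2^i multipliers. Since only 2^(l-1) multipliers are
  odd, the collision probability is at most 2 / 2^s.\<close>

lemma mshift_collisions:
  assumes xy: "x < y" "y < 2 ^ l"
  shows "card {a. odd a \<and> a < 2 ^ l \<and> mshift l a s x = mshift l a s y} * 2 ^ s \<le> 2 ^ l"
proof -
  let ?C = "{a. odd a \<and> a < 2 ^ l \<and> mshift l a s x = mshift l a s y}"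
  obtain i u where iu: "y - x = 2 ^ i * u" "odd u" using odd_part[of "y - x"] xy by auto
  have "2 ^ i \<le> y - x" using iu by (simp add: odd_pos Suc_leI)
  then have "(2::nat) ^ i < 2 ^ l" using xy by linarith
  then have il: "i < l" by simp
  have l2: "(2::nat) ^ l = 2 ^ i * 2 ^ (l - i)" using il by (simp add: power_add[symmetric])
  let ?v = "\<lambda>a. a * u mod 2 ^ (l - i)"
  have vodd: "odd (?v a)" if "odd a" for a
    using that iu il dvd_mod_iff[of 2 "2 ^ (l - i)" "a * u"] by simp
  have vless: "?v a < 2 ^ (l - i)" for a by simp
  have div_eq: "q < p + N" if "p div N = q div N" "0 < N" for p q N :: nat
  proof -
    have "q = N * (q div N) + q mod N" by simp
    also have "\<dots> < N * (p div N) + N"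
      unfolding that(1) using mod_less_divisor[OF that(2), of q] by (rule add_strict_left_mono)
    also have "\<dots> \<le> p + N" by simp
    finally show ?thesis .
  qed
  have near: "2 ^ i * ?v a * 2 ^ s < 2 ^ l \<or> 2 ^ i * (2 ^ (l - i) - ?v a) * 2 ^ s < 2 ^ l" if a: "a \<in> ?C" for a
  proof -
    define X Y z where "X = a * x mod 2 ^ l" and "Y = a * y mod 2 ^ l" and "z = a * (y - x) mod 2 ^ l"
    have z: "2 ^ i * ?v a = z"
      unfolding z_def iu(1) l2 by (simp only: mult_mod_right) (simp only: mult.left_commute)
    then have z': "2 ^ i * (2 ^ (l - i) - ?v a) = 2 ^ l - z" by (simp add: diff_mult_distrib2 l2)
    have "X * 2 ^ s div 2 ^ l = Y * 2 ^ s div 2 ^ l" using a by (simp add: mshift_def X_def Y_def)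
    from div_eq[OF this] div_eq[OF this[symmetric]]
    have close: "Y * 2 ^ s < X * 2 ^ s + 2 ^ l" "X * 2 ^ s < Y * 2 ^ s + 2 ^ l" by auto
    have lt: "X < 2 ^ l" "z < 2 ^ l" by (simp_all add: X_def z_def)
    have "(z + X) mod 2 ^ l = Y"
      unfolding z_def X_def Y_def mod_add_eq using xy by (simp add: distrib_left[symmetric])
    then have "z + X = Y \<or> z + X = Y + 2 ^ l"
      using lt mod_if[of "z + X" "2 ^ l"] le_mod_geq[of "2 ^ l" "z + X"]
      by (cases "z + X < 2 ^ l") auto
    then show ?thesis
    proof
      assume "z + X = Y"
      then have "z * 2 ^ s + X * 2 ^ s = Y * 2 ^ s" by (metis distrib_right)
      then show ?thesis unfolding z using close by linarith
    next
      assume "z + X = Y + 2 ^ l"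
      then have "2 ^ l - z + Y = X" using lt by simp
      then have "(2 ^ l - z) * 2 ^ s + Y * 2 ^ s = X * 2 ^ s" by (metis distrib_right)
      then show ?thesis unfolding z z' using close by linarith
    qed
  qed
  show ?thesis
  proof (cases "l \<le> i + s")
    case True
    then have big: "(2::nat) ^ l \<le> 2 ^ i * 2 ^ s" by (simp add: power_add[symmetric])
    \<comment> \<open>The interval around 0 is now too short to contain an odd multiple of
      2^i.\<close>
    have "?C = {}"
    proof (rule ccontr)
      assume "?C \<noteq> {}"
      then obtain a where a: "a \<in> ?C" by blast
      have "1 \<le> ?v a" "1 \<le> 2 ^ (l - i) - ?v a" using vodd[of a] vless[of a] a by (auto simp: odd_pos Suc_leI)
      then have "2 ^ i * 1 * 2 ^ s \<le> 2 ^ i * ?v a * 2 ^ s" "2 ^ i * 1 * 2 ^ s \<le> 2 ^ i * (2 ^ (l - i) - ?v a) * 2 ^ s"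
        by (intro mult_le_mono order_refl; simp)+
      then show False using near[OF a] big by linarith
    qed
    then show ?thesis by (simp only: card.empty mult_0 zero_le)
  next
    case False
    define e where "e = l - i - s"
    have e: "l - i = e + s" "0 < e" "l = i + (e + s)" using False by (auto simp: e_def)
    define O1 where "O1 = {v. odd v \<and> v < (2::nat) ^ e}"
    define V where "V = O1 \<union> (\<lambda>v. 2 ^ (l - i) - v) ` O1"
    have finO: "finite O1" unfolding O1_def by (rule finite_subset[of _ "{..<2 ^ e}"]) auto
    have "card O1 = 2 ^ (e - 1)" using card_odd_less[of "e - 1"] e by (simp add: O1_def)
    moreover have "card V \<le> card O1 + card O1"
      unfolding V_def by (rule order_trans[OF card_Un_le]) (simp add: card_image_le finO)
    moreover have "2 ^ (e - 1) + 2 ^ (e - 1) = (2::nat) ^ e" using e by (cases e) auto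
    ultimately have cV: "card V \<le> 2 ^ e" by simp
    \<comment> \<open>A multiplier is encoded by \<open>?v a\<close>, which determines its low
      \<open>l - i\<close> bits, together with its remaining \<open>i\<close> bits.\<close>
    have "(\<lambda>a. (?v a, a div 2 ^ (l - i))) ` ?C \<subseteq> V \<times> {..<2 ^ i}"
    proof (clarsimp, intro conjI)
      fix a assume a: "odd a" "a < 2 ^ l" "mshift l a s x = mshift l a s y"
      then have aC: "a \<in> ?C" by simp
      show "a div 2 ^ (l - i) < 2 ^ i" using a(2) unfolding l2 by (rule less_mult_imp_div_less)
      have le: "(2::nat) ^ l = 2 ^ i * (2 ^ e * 2 ^ s)" using e(3) by (simp add: power_add)
      have shrink: "t < 2 ^ e" if "2 ^ i * t * 2 ^ s < 2 ^ l" for t :: nat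
        using that unfolding le by (simp add: mult.assoc)
      have "odd (2 ^ (l - i) - v)" if "odd v" "v < 2 ^ (l - i)" for v :: nat
        using that il by (simp add: not_less less_imp_le)
      then have odd2: "odd (2 ^ (l - i) - ?v a)" using vodd[OF a(1)] vless[of a] by blast
      from near[OF aC] show "?v a \<in> V"
      proof
        assume "2 ^ i * ?v a * 2 ^ s < 2 ^ l"
        then show ?thesis using shrink vodd[OF a(1)] by (simp add: V_def O1_def)
      next
        assume "2 ^ i * (2 ^ (l - i) - ?v a) * 2 ^ s < 2 ^ l"
        then have "2 ^ (l - i) - ?v a \<in> O1" using shrink odd2 by (simp add: O1_def)
        moreover have "?v a = 2 ^ (l - i) - (2 ^ (l - i) - ?v a)" using vless[of a] by simp
        ultimately show ?thesis unfolding V_def by blast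
      qed
    qed
    moreover have "inj_on (\<lambda>a. (?v a, a div 2 ^ (l - i))) ?C"
    proof (rule inj_onI)
      fix a b assume ab: "(?v a, a div 2 ^ (l - i)) = (?v b, b div 2 ^ (l - i))"
      have cop: "coprime (2 ^ (l - i)) u" using iu(2) by simp
      have "a mod 2 ^ (l - i) = b mod 2 ^ (l - i)"
      proof (cases "b \<le> a")
        case True
        then have "2 ^ (l - i) dvd a * u - b * u" using ab mod_eq_dvd_iff_nat[where m = "a * u" and n = "b * u"] by simp
        then have "2 ^ (l - i) dvd a - b" using cop by (simp add: diff_mult_distrib[symmetric] coprime_dvd_mult_left_iff)
        then show ?thesis using True by (simp add: mod_eq_dvd_iff_nat)
      next
        case False
        then have "2 ^ (l - i) dvd b * u - a * u" using ab mod_eq_dvd_iff_nat[where m = "b * u" and n = "a * u", of "2 ^ (l - i)"] by simp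
        then have "2 ^ (l - i) dvd b - a" using cop by (simp add: diff_mult_distrib[symmetric] coprime_dvd_mult_left_iff)
        then show ?thesis using False mod_eq_dvd_iff_nat[where m = b and n = a, of "2 ^ (l - i)"] by simp
      qed
      then show "a = b" using ab by (metis div_mult_mod_eq Pair_inject)
    qed
    moreover have "finite V" using finO by (simp add: V_def)
    ultimately have "card ?C \<le> card (V \<times> {..<(2::nat) ^ i})"
      by (intro card_inj_on_le[of "\<lambda>a. (?v a, a div 2 ^ (l - i))"]) auto
    also have "\<dots> \<le> 2 ^ e * 2 ^ i" using cV by (simp add: card_cartesian_product)
    finally have "card ?C * 2 ^ s \<le> 2 ^ e * 2 ^ i * 2 ^ s" by (rule mult_le_mono1)
    also have "\<dots> = 2 ^ l" unfolding e(3) by (simp add: power_add)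
    finally show ?thesis .
  qed
qed

lemma averaging:
  fixes f :: "'a \<Rightarrow> nat"
  assumes "finite A" "A \<noteq> {}" "(\<Sum>a\<in>A. f a) \<le> card A * k"
  shows "\<exists>a\<in>A. f a \<le> k"
proof (rule ccontr)
  assume "\<not> (\<exists>a\<in>A. f a \<le> k)"
  then have "(\<Sum>a\<in>A. Suc k) \<le> (\<Sum>a\<in>A. f a)" by (intro sum_mono) (auto simp: not_le Suc_le_eq)
  moreover have "card A > 0" using assms by (simp add: card_gt_0_iff)
  ultimately show False using assms(3) by simp
qed

lemma floorlog_zero [simp]: "floorlog b 0 = 0"
  by (simp add: floorlog_def)

lemma floorlog_div2: "0 < n \<Longrightarrow> k \<le> n div 2 \<Longrightarrow> Suc (floorlog 2 k) \<le> floorlog 2 n"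
  using floorlog_mono[of k "n div 2" 2] by (subst compute_floorlog[of 2 n]) auto

text \<open>Some seed serves at least half of the buckets. Putting it first in the list and recursing on the other
  buckets makes the positions of the seeds that are used sum up to at most the number of buckets.\<close>

lemma shared_seeds:
  assumes "finite I" "finite A" "A \<noteq> {}" "\<And>i. i \<in> I \<Longrightarrow> card A \<le> 2 * card {a\<in>A. good i a}"
  shows "\<exists>seeds j. set seeds \<subseteq> A \<and> length seeds \<le> floorlog 2 (card I) \<and>
     (\<forall>i\<in>I. j i < length seeds \<and> good i (seeds ! j i)) \<and> (\<Sum>i\<in>I. j i) \<le> card I"
  using assms(1,4)
proof (induction "card I" arbitrary: I rule: less_induct)
  case less
  show ?case
  proof (cases "I = {}")
    case True
    then show ?thesis by (intro exI[of _ "[]"]) simp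
  next
    case False
    let ?bad = "\<lambda>a. {i\<in>I. \<not> good i a}"
    have "\<exists>a\<in>A. 2 * card (?bad a) \<le> card I"
    proof (rule averaging[OF assms(2,3)])
      have "(\<Sum>a\<in>A. card (?bad a)) = (\<Sum>i\<in>I. card {a\<in>A. \<not> good i a})"
        using sum_multicount_gen[of A I "\<lambda>a i. \<not> good i a" "\<lambda>i. card {a\<in>A. \<not> good i a}"] assms(2) less.prems(1) by simp
      moreover have "2 * card {a\<in>A. \<not> good i a} \<le> card A" if "i \<in> I" for i
      proof -
        have "{a\<in>A. \<not> good i a} = A - {a\<in>A. good i a}" by blast
        then have "card {a\<in>A. \<not> good i a} = card A - card {a\<in>A. good i a}"
          using card_Diff_subset[of "{a\<in>A. good i a}" A] assms(2) by simp
        then show ?thesis using less.prems(2)[OF that] by simp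
      qed
      then have "(\<Sum>i\<in>I. 2 * card {a\<in>A. \<not> good i a}) \<le> (\<Sum>i\<in>I. card A)" by (rule sum_mono)
      ultimately show "(\<Sum>a\<in>A. 2 * card (?bad a)) \<le> card A * card I"
        by (simp add: sum_distrib_left[symmetric] mult.commute)
    qed
    then obtain a where a: "a \<in> A" "2 * card (?bad a) \<le> card I" by blast
    have cI: "0 < card I" using False less.prems(1) by (simp add: card_gt_0_iff)
    then have "card (?bad a) < card I" using a by linarith
    from less.hyps[OF this] less.prems obtain seeds j where sj: "set seeds \<subseteq> A" "length seeds \<le> floorlog 2 (card (?bad a))"
      "\<forall>i\<in>?bad a. j i < length seeds \<and> good i (seeds ! j i)" "(\<Sum>i\<in>?bad a. j i) \<le> card (?bad a)"
      by auto
    let ?j = "\<lambda>i. if good i a then 0 else Suc (j i)"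
    have "(\<Sum>i\<in>I. ?j i) = (\<Sum>i\<in>?bad a. Suc (j i))"
      by (rule sum.mono_neutral_cong_right) (use less.prems(1) in auto)
    also have "\<dots> \<le> card (?bad a) + card (?bad a)" using sj(4) by (simp add: sum_Suc)
    also have "\<dots> \<le> card I" using a by simp
    finally have sum: "(\<Sum>i\<in>I. ?j i) \<le> card I" .
    have "length (a # seeds) \<le> floorlog 2 (card I)"
      using sj(2) floorlog_div2[OF cI, of "card (?bad a)"] div_le_mono[OF a(2), of 2] by simp
    then show ?thesis using sj sum a(1)
      by (intro exI[of _ "a # seeds"] exI[of _ ?j]) auto
  qed
qed

section \<open>The two-level hash function\<close>

record hash_data =
  mod1 :: nat
  mod2 :: nat
  seed :: nat
  seeds :: "nat list"
  lg_size :: "nat \<Rightarrow> nat"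
  seed_index :: "nat \<Rightarrow> nat"

definition key :: "hash_data \<Rightarrow> nat \<Rightarrow> nat" where
  "key h x = x mod mod1 h mod mod2 h"

definition key_bits :: "hash_data \<Rightarrow> nat" where
  "key_bits h = floorlog 2 (mod2 h)"

definition bucket :: "hash_data \<Rightarrow> nat \<Rightarrow> nat \<Rightarrow> nat" where
  "bucket h L x = mshift (key_bits h) (seed h) L (key h x)"

definition place :: "hash_data \<Rightarrow> nat \<Rightarrow> nat \<Rightarrow> nat" where
  "place h L x = (let i = bucket h L x in
     mshift (key_bits h) (seeds h ! seed_index h i) (lg_size h i) (key h x))"

text \<open>Besides injectivity this records what determines the space: the sizes of the moduli, the
  number of seeds, and the total length of the ranges together with the two numbers that each bucket
  stores in unary.\<close>

definition hash_ok :: "nat \<Rightarrow> nat \<Rightarrow> nat set \<Rightarrow> hash_data \<Rightarrow> bool" where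
  "hash_ok m k S h \<longleftrightarrow> (let n = card S; L = floorlog 2 n; l = key_bits h in
     0 < mod1 h \<and> mod1 h \<le> m \<and> mod1 h \<le> 2 * (n\<^sup>2 * k + 1) \<and>
     0 < mod2 h \<and> mod2 h \<le> mod1 h \<and> mod2 h \<le> 2 * (n\<^sup>2 * floorlog 2 (mod1 h) + 1) \<and>
     seed h < 2 ^ l \<and> (\<forall>a\<in>set (seeds h). a < 2 ^ l) \<and> length (seeds h) \<le> L + 1 \<and>
     (\<forall>i<2 ^ L. seed_index h i < length (seeds h)) \<and>
     (\<Sum>i<2 ^ L. 2 ^ lg_size h i + lg_size h i + seed_index h i) \<le> 54 * n + 3 \<and>
     inj_on (\<lambda>x. (bucket h L x, place h L x)) S)"

lemma mod1_mod2_exist: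
  assumes "S \<subseteq> {..<m}" "m \<le> 2 ^ k" "0 < m" "card S = n"
  shows "\<exists>r1 r2. 0 < r1 \<and> r1 \<le> m \<and> r1 \<le> 2 * (n\<^sup>2 * k + 1) \<and> 0 < r2 \<and> r2 \<le> r1 \<and>
    r2 \<le> 2 * (n\<^sup>2 * floorlog 2 r1 + 1) \<and> inj_on (\<lambda>x. x mod r1 mod r2) S"
proof -
  obtain r1 where r1: "0 < r1" "r1 \<le> m" "r1 \<le> 2 * (n\<^sup>2 * k + 1)" "inj_on (\<lambda>x. x mod r1) S"
    using injective_modulus[OF assms(1-3)] assms(4) by blast
  let ?S = "(\<lambda>x. x mod r1) ` S"
  have "card ?S = n" using r1(4) assms(4) by (simp add: card_image)
  moreover have "?S \<subseteq> {..<r1}" using r1(1) by auto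
  ultimately obtain r2 where r2: "0 < r2" "r2 \<le> r1" "r2 \<le> 2 * (n\<^sup>2 * floorlog 2 r1 + 1)" "inj_on (\<lambda>y. y mod r2) ?S"
    using injective_modulus[of ?S r1 "floorlog 2 r1"] less_floorlog[of r1] r1(1) by (auto simp: less_imp_le)
  have "inj_on (\<lambda>x. x mod r1 mod r2) S"
    using comp_inj_on[OF r1(4) r2(4)] by (simp add: o_def)
  then show ?thesis using r1 r2 by blast
qed

text \<open>A fixed pair collides for at most the fraction 2 / 2^L of the odd multipliers, so some
  multiplier has at most 2 n colliding ordered pairs. The squares of the bucket sizes count these
  and the n pairs on the diagonal.\<close>

lemma few_collisions:
  assumes "finite Y" "Y \<subseteq> {..<2 ^ l}" "0 < l" "card Y < 2 ^ L"
  shows "\<exists>a. odd a \<and> a < 2 ^ l \<and> (\<Sum>i<2 ^ L. (card {y\<in>Y. mshift l a L y = i})\<^sup>2) \<le> 3 * card Y"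
proof -
  let ?A = "{a. odd a \<and> a < (2::nat) ^ l}"
  let ?n = "card Y"
  define Q where "Q = {(x, y) \<in> Y \<times> Y. x \<noteq> y}"
  let ?c = "\<lambda>a. {q\<in>Q. mshift l a L (fst q) = mshift l a L (snd q)}"
  have finA: "finite ?A" by (rule finite_subset[of _ "{..<2 ^ l}"]) auto
  have cA: "2 * card ?A = 2 ^ l" using card_odd_less[of "l - 1"] assms(3) by (cases l) auto
  have finQ: "finite Q" unfolding Q_def using assms(1) by (auto intro: finite_subset[of _ "Y \<times> Y"])
  have "card Q \<le> ?n * ?n"
    unfolding Q_def using assms(1) card_mono[of "Y \<times> Y" "{(x, y) \<in> Y \<times> Y. x \<noteq> y}"] by (auto simp: card_cartesian_product)
  have "\<exists>a\<in>?A. card (?c a) \<le> 2 * ?n"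
  proof (rule averaging[OF finA])
    show "?A \<noteq> {}" using one_less_power[of "2::nat" l] assms(3) by (auto intro!: exI[of _ 1])
    have "(\<Sum>a\<in>?A. card (?c a)) = (\<Sum>q\<in>Q. card {a\<in>?A. mshift l a L (fst q) = mshift l a L (snd q)})"
      using sum_multicount_gen[OF finA finQ, of "\<lambda>a q. mshift l a L (fst q) = mshift l a L (snd q)"
          "\<lambda>q. card {a\<in>?A. mshift l a L (fst q) = mshift l a L (snd q)}"] by simp
    moreover have "card {a\<in>?A. mshift l a L (fst q) = mshift l a L (snd q)} * 2 ^ L \<le> 2 ^ l" if "q \<in> Q" for q
    proof -
      have "\<And>x y. {a\<in>?A. mshift l a L x = mshift l a L y} = {a. odd a \<and> a < 2 ^ l \<and> mshift l a L x = mshift l a L y}"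
        by auto
      moreover have "fst q < snd q \<or> snd q < fst q" "fst q < 2 ^ l" "snd q < 2 ^ l"
        using that assms(2) by (auto simp: Q_def)
      ultimately show ?thesis
        using mshift_collisions[of "fst q" "snd q" l L] mshift_collisions[of "snd q" "fst q" l L]
        by (auto simp: eq_commute)
    qed
    then have "(\<Sum>q\<in>Q. card {a\<in>?A. mshift l a L (fst q) = mshift l a L (snd q)} * 2 ^ L) \<le> (\<Sum>q\<in>Q. 2 ^ l)"
      by (rule sum_mono)
    ultimately have "(\<Sum>a\<in>?A. card (?c a)) * 2 ^ L \<le> card Q * 2 ^ l" by (simp add: sum_distrib_right)
    also have "\<dots> \<le> ?n * 2 ^ L * 2 ^ l"
      using \<open>card Q \<le> ?n * ?n\<close> assms(4) by (intro mult_le_mono1) (meson le_trans less_imp_le mult_le_mono2)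
    also have "\<dots> = (card ?A * (2 * ?n)) * 2 ^ L" using cA by (simp add: algebra_simps)
    finally show "(\<Sum>a\<in>?A. card (?c a)) \<le> card ?A * (2 * ?n)" by simp
  qed
  then obtain a where a: "odd a" "a < 2 ^ l" "card (?c a) \<le> 2 * ?n" by blast
  let ?B = "\<lambda>i. {y\<in>Y. mshift l a L y = i}"
  have "(\<Sum>i<2 ^ L. (card (?B i))\<^sup>2) = (\<Sum>i<2 ^ L. card (?B i \<times> ?B i))"
    by (simp add: card_cartesian_product power2_eq_square)
  also have "\<dots> = card (\<Union>i\<in>{..<2 ^ L}. ?B i \<times> ?B i)"
    using assms(1) by (intro card_UN_disjoint[symmetric]) auto
  also have "\<dots> \<le> card ((\<lambda>y. (y, y)) ` Y \<union> ?c a)"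
    using assms(1) finQ by (intro card_mono) (auto simp: Q_def)
  also have "\<dots> \<le> card ((\<lambda>y. (y, y)) ` Y) + card (?c a)" by (rule card_Un_le)
  also have "\<dots> \<le> ?n + 2 * ?n" using a(3) assms(1) by (intro add_mono card_image_le)
  finally show ?thesis using a by auto
qed

text \<open>Union bound: fewer than 2^s / 4 pairs, each spoiled by at most 2^l / 2^s multipliers,
  leave at most 2^l / 4 bad ones, half of the odd multipliers.\<close>

lemma injective_for_half:
  assumes "finite B" "B \<subseteq> {..<2 ^ l}" "4 * (card B)\<^sup>2 < 2 ^ s"
  shows "card {a. odd a \<and> a < (2::nat) ^ l} \<le> 2 * card {a \<in> {a. odd a \<and> a < (2::nat) ^ l}. inj_on (mshift l a s) B}"
proof -
  let ?A = "{a. odd a \<and> a < (2::nat) ^ l}"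
  define Q where "Q = {(x, y) \<in> B \<times> B. x < y}"
  let ?C = "\<lambda>(x, y). {a. odd a \<and> a < 2 ^ l \<and> mshift l a s x = mshift l a s y}"
  have finA: "finite ?A" by (rule finite_subset[of _ "{..<2 ^ l}"]) auto
  have finQ: "finite Q" unfolding Q_def using assms(1) by (auto intro: finite_subset[of _ "B \<times> B"])
  have cQ: "card Q \<le> (card B)\<^sup>2"
    unfolding Q_def using assms(1) card_mono[of "B \<times> B" "{(x, y) \<in> B \<times> B. x < y}"]
    by (auto simp: card_cartesian_product power2_eq_square)
  let ?bad = "{a\<in>?A. \<not> inj_on (mshift l a s) B}"
  have "?bad \<subseteq> (\<Union>q\<in>Q. ?C q)"
  proof
    fix a assume a: "a \<in> ?bad"
    then obtain x y where "x \<in> B" "y \<in> B" "x \<noteq> y" "mshift l a s x = mshift l a s y"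
      by (auto simp: inj_on_def)
    then have "\<exists>x\<in>B. \<exists>y\<in>B. x < y \<and> mshift l a s x = mshift l a s y"
      by (cases x y rule: linorder_cases) (fastforce simp: eq_commute)+
    then show "a \<in> (\<Union>q\<in>Q. ?C q)" using a by (auto simp: Q_def)
  qed
  moreover have "finite (?C q)" for q by (rule finite_subset[OF _ finA]) (auto split: prod.splits)
  ultimately have "card ?bad \<le> (\<Sum>q\<in>Q. card (?C q))"
    using finQ by (intro order_trans[OF card_mono card_UN_le]) auto
  then have "card ?bad * 2 ^ s \<le> (\<Sum>q\<in>Q. card (?C q) * 2 ^ s)"
    by (simp only: sum_distrib_right[symmetric]) simp
  also have "\<dots> \<le> (\<Sum>q\<in>Q. 2 ^ l)"
    using assms(2) by (intro sum_mono) (auto simp: Q_def intro!: mshift_collisions)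
  also have "\<dots> \<le> (card B)\<^sup>2 * 2 ^ l" using cQ by simp
  finally have 1: "card ?bad * 2 ^ s \<le> (card B)\<^sup>2 * 2 ^ l" .
  have "4 * card ?bad \<le> 2 ^ l"
  proof (cases "card B = 0")
    case True
    then have "card ?bad = 0" using 1 by simp
    then show ?thesis by (simp only: mult_0_right zero_le)
  next
    case False
    have "card ?bad * (4 * (card B)\<^sup>2) \<le> card ?bad * 2 ^ s" using assms(3) by (intro mult_le_mono) auto
    also note 1
    finally have "(4 * card ?bad) * (card B)\<^sup>2 \<le> 2 ^ l * (card B)\<^sup>2" by (simp only: mult_ac)
    then show ?thesis using False by (simp only: mult_le_cancel2) simp
  qed
  \<comment> \<open>The summand 1 is for \<open>l = 0\<close>, where there is no odd
    multiplier.\<close>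
  moreover have "2 ^ l \<le> 2 * card ?A + 1" using card_odd_less[of "l - 1"] by (cases l) auto
  ultimately have "2 * card ?bad \<le> card ?A" by linarith
  moreover have "card ?A = card {a\<in>?A. inj_on (mshift l a s) B} + card ?bad"
  proof -
    have eq: "{a\<in>?A. inj_on (mshift l a s) B} \<union> ?bad = ?A" by blast
    have "card ({a\<in>?A. inj_on (mshift l a s) B} \<union> ?bad) = card {a\<in>?A. inj_on (mshift l a s) B} + card ?bad"
      by (rule card_Un_disjoint) (use finA in auto)
    then show ?thesis unfolding eq .
  qed
  ultimately show ?thesis by linarith
qed

lemma hash_exists:
  assumes "S \<subseteq> {..<m}" "m \<le> 2 ^ k" "0 < m"
  shows "\<exists>h. hash_ok m k S h"
proof -
  define n L where "n = card S" and "L = floorlog 2 n"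
  have finS: "finite S" using assms(1) finite_subset by blast
  obtain r1 r2 where r: "0 < r1" "r1 \<le> m" "r1 \<le> 2 * (n\<^sup>2 * k + 1)" "0 < r2" "r2 \<le> r1"
    "r2 \<le> 2 * (n\<^sup>2 * floorlog 2 r1 + 1)" "inj_on (\<lambda>x. x mod r1 mod r2) S"
    using mod1_mod2_exist[OF assms, of n] by (auto simp: n_def)
  define y where "y = (\<lambda>x. x mod r1 mod r2)"
  define l where "l = floorlog 2 r2"
  define Y where "Y = y ` S"
  have injy: "inj_on y S" using r(7) by (simp add: y_def)
  have Y: "finite Y" "card Y = n" using injy finS by (auto simp: Y_def n_def card_image)
  have yl: "y x < 2 ^ l" for x
    unfolding y_def l_def using r(4) less_floorlog[of r2] by (intro less_trans[OF mod_less_divisor]) auto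
  then have Yl: "Y \<subseteq> {..<2 ^ l}" by (auto simp: Y_def)
  have l: "0 < l" using less_floorlog[of r2] r(4) by (cases "l = 0") (auto simp: l_def)
  have nL: "n < 2 ^ L" by (simp add: L_def less_floorlog)
  have Ln: "2 ^ L \<le> 2 * n + 1" using floorlog_power_le[of n] by (cases "n = 0") (auto simp: L_def floorlog_def)
  obtain a0 where a0: "odd a0" "a0 < 2 ^ l" "(\<Sum>i<2 ^ L. (card {z\<in>Y. mshift l a0 L z = i})\<^sup>2) \<le> 3 * n"
    using few_collisions[OF Y(1) Yl l, of L] Y nL by auto
  define B where "B = (\<lambda>i. {z\<in>Y. mshift l a0 L z = i})"
  \<comment> \<open>The least exponent that \<open>injective_for_half\<close> admits. The range is
    then at most 8 times the squared bucket size plus 1, and the ranges sum to at most 24 n +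
    2^L.\<close>
  define s where "s = (\<lambda>i. floorlog 2 (4 * (card (B i))\<^sup>2))"
  let ?A = "{a. odd a \<and> a < (2::nat) ^ l}"
  have finA: "finite ?A" by (rule finite_subset[of _ "{..<2 ^ l}"]) auto
  have "?A \<noteq> {}" using a0 by blast
  moreover have "card ?A \<le> 2 * card {a\<in>?A. inj_on (mshift l a (s i)) (B i)}" for i
    using Y Yl by (intro injective_for_half) (auto simp: B_def s_def less_floorlog)
  ultimately obtain sd j where sd: "set sd \<subseteq> ?A" "length sd \<le> floorlog 2 (card {..<(2::nat) ^ L})"
    "\<forall>i\<in>{..<2 ^ L}. j i < length sd \<and> inj_on (mshift l (sd ! j i) (s i)) (B i)" "(\<Sum>i<2 ^ L. j i) \<le> card {..<(2::nat) ^ L}"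
    using shared_seeds[of "{..<2 ^ L}" ?A "\<lambda>i a. inj_on (mshift l a (s i)) (B i)"] finA by blast
  have lsd: "length sd \<le> L + 1"
    using sd(2) floorlog_le[of "2 ^ L" "L + 1"] by simp
  have "2 ^ s i \<le> 8 * (card (B i))\<^sup>2 + 1" for i
    using floorlog_power_le[of "4 * (card (B i))\<^sup>2"] by (cases "card (B i) = 0") (auto simp: s_def)
  then have "(\<Sum>i<2 ^ L. 2 ^ s i) \<le> (\<Sum>i<(2::nat) ^ L. 8 * (card (B i))\<^sup>2 + 1)" by (rule sum_mono)
  also have "\<dots> = 8 * (\<Sum>i<2 ^ L. (card (B i))\<^sup>2) + 2 ^ L" by (simp only: sum.distrib sum_distrib_left) simp
  also have "\<dots> \<le> 26 * n + 1" using a0(3) Ln by (simp add: B_def)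
  finally have sum1: "(\<Sum>i<2 ^ L. 2 ^ s i) \<le> 26 * n + 1" .
  have "(\<Sum>i<2 ^ L. s i) \<le> (\<Sum>i<(2::nat) ^ L. 2 ^ s i)" by (intro sum_mono) (simp add: less_imp_le)
  \<comment> \<open>26 n + 1 for the ranges, at most as much for their logarithms, and 2^L <= 2 n +
    1 for the seed numbers.\<close>
  then have total: "(\<Sum>i<2 ^ L. 2 ^ s i + s i + j i) \<le> 54 * n + 3"
    using sum1 sd(4) Ln by (simp add: sum.distrib)
  define h where "h = \<lparr>mod1 = r1, mod2 = r2, seed = a0, seeds = sd, lg_size = s, seed_index = j\<rparr>"
  have hy: "key h x = y x" "key_bits h = l" "bucket h L x = mshift l a0 L (y x)" for x
    by (simp_all add: h_def key_def y_def key_bits_def l_def bucket_def)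
  have pl: "place h L x = mshift l (sd ! j (bucket h L x)) (s (bucket h L x)) (y x)" for x
    by (simp add: place_def hy Let_def) (simp add: h_def)
  have "inj_on (\<lambda>x. (bucket h L x, place h L x)) S"
  proof (rule inj_onI)
    fix x x' assume xx: "x \<in> S" "x' \<in> S" "(bucket h L x, place h L x) = (bucket h L x', place h L x')"
    let ?i = "bucket h L x"
    have same: "bucket h L x' = ?i" "place h L x' = place h L x" using xx(3) by auto
    have i: "?i < 2 ^ L" by (simp add: hy mshift_less)
    have "y x \<in> B ?i" "y x' \<in> B ?i" using xx by (auto simp: B_def Y_def hy)
    moreover have "mshift l (sd ! j ?i) (s ?i) (y x) = mshift l (sd ! j ?i) (s ?i) (y x')"
      using same(2) unfolding pl same(1) by simp
    ultimately have "y x = y x'" using sd(3) i by (auto dest: inj_onD)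
    then show "x = x'" using injy xx by (auto dest: inj_onD)
  qed
  then have "hash_ok m k S h"
    unfolding hash_ok_def Let_def n_def[symmetric] L_def[symmetric] hy
    using r a0 sd lsd total by (auto simp: h_def)
  then show ?thesis ..
qed

section \<open>Sparse sets\<close>

text \<open>The bit length of the largest possible element, which is the ceiling of lg m.\<close>

definition clog :: "nat \<Rightarrow> nat" where
  "clog m = floorlog 2 (m - 1)"

lemma clog_ge: "m \<le> 2 ^ clog m"
  using less_floorlog[of "m - 1"] by (simp add: clog_def)

definition width :: "nat list \<Rightarrow> nat" where
  "width xs = floorlog 2 (Max (set (0 # xs)))"

lemma less_width: "x \<in> set xs \<Longrightarrow> x < 2 ^ width xs"
proof -
  assume "x \<in> set xs"
  then have "x \<le> Max (set (0 # xs))" by (intro Max_ge) auto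
  then show ?thesis unfolding width_def using less_floorlog by (rule le_less_trans)
qed

lemma width_le: "(\<And>x. x \<in> set xs \<Longrightarrow> x < 2 ^ e) \<Longrightarrow> width xs \<le> e"
  unfolding width_def by (rule floorlog_le, subst Max_less_iff) auto

lemma layout_bits_le:
  assumes "well_sized B X arrs" "B < 2 ^ e" "X < 2 ^ e"
  shows "length (layout arrs) \<le> (3 + 2 * length arrs) * e + 1 + array_bits arrs"
proof -
  have "x < 2 ^ e" if "x \<in> set (header_fields arrs)" for x
  proof -
    have "x \<le> B \<or> x \<le> X" using that assms(1) by (fastforce simp: header_fields_def well_sized_def)
    then show ?thesis using assms(2,3) by linarith
  qed
  then have b: "field_width arrs \<le> e" using width_le[of "header_fields arrs" e] by (simp add: field_width_def width_def)
  have "floorlog 2 (field_width arrs) \<le> field_width arrs" by (rule floorlog_le) simp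
  then have "3 * floorlog 2 (field_width arrs) \<le> 3 * e" using b by linarith
  moreover have "2 * length arrs * field_width arrs \<le> 2 * length arrs * e" using b by (rule mult_le_mono2)
  ultimately show ?thesis unfolding length_layout distrib_right by linarith
qed

lemma square_le_power: "f\<^sup>2 \<le> 2 * (2::nat) ^ f"
proof -
  have "(f + 3)\<^sup>2 \<le> 2 * (2::nat) ^ (f + 3)" for f
  proof (induction f)
    case (Suc f)
    have "(Suc f + 3)\<^sup>2 \<le> 2 * (f + 3)\<^sup>2" by (simp add: power2_eq_square algebra_simps)
    also have "\<dots> \<le> 2 * (2 * 2 ^ (f + 3))" using Suc by simp
    finally show ?case by (simp only: add_Suc power_Suc)
  qed simp
  from this[of "f - 3"] show ?thesis
  proof (cases "f < 3")
    case True
    then have "f = 0 \<or> f = 1 \<or> f = 2" by auto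
    then show ?thesis by auto
  qed simp
qed

lemma table_bits: "2 ^ (L div 2 + 1) * (L div 2 + 1)\<^sup>2 \<le> 8 * (2::nat) ^ L"
proof -
  let ?g = "L div 2 + 1"
  have "2 ^ ?g * ?g\<^sup>2 \<le> 2 ^ ?g * (2 * (2::nat) ^ ?g)" by (intro mult_le_mono2 square_le_power)
  also have "\<dots> = 2 * 2 ^ (2 * ?g)" by (simp only: mult_2[of ?g] power_add mult.left_commute mult.assoc)
  also have "\<dots> = 8 * 2 ^ (2 * (L div 2))" by simp
  also have "\<dots> \<le> 8 * 2 ^ L" by (intro mult_le_mono2 power_increasing) auto
  finally show ?thesis .
qed

lemma power_bound: "n < 2 ^ L \<Longrightarrow> c < 2 ^ z \<Longrightarrow> n\<^sup>2 * c + 1 \<le> (2::nat) ^ (2 * L + z)"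
proof -
  assume *: "n < 2 ^ L" "c < 2 ^ z"
  show ?thesis
  proof (cases "n = 0")
    case False
    then have "n\<^sup>2 * c + 1 \<le> n\<^sup>2 * (c + 1)" by simp
    also have "\<dots> \<le> (2 ^ L)\<^sup>2 * 2 ^ z" using * by (intro mult_le_mono power_mono) auto
    finally show ?thesis by (simp add: power_add power_mult mult.commute)
  qed simp
qed

locale sparse_set =
  fixes m :: nat and S :: "nat set" and h :: hash_data and k :: nat
  assumes S: "S \<subseteq> {..<m}" and m: "0 < m" and sparse: "512 * card S \<le> m"
    and hash: "hash_ok m (clog m) S h"
begin

definition "n = card S"
definition "L = floorlog 2 n"
text \<open>The split of Elias and Fano: the high parts stay below 2^L, so their increments sum to
  at most 2^L.\<close>

definition "low_bits = clog m - L"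
definition "elems = sorted_list_of_set S"
text \<open>Everything monotone is read off the prefix sums of one list, \<open>steps\<close>: first, for each bucket, the size of its
  range, the logarithm of this size and the number of its seed (so that prefix sums locate the range and differences give
  the other two), then the increments of the high parts, then the occupied positions.\<close>

definition "gaps = concat (map (\<lambda>i. [2 ^ lg_size h i, lg_size h i, seed_index h i]) [0..<2 ^ L])"
definition "high_gaps = map (\<lambda>i. elems ! i div 2 ^ low_bits - (if i = 0 then 0 else elems ! (i - 1) div 2 ^ low_bits)) [0..<n]"
text \<open>The entries for \<open>lg_size\<close> and \<open>seed_index\<close> leave dead cells
  behind each range. In return the start of a range is a plain prefix sum.\<close>

definition "pos x = sum_list (take (3 * bucket h L x) gaps) + place h L x"
definition "occupied = map (\<lambda>p. of_bool (p \<in> pos ` S) :: nat) [0..<sum_list gaps]"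
definition "steps = gaps @ high_gaps @ occupied"
text \<open>Ranking among the occupied cells compresses the O(n) cells, which makes the perfect hash
  function minimal on \<open>S\<close>.\<close>

definition "slot x = card {p \<in> pos ` S. p < pos x}"
definition "rank_of x = card {y \<in> S. y < x}"
text \<open>Entry \<open>n\<close> exists because all \<open>n\<close> occupied cells may lie below
  the position of a query outside \<open>S\<close>. Whatever block such a query reads, its
  candidates fail the comparison.\<close>

definition "blocks = map (\<lambda>i. if \<exists>x\<in>S. slot x = i then rank_of (SOME x. x \<in> S \<and> slot x = i) div 2 ^ k else 0) [0..<n + 1]"
definition "lows = map (\<lambda>x. x mod 2 ^ low_bits) elems"

lemma finite_S: "finite S" using S finite_subset by blast

lemma n_less: "n < 2 ^ L" by (simp add: L_def less_floorlog)

lemma L_le: "2 ^ L \<le> 2 * n + 1"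
  using floorlog_power_le[of n] by (cases "n = 0") (auto simp: L_def)

lemma L_clog: "L + low_bits = clog m"
proof -
  have "n < 2 ^ clog m" if "n > 0"
    using clog_ge[of m] sparse that by (simp add: n_def)
  then have "L \<le> clog m" unfolding L_def by (cases "n = 0") (auto intro: floorlog_le)
  then show ?thesis by (simp add: low_bits_def)
qed

lemma elems: "length elems = n" "set elems = S" "sorted_wrt (<) elems"
  using finite_S by (auto simp: elems_def n_def)

lemma hash_facts:
  "0 < mod1 h" "mod1 h \<le> m" "mod1 h \<le> 2 * (n\<^sup>2 * clog m + 1)" "0 < mod2 h" "mod2 h \<le> mod1 h"
  "mod2 h \<le> 2 * (n\<^sup>2 * floorlog 2 (mod1 h) + 1)" "seed h < 2 ^ key_bits h"
  "a \<in> set (seeds h) \<Longrightarrow> a < 2 ^ key_bits h" "length (seeds h) \<le> L + 1"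
  "i < 2 ^ L \<Longrightarrow> seed_index h i < length (seeds h)"
  "(\<Sum>i<2 ^ L. 2 ^ lg_size h i + lg_size h i + seed_index h i) \<le> 54 * n + 3"
  "inj_on (\<lambda>x. (bucket h L x, place h L x)) S"
  using hash by (auto simp: hash_ok_def Let_def n_def L_def)

lemma bucket_less: "bucket h L x < 2 ^ L"
  by (simp add: bucket_def mshift_less)

lemma length_gaps [simp]: "length gaps = 3 * 2 ^ L"
proof -
  have "length (concat (map (\<lambda>i. [2 ^ lg_size h i, lg_size h i, seed_index h i]) [0..<N])) = 3 * N" for N
    by (induction N) auto
  then show ?thesis by (simp add: gaps_def)
qed

lemma gaps_take:
  assumes "i < 2 ^ L"
  shows "take (3 * i + 3) gaps = take (3 * i) gaps @ [2 ^ lg_size h i, lg_size h i, seed_index h i]"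
proof -
  let ?f = "\<lambda>i. [2 ^ lg_size h i, lg_size h i, seed_index h i]"
  have len: "length (concat (map ?f [0..<N])) = 3 * N" for N by (induction N) auto
  have tk: "take (3 * j) gaps = concat (map ?f [0..<j])" if "j \<le> 2 ^ L" for j
  proof -
    have "[0..<2 ^ L] = [0..<j] @ [j..<2 ^ L]" using that by (metis le0 le_add_diff_inverse upt_add_eq_append)
    then have "gaps = concat (map ?f [0..<j]) @ concat (map ?f [j..<2 ^ L])" by (simp add: gaps_def)
    then show ?thesis using len[of j] by simp
  qed
  have "3 * i + 3 = 3 * Suc i" by simp
  then show ?thesis using tk[of i] tk[of "Suc i"] assms by (simp del: mult_Suc_right)
qed

lemma sum_gaps: "sum_list gaps \<le> 54 * n + 3"
proof -
  have "sum_list (concat (map (\<lambda>i. [2 ^ lg_size h i, lg_size h i, seed_index h i]) [0..<N])) =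
    (\<Sum>i<N. 2 ^ lg_size h i + lg_size h i + seed_index h i)" for N
    by (induction N) auto
  then show ?thesis using hash_facts(11) by (simp add: gaps_def)
qed

lemma sum_gaps_step:
  assumes "i < 2 ^ L"
  shows "sum_list (take (3 * i + 1) gaps) = sum_list (take (3 * i) gaps) + 2 ^ lg_size h i"
    "sum_list (take (3 * i + 2) gaps) = sum_list (take (3 * i) gaps) + 2 ^ lg_size h i + lg_size h i"
    "sum_list (take (3 * i + 3) gaps) = sum_list (take (3 * i) gaps) + 2 ^ lg_size h i + lg_size h i + seed_index h i"
proof -
  note t = gaps_take[OF assms]
  have l: "length (take (3 * i) gaps) = 3 * i" using assms by simp
  have "take (3 * i + 1) gaps = take (3 * i + 1) (take (3 * i + 3) gaps)" by simp
  also have "\<dots> = take (3 * i) gaps @ [2 ^ lg_size h i]" unfolding t take_append l by simp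
  finally show "sum_list (take (3 * i + 1) gaps) = sum_list (take (3 * i) gaps) + 2 ^ lg_size h i" by simp
  have "take (3 * i + 2) gaps = take (3 * i + 2) (take (3 * i + 3) gaps)" by simp
  also have "\<dots> = take (3 * i) gaps @ [2 ^ lg_size h i, lg_size h i]" unfolding t take_append l by simp
  finally show "sum_list (take (3 * i + 2) gaps) = sum_list (take (3 * i) gaps) + 2 ^ lg_size h i + lg_size h i" by simp
  show "sum_list (take (3 * i + 3) gaps) = sum_list (take (3 * i) gaps) + 2 ^ lg_size h i + lg_size h i + seed_index h i"
    unfolding t by simp
qed

lemma place_less: "place h L x < 2 ^ lg_size h (bucket h L x)"
  by (simp add: place_def Let_def mshift_less)

lemma pos_range: "sum_list (take (3 * bucket h L x) gaps) \<le> pos x"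
  "pos x < sum_list (take (3 * bucket h L x + 1) gaps)" "pos x < sum_list gaps"
proof -
  show "sum_list (take (3 * bucket h L x) gaps) \<le> pos x" by (simp add: pos_def)
  show lt: "pos x < sum_list (take (3 * bucket h L x + 1) gaps)"
    unfolding pos_def sum_gaps_step(1)[OF bucket_less] using place_less by simp
  have "sum_list (take (3 * bucket h L x + 1) gaps) \<le> sum_list (take (length gaps) gaps)"
    using bucket_less[of x] by (intro sum_take_mono) simp
  then show "pos x < sum_list gaps" using lt by simp
qed

text \<open>Ranges of different buckets are disjoint, and within one bucket \<open>place\<close> is
  injective.\<close>

lemma inj_pos: "inj_on pos S"
proof (rule inj_onI)
  fix x y assume xy: "x \<in> S" "y \<in> S" "pos x = pos y"
  have "\<not> bucket h L u < bucket h L v" if "pos u = pos v" for u v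
  proof
    assume "bucket h L u < bucket h L v"
    then have "sum_list (take (3 * bucket h L u + 1) gaps) \<le> sum_list (take (3 * bucket h L v) gaps)"
      by (intro sum_take_mono) simp
    then show False using pos_range(1)[of v] pos_range(2)[of u] that by simp
  qed
  then have b: "bucket h L x = bucket h L y" using xy(3) by (metis linorder_neqE_nat)
  then have "place h L x = place h L y" using xy(3) by (simp add: pos_def)
  then show "x = y" using b hash_facts(12) xy by (auto dest: inj_onD)
qed

lemma slot_le: "slot x \<le> n"
proof -
  have "slot x \<le> card (pos ` S)" unfolding slot_def using finite_S by (intro card_mono) auto
  then show ?thesis using finite_S card_image_le[of S pos] by (simp add: n_def)
qed

lemma inj_slot: "inj_on slot S"
proof (rule inj_onI)
  fix x y assume xy: "x \<in> S" "y \<in> S" "slot x = slot y"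
  have "sorted_list_of_set (pos ` S) ! slot x = pos x" if "x \<in> S" for x
    using finite_sorted_nth_card(1)[of "pos ` S" "pos x"] finite_S that by (simp add: slot_def)
  then have "pos x = pos y" using xy by metis
  then show "x = y" using inj_pos xy by (auto dest: inj_onD)
qed

lemma blocks_slot: assumes "x \<in> S" shows "blocks ! slot x = rank_of x div 2 ^ k"
proof -
  have "(SOME y. y \<in> S \<and> slot y = slot x) = x"
    using assms inj_slot by (intro some_equality) (auto dest: inj_onD)
  then show ?thesis using assms slot_le[of x] by (auto simp: blocks_def simp del: upt_Suc)
qed

lemma rank_of: assumes "x \<in> S" shows "rank_of x < n" "elems ! rank_of x = x"
  using finite_sorted_nth_card[OF finite_S assms] by (auto simp: rank_of_def elems_def n_def)

lemma elems_less: "i < n \<Longrightarrow> elems ! i < m"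
  using S elems nth_mem[of i elems] by auto

lemma high_less: assumes "i < n" shows "elems ! i div 2 ^ low_bits < 2 ^ L"
proof -
  have "elems ! i < 2 ^ L * 2 ^ low_bits"
    using elems_less[OF assms] clog_ge[of m] L_clog by (simp add: power_add[symmetric])
  then show ?thesis by (rule less_mult_imp_div_less)
qed

lemma sum_high: "i \<le> n \<Longrightarrow> sum_list (take i high_gaps) = (if i = 0 then 0 else elems ! (i - 1) div 2 ^ low_bits)"
proof (induction i)
  case (Suc i)
  then have "take (Suc i) high_gaps = take i high_gaps @ [high_gaps ! i]"
    by (intro take_Suc_conv_app_nth) (simp add: high_gaps_def)
  moreover have "elems ! (i - 1) div 2 ^ low_bits \<le> elems ! i div 2 ^ low_bits" if "i > 0"
    using sorted_wrt_nth_less[OF elems(3), of "i - 1" i] Suc.prems that elems(1) by (intro div_le_mono) simp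
  ultimately show ?case using Suc by (auto simp: high_gaps_def)
qed simp

lemma sum_occupied: "p \<le> sum_list gaps \<Longrightarrow> sum_list (take p occupied) = card {q \<in> pos ` S. q < p}"
proof (induction p)
  case (Suc p)
  then have "take (Suc p) occupied = take p occupied @ [occupied ! p]"
    by (intro take_Suc_conv_app_nth) (simp add: occupied_def)
  moreover have "{q \<in> pos ` S. q < Suc p} = {q \<in> pos ` S. q < p} \<union> (if p \<in> pos ` S then {p} else {})"
    by (auto simp: less_Suc_eq)
  ultimately show ?case using Suc finite_S by (auto simp: occupied_def)
qed simp

section \<open>Lookups in the prefix sums, and the space for sparse sets\<close>

definition "psums = prefix_sums steps"

lemma length_steps: "length steps = 3 * 2 ^ L + n + sum_list gaps"
  by (simp add: steps_def high_gaps_def occupied_def)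

lemma psums_nth: "i \<le> length steps \<Longrightarrow> psums ! i = sum_list (take i steps)"
  by (simp add: psums_def prefix_sums_def del: upt_Suc)

lemma psums_gaps: "i \<le> 3 * 2 ^ L \<Longrightarrow> psums ! i = sum_list (take i gaps)"
  using psums_nth[of i] length_steps by (simp add: steps_def)

lemma psums_high: "i \<le> n \<Longrightarrow> psums ! (3 * 2 ^ L + i) = sum_list gaps + sum_list (take i high_gaps)"
  using psums_nth[of "3 * 2 ^ L + i"] length_steps by (simp add: steps_def high_gaps_def)

lemma psums_occupied:
  "p \<le> sum_list gaps \<Longrightarrow>
    psums ! (3 * 2 ^ L + n + p) = sum_list gaps + sum_list high_gaps + sum_list (take p occupied)"
  using psums_nth[of "3 * 2 ^ L + n + p"] length_steps by (simp add: steps_def high_gaps_def)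

lemma lookup:
  assumes "i < 2 ^ L"
  shows "psums ! (3 * i) = sum_list (take (3 * i) gaps)"
    "psums ! (3 * i + 2) - psums ! (3 * i + 1) = lg_size h i"
    "psums ! (3 * i + 3) - psums ! (3 * i + 2) = seed_index h i"
    "psums ! (3 * i + 1) \<le> psums ! (3 * i + 2)" "psums ! (3 * i + 2) \<le> psums ! (3 * i + 3)"
proof -
  have s: "psums ! (3 * i + 1) = sum_list (take (3 * i + 1) gaps)" "psums ! (3 * i + 2) = sum_list (take (3 * i + 2) gaps)"
    "psums ! (3 * i + 3) = sum_list (take (3 * i + 3) gaps)" using assms by (intro psums_gaps; simp)+
  show "psums ! (3 * i) = sum_list (take (3 * i) gaps)" using assms by (intro psums_gaps) simp
  show "psums ! (3 * i + 2) - psums ! (3 * i + 1) = lg_size h i"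
    "psums ! (3 * i + 3) - psums ! (3 * i + 2) = seed_index h i"
    "psums ! (3 * i + 1) \<le> psums ! (3 * i + 2)" "psums ! (3 * i + 2) \<le> psums ! (3 * i + 3)"
    unfolding s sum_gaps_step[OF assms] by simp_all
qed

lemma lookup_high:
  assumes "i < n"
  shows "psums ! (3 * 2 ^ L + (i + 1)) - psums ! (3 * 2 ^ L) = elems ! i div 2 ^ low_bits"
    "psums ! (3 * 2 ^ L) \<le> psums ! (3 * 2 ^ L + (i + 1))"
  using psums_high[of 0] psums_high[of "i + 1"] sum_high[of "i + 1"] assms by auto

lemma lookup_slot:
  "psums ! (3 * 2 ^ L + n + pos x) - psums ! (3 * 2 ^ L + n) = slot x"
  "psums ! (3 * 2 ^ L + n) \<le> psums ! (3 * 2 ^ L + n + pos x)"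
  using psums_occupied[of 0] psums_occupied[of "pos x"] sum_occupied[of "pos x"] pos_range(3)[of x]
  by (auto simp: slot_def)

text \<open>The left side is at most 4 * 2^L + 110 n + 7, where \<open>sum_gaps\<close> enters
  twice. The factor is rounded up to a power of two, so that the shifted sums have
  \<open>L + 7\<close> bits.\<close>

lemma steps_size: "length steps + sum_list steps + 1 \<le> 128 * 2 ^ L"
proof -
  have "sum_list high_gaps \<le> 2 ^ L"
    using sum_high[of n] high_less[of "n - 1"] by (cases "n = 0") (auto simp: high_gaps_def)
  moreover have "sum_list occupied = card {q \<in> pos ` S. q < sum_list gaps}"
    using sum_occupied[of "sum_list gaps"] by (simp add: occupied_def)
  moreover have "card {q \<in> pos ` S. q < sum_list gaps} \<le> n"
    using card_mono[of "pos ` S" "{q \<in> pos ` S. q < sum_list gaps}"] card_image_le[of S pos] finite_S by (simp add: n_def)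
  ultimately show ?thesis using sum_gaps n_less length_steps by (simp add: steps_def)
qed

text \<open>About half of \<open>L\<close>: tables of 2^g g entries with g bits each stay within
  O(2^L), while numbers of \<open>L + 7\<close> bits still have O(g) bits.\<close>

definition "g = L div 2 + 1"

text \<open>The leading 0 marks the sparse format; \<open>dense_params\<close> start with 1. Every
  entry has O(L + z) bits, which excludes \<open>m\<close> itself.\<close>

definition "params = [0, n, L, low_bits, mod1 h, mod2 h, key_bits h, seed h, g]"

definition "arrays = [(width params, params), (key_bits h, seeds h), (low_bits, lows), (L - k, blocks)] @
  increasing_arrays g (L + 7) (shifted_sums steps)"

definition "z = floorlog 2 (clog m)"

lemma clog_less: "clog m < 2 ^ z"
  by (simp add: z_def less_floorlog)

lemma g_bounds: "0 < g" "L + 7 \<le> 8 * g" "g \<le> 2 ^ L" "2 ^ g * g\<^sup>2 \<le> 8 * 2 ^ L" "2 ^ g * g \<le> 8 * 2 ^ L"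
proof -
  show "0 < g" "L + 7 \<le> 8 * g" by (auto simp: g_def)
  have "L < 2 ^ L" by simp
  then show "g \<le> 2 ^ L" unfolding g_def by linarith
  show b: "2 ^ g * g\<^sup>2 \<le> 8 * 2 ^ L" unfolding g_def by (rule table_bits)
  have "2 ^ g * g \<le> 2 ^ g * g\<^sup>2" using \<open>0 < g\<close> by (simp add: power2_eq_square)
  then show "2 ^ g * g \<le> 8 * 2 ^ L" using b by (rule order_trans)
qed

lemma mod1_less: "mod1 h < 2 ^ (2 * L + z + 2)"
proof -
  have "mod1 h \<le> 2 * 2 ^ (2 * L + z)"
    using order_trans[OF hash_facts(3) mult_le_mono2[OF power_bound[OF n_less clog_less]]] .
  also have "\<dots> < 2 ^ (2 * L + z + 2)" by simp
  finally show ?thesis .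
qed

lemma key_power: "2 ^ key_bits h \<le> 2 * mod2 h"
  unfolding key_bits_def using hash_facts(4) by (rule floorlog_power_le)

lemma two_mod1_less: "2 * mod1 h < 2 ^ (2 * L + z + 3)"
proof -
  have "(2::nat) ^ (2 * L + z + 3) = 2 * 2 ^ (2 * L + z + 2)" by (simp add: power_add)
  then show ?thesis using mod1_less by linarith
qed

lemma params_less: "x \<in> set params \<Longrightarrow> x < 2 ^ (2 * L + z + 3)"
proof -
  have le: "a < 2 ^ (2 * L + z + 3)" if "a < 2 ^ e" "e \<le> 2 * L + z + 3" for a e :: nat
    using that by (meson less_le_trans power_increasing one_le_numeral)
  have m2: "2 * mod2 h < 2 ^ (2 * L + z + 3)" using two_mod1_less hash_facts(5) by linarith
  have "low_bits < 2 ^ z" using clog_less by (simp add: low_bits_def)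
  moreover have "g < 2 ^ (2 * L + z + 3)"
    by (rule le[of _ "L + 1"]) (use g_bounds(3) in \<open>auto intro: le_less_trans\<close>)
  moreover have "L < 2 ^ (2 * L + z + 3)" by (rule le[of _ L]) auto
  moreover have "key_bits h < 2 ^ (2 * L + z + 3)" using key_power m2 less_exp[of "key_bits h"] by linarith
  moreover have "seed h < 2 ^ (2 * L + z + 3)" using key_power m2 hash_facts(7) by linarith
  moreover have "mod1 h < 2 ^ (2 * L + z + 3)" using mod1_less by (rule le) simp
  moreover have "mod2 h < 2 ^ (2 * L + z + 3)" using m2 by simp
  ultimately show "x \<in> set params \<Longrightarrow> x < 2 ^ (2 * L + z + 3)"
    using n_less le by (auto simp: params_def)
qed

lemma key_bits_le: "key_bits h \<le> 2 * L + z + 3"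
proof -
  have "(2::nat) ^ key_bits h \<le> 2 * mod1 h" using key_power hash_facts(5) by linarith
  also have "\<dots> < 2 ^ (2 * L + z + 3)" by (rule two_mod1_less)
  finally show ?thesis by simp
qed

lemma width_params: "width params \<le> 2 * L + z + 3"
  by (rule width_le) (rule params_less)

text \<open>Here the second modulus pays off. With f the bit length of a bound on the length of
  \<open>mod1 h\<close>, a seed has at most 2 L + f + 2 bits. The mixed term f (L + 1) is at most
  f^2 + (L + 1)^2, where f^2 = O(L + z).\<close>

lemma seeds_bits: "key_bits h * length (seeds h) \<le> 12 * 2 ^ L + 4 * (2 * L + z + 2)"
proof -
  define y where "y = 2 * L + z + 2"
  define f where "f = floorlog 2 y"
  have "floorlog 2 (mod1 h) \<le> y" unfolding y_def by (rule floorlog_le[OF mod1_less])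
  also have "y < 2 ^ f" by (simp add: f_def less_floorlog)
  finally have "n\<^sup>2 * floorlog 2 (mod1 h) + 1 \<le> 2 ^ (2 * L + f)" by (intro power_bound n_less)
  from order_trans[OF hash_facts(6) mult_le_mono2[OF this]] have "mod2 h \<le> 2 * 2 ^ (2 * L + f)" .
  also have "\<dots> < 2 ^ (2 * L + f + 2)" by simp
  finally have "mod2 h < 2 ^ (2 * L + f + 2)" .
  then have l: "key_bits h \<le> 2 * L + f + 2" unfolding key_bits_def by (rule floorlog_le)
  have "key_bits h * length (seeds h) \<le> (2 * L + f + 2) * (L + 1)"
    using l hash_facts(9) by (intro mult_le_mono) auto
  also have "\<dots> = 2 * (L + 1)\<^sup>2 + f * (L + 1)" by (simp add: power2_eq_square algebra_simps)
  also have "f * (L + 1) \<le> f\<^sup>2 + (L + 1)\<^sup>2"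
  proof (cases "f \<le> L + 1")
    case True
    then have "f * (L + 1) \<le> (L + 1) * (L + 1)" by (rule mult_le_mono1)
    then show ?thesis by (simp add: power2_eq_square)
  next
    case False
    then have "f * (L + 1) \<le> f * f" by (intro mult_le_mono2) simp
    then show ?thesis by (simp add: power2_eq_square)
  qed
  also have "f\<^sup>2 \<le> 4 * y"
    using square_le_power[of f] floorlog_power_le[of y] by (simp add: f_def y_def)
  finally show ?thesis using square_le_power[of "L + 1"] by (simp add: y_def)
qed

text \<open>Ranks are below 2^L. For \<open>L <= k\<close> all blocks are therefore 0 and take no
  bits.\<close>

lemma blocks_less: "x \<in> set blocks \<Longrightarrow> x < 2 ^ (L - k)"
proof -
  assume "x \<in> set blocks"
  then have "x = 0 \<or> (\<exists>y\<in>S. x = rank_of y div 2 ^ k)"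
    by (auto simp: blocks_def simp del: upt_Suc split: if_splits) (metis (mono_tags, lifting) someI_ex)
  then show "x < 2 ^ (L - k)"
  proof
    assume "\<exists>y\<in>S. x = rank_of y div 2 ^ k"
    then obtain y where y: "y \<in> S" "x = rank_of y div 2 ^ k" by blast
    have "rank_of y < 2 ^ L" using rank_of(1)[OF y(1)] n_less by simp
    also have "(2::nat) ^ L \<le> 2 ^ (L - k) * 2 ^ k" by (simp add: power_add[symmetric])
    finally show ?thesis unfolding y(2) by (rule less_mult_imp_div_less)
  qed simp
qed

lemma arrays_sized:
  assumes "width params \<le> B" "key_bits h \<le> B" "low_bits \<le> B" "L + 7 \<le> B"
  shows "well_sized B (128 * 2 ^ L) arrays"
proof -
  have L0: "1 \<le> (2::nat) ^ L" "L < 2 ^ L" by auto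
  have "well_sized B (128 * 2 ^ L) (increasing_arrays g (L + 7) (shifted_sums steps))"
  proof (rule increasing_arrays_sized[OF g_bounds(1) shifted_sums_increasing])
    show "x < 128 * 2 ^ L" if "x \<in> set (shifted_sums steps)" for x
      using shifted_sums_less[OF that] steps_size by linarith
    show "128 * 2 ^ L \<le> (2::nat) ^ (L + 7)" by (simp add: power_add)
    show "2 ^ g * g \<le> 128 * 2 ^ L" using g_bounds(5) by simp
    show "g \<le> B" using assms(4) by (simp add: g_def)
  qed (use assms in auto)
  moreover have "length (seeds h) \<le> 128 * 2 ^ L" "n + 1 \<le> 128 * 2 ^ L" "9 \<le> 128 * (2::nat) ^ L"
    using hash_facts(9) n_less L0 by linarith+
  moreover have "L - k \<le> B" using assms(4) by simp
  ultimately show ?thesis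
    using less_width hash_facts(8) blocks_less elems(1) assms(1-3)
    by (auto simp: well_sized_def arrays_def lows_def blocks_def params_def)
qed

lemma arrays_bits:
  "array_bits arrays \<le> 9 * (2 * L + z + 3) + (12 * 2 ^ L + 4 * (2 * L + z + 2)) + n * low_bits + (n + 1) * (L - k) + 3370 * 2 ^ L"
proof -
  have "array_bits (increasing_arrays g (L + 7) (shifted_sums steps)) \<le> (128 * 2 ^ L + g) * (3 * 8 + 2) + 2 * (2 ^ g * g\<^sup>2)"
  proof (rule increasing_arrays_bits[OF g_bounds(1) shifted_sums_increasing _ g_bounds(2)])
    show "x < 128 * 2 ^ L" if "x \<in> set (shifted_sums steps)" for x
      using shifted_sums_less[OF that] steps_size by linarith
  qed
  \<comment> \<open>129 * 26 from the structure and 2 * 8 from the tables.\<close>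
  also have "\<dots> \<le> 3370 * 2 ^ L" using g_bounds(3,4) by simp
  finally have 1: "array_bits (increasing_arrays g (L + 7) (shifted_sums steps)) \<le> 3370 * 2 ^ L" .
  have 2: "width params * 9 \<le> 9 * (2 * L + z + 3)" using width_params by simp
  have "array_bits arrays = width params * 9 + key_bits h * length (seeds h) + low_bits * n + (L - k) * (n + 1)
    + array_bits (increasing_arrays g (L + 7) (shifted_sums steps))"
    by (simp add: array_bits_def arrays_def params_def lows_def blocks_def elems(1) del: upt_Suc)
  then show ?thesis using 1 2 seeds_bits by (simp add: mult.commute)
qed

text \<open>The coefficient of \<open>z\<close> is 3 + 2 * 11 from the header, 9 from the parameters
  and 4 from the seeds, 38 in all. The terms in \<open>L\<close> and 2^L turn into multiples of
  \<open>n\<close> by \<open>L_le\<close>.\<close>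

lemma layout_bits: "length (layout arrays) \<le> n * low_bits + n * (L - k) + 7000 * n + 40 * z + 4000"
proof -
  have "length (layout arrays) \<le> (3 + 2 * length arrays) * (2 * L + z + 9) + 1 + array_bits arrays"
  proof (rule layout_bits_le[OF arrays_sized[of "2 ^ (2 * L + z + 8)"]])
    have e: "e \<le> (2::nat) ^ (2 * L + z + 8)" if "e \<le> 2 * L + z + 8" for e
      using less_imp_le[OF less_exp] that by (rule order_trans[rotated])
    show "width params \<le> 2 ^ (2 * L + z + 8)" by (rule e) (use width_params in simp)
    show "key_bits h \<le> 2 ^ (2 * L + z + 8)" by (rule e) (use key_bits_le in simp)
    show "L + 7 \<le> 2 ^ (2 * L + z + 8)" by (rule e) simp
    have "(2::nat) ^ z \<le> 2 ^ (2 * L + z + 8)" by (intro power_increasing) auto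
    then show "low_bits \<le> 2 ^ (2 * L + z + 8)"
      using clog_less diff_le_self[of "clog m" L] unfolding low_bits_def by linarith
    have "128 * 2 ^ L = (2::nat) ^ (L + 7)" by (simp add: power_add)
    also have "\<dots> < 2 ^ (2 * L + z + 9)" by (intro power_strict_increasing) auto
    finally show "128 * 2 ^ L < (2::nat) ^ (2 * L + z + 9)" .
  qed simp
  also have "length arrays = 11" by (simp add: arrays_def increasing_arrays_def rank_arrays_def)
  finally have 1: "length (layout arrays) \<le> 25 * (2 * L + z + 9) + 1 + array_bits arrays" by simp
  define d nl nd p where "d = L - k" and "nl = n * low_bits" and "nd = n * d" and "p = (2::nat) ^ L"
  have "d \<le> L" "L < p" by (simp_all add: d_def p_def)
  then show ?thesis
    using 1 arrays_bits L_le unfolding d_def[symmetric] distrib_right nl_def[symmetric] nd_def[symmetric] p_def[symmetric]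
    by simp
qed

end

section \<open>Queries on sparse and dense sets\<close>

context ram
begin

lemma readable_cong:
  assumes "readable F A" "\<And>I. I \<in> F \<Longrightarrow> A I = B I" shows "readable F B"
  unfolding readable_def
proof (intro allI impI)
  fix i assume i: "comp F i" "\<forall>I\<in>F. i I < length (B I)"
  then have "comp F (\<lambda>I. A I ! i I)" using assms by (intro readableD[OF assms(1)]) auto
  then show "comp F (\<lambda>I. B I ! i I)" by (rule comp_cong) (simp add: assms(2))
qed

lemma comp_power2:
  assumes "comp F i" "\<And>I. I \<in> F \<Longrightarrow> i I < wd I"
  shows "comp F (\<lambda>I. 2 ^ i I)"
proof -
  have "comp F (\<lambda>_. 1)" by (intro comp_const one_less_power) (use assms(2) in force)+
  from comp_shl[OF this assms(1)] show ?thesis by (rule comp_cong) (use assms(2) in simp)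
qed

text \<open>The length l of the keys need not be the word size w. After a left shift by w - l,
  truncation to w bits acts on the product as reduction modulo 2^l, and the top s bits are the hash
  value. The overflow of the product is absorbed by the same truncation.\<close>

lemma comp_mshift:
  assumes "comp F l" "comp F a" "comp F s" "comp F y"
    and "\<And>I. I \<in> F \<Longrightarrow> l I \<le> wd I" "\<And>I. I \<in> F \<Longrightarrow> s I \<le> wd I"
  shows "comp F (\<lambda>I. mshift (l I) (a I) (s I) (y I))"
proof -
  have d: "comp F (\<lambda>I. wd I - l I)" "comp F (\<lambda>I. wd I - s I)"
    using assms by (auto intro!: comp_diff comp_wd)
  have "comp F (\<lambda>I. eval_binop (wd I) Mul (a I) (y I) * 2 ^ (wd I - l I) mod 2 ^ wd I div 2 ^ (wd I - s I))"
    by (rule comp_shr[OF comp_shl[OF comp_binop[OF assms(2,4)] d(1)] d(2)])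
  then show ?thesis
  proof (rule comp_cong)
    fix I assume I: "I \<in> F"
    let ?w = "wd I" let ?d = "?w - l I" let ?X = "a I * y I mod 2 ^ l I"
    have wl: "(2::nat) ^ ?w = 2 ^ l I * 2 ^ ?d" "(2::nat) ^ ?w = 2 ^ (?w - s I) * 2 ^ s I"
      using assms(5,6)[OF I] by (simp_all add: power_add[symmetric])
    have "eval_binop ?w Mul (a I) (y I) * 2 ^ ?d mod 2 ^ ?w = (a I * y I) * 2 ^ ?d mod 2 ^ ?w"
      by (simp add: mod_mult_left_eq)
    also have "\<dots> = ?X * 2 ^ ?d" unfolding wl(1) by (rule mult_mod_left[symmetric])
    finally have "eval_binop ?w Mul (a I) (y I) * 2 ^ ?d mod 2 ^ ?w div 2 ^ (?w - s I) = ?X * 2 ^ ?d div 2 ^ (?w - s I)"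
      by simp
    also have "\<dots> = (?X * 2 ^ ?d * 2 ^ s I) div (2 ^ (?w - s I) * 2 ^ s I)" by simp
    also have "\<dots> = (?X * 2 ^ s I * 2 ^ ?d) div (2 ^ l I * 2 ^ ?d)" unfolding wl[symmetric] by (simp only: mult_ac)
    also have "\<dots> = mshift (l I) (a I) (s I) (y I)" unfolding mshift_def by simp
    finally show "eval_binop ?w Mul (a I) (y I) * 2 ^ ?d mod 2 ^ ?w div 2 ^ (?w - s I) = mshift (l I) (a I) (s I) (y I)" .
  qed
qed

lemma comp_minus_one:
  assumes "\<And>I. I \<in> F \<Longrightarrow> 1 \<le> wd I" shows "comp F (\<lambda>I. 2 ^ wd I - 1)"
proof -
  have "comp F (\<lambda>_. 1)" "comp F (\<lambda>_. 0)" by (intro comp_const one_less_power zero_less_power; use assms in force)+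
  from comp_binop[OF this(2,1), of Sub] show ?thesis by (rule comp_cong) simp
qed

end

lemma (in stored) readable_nth:
  "j < J \<Longrightarrow> (\<And>I. I \<in> F \<Longrightarrow> snd (arrs I ! j) = A I) \<Longrightarrow> readable F A"
  by (rule readable_cong[OF readable_array])

definition rank_word :: "nat \<Rightarrow> nat set \<Rightarrow> nat \<Rightarrow> nat" where
  "rank_word w S x = (if x \<in> S then card {y \<in> S. y < x} else 2 ^ w - 1)"

locale dict_ram = stored +
  fixes u :: "'a \<Rightarrow> nat" and S :: "'a \<Rightarrow> nat set" and k :: nat
  assumes S: "I \<in> F \<Longrightarrow> S I \<subseteq> {..<u I}" and u_less: "I \<in> F \<Longrightarrow> u I < 2 ^ wd I" and wd: "I \<in> F \<Longrightarrow> 1024 \<le> wd I"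
    and k: "I \<in> F \<Longrightarrow> k < wd I" and J: "J = 11"

locale sparse_ram = dict_ram +
  fixes h :: "'a \<Rightarrow> hash_data"
  assumes sparse: "I \<in> F \<Longrightarrow> sparse_set (u I) (S I) (h I)"
    and arrs: "I \<in> F \<Longrightarrow> arrs I = sparse_set.arrays (u I) (S I) (h I) k"
begin

abbreviation "n I \<equiv> sparse_set.n (S I)"
abbreviation "L I \<equiv> sparse_set.L (S I)"
abbreviation "g I \<equiv> sparse_set.g (S I)"
abbreviation "low_bits I \<equiv> sparse_set.low_bits (u I) (S I)"
abbreviation "params I \<equiv> sparse_set.params (u I) (S I) (h I)"
abbreviation "steps I \<equiv> sparse_set.steps (u I) (S I) (h I)"
abbreviation "psums I \<equiv> sparse_set.psums (u I) (S I) (h I)"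
abbreviation "elems I \<equiv> sparse_set.elems (S I)"
abbreviation "lows I \<equiv> sparse_set.lows (u I) (S I)"
abbreviation "blocks I \<equiv> sparse_set.blocks (S I) (h I) k"
abbreviation "pos I \<equiv> sparse_set.pos (S I) (h I)"
abbreviation "slot I \<equiv> sparse_set.slot (S I) (h I)"

text \<open>Here the threshold 512 enters: 128 * 2^L <= 256 n <= m for n > 0, so indices and values
  of the prefix sums are machine words.\<close>

lemma big: "I \<in> F \<Longrightarrow> 128 * 2 ^ L I < (2::nat) ^ wd I"
proof -
  assume I: "I \<in> F"
  interpret sp: sparse_set "u I" "S I" "h I" k using sparse[OF I] .
  show ?thesis
  proof (cases "n I = 0")
    case True
    have "(2::nat) ^ 7 < 2 ^ wd I" using wd[OF I] by (intro power_strict_increasing) auto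
    then show ?thesis using True by (simp add: sp.L_def)
  next
    case False
    then have "2 ^ L I \<le> 2 * n I" unfolding sp.L_def by (intro floorlog_power_le) simp
    then show ?thesis using sp.sparse u_less[OF I] by (simp add: sp.n_def)
  qed
qed

lemma nth_arrays:
  assumes "I \<in> F"
  shows "arrs I ! 0 = (width (params I), params I)" "arrs I ! 1 = (key_bits (h I), seeds (h I))"
    "arrs I ! 2 = (low_bits I, lows I)" "arrs I ! 3 = (L I - k, blocks I)"
    "arrs I ! 4 = (L I + 7, rank_base (g I) (segments (g I) (shifted_sums (steps I))))"
    "arrs I ! 5 = (g I, rank_code (g I) (segments (g I) (shifted_sums (steps I))))"
    "arrs I ! 6 = (g I, pop_table (g I))"
    "arrs I ! 7 = (L I + 7, heads (g I) (shifted_sums (steps I)))"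
    "arrs I ! 8 = (L I + 7, chunk_ids (g I) (shifted_sums (steps I)))"
    "arrs I ! 9 = (g I, chunk_codes (g I) (shifted_sums (steps I)))"
    "arrs I ! 10 = (g I, select_table (g I))"
  unfolding arrs[OF assms] sparse_set.arrays_def[OF sparse[OF assms]] increasing_arrays_def rank_arrays_def
  by simp_all

lemma comp_param:
  assumes "j < 9" shows "comp F (\<lambda>I. params I ! j)"
proof -
  have "readable F params"
    by (rule readable_nth[of 0]) (simp_all add: nth_arrays J)
  then show ?thesis
    by (rule readableD) (use assms in \<open>auto intro!: small_const simp: sparse_set.params_def[OF sparse]\<close>)
qed

lemma comp_params:
  "comp F n" "comp F L" "comp F low_bits" "comp F (\<lambda>I. mod1 (h I))" "comp F (\<lambda>I. mod2 (h I))"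
  "comp F (\<lambda>I. key_bits (h I))" "comp F (\<lambda>I. seed (h I))" "comp F g"
  by (rule comp_cong[OF comp_param[of 1]] comp_cong[OF comp_param[of 2]] comp_cong[OF comp_param[of 3]]
        comp_cong[OF comp_param[of 4]] comp_cong[OF comp_param[of 5]] comp_cong[OF comp_param[of 6]]
        comp_cong[OF comp_param[of 7]] comp_cong[OF comp_param[of 8]];
      simp add: sparse_set.params_def[OF sparse])+

lemma readable_psums: "readable F psums"
proof -
  have size: "length (steps I) + sum_list (steps I) + 1 < 2 ^ wd I" if "I \<in> F" for I
    using sparse_set.steps_size[OF sparse[OF that]] big[OF that] by simp
  have "readable F (\<lambda>I. shifted_sums (steps I))"
  proof (rule readable_increasing)
    show "readable F (\<lambda>I. rank_base (g I) (segments (g I) (shifted_sums (steps I))))"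
      by (rule readable_nth[of 4]) (simp_all add: nth_arrays J)
    show "readable F (\<lambda>I. rank_code (g I) (segments (g I) (shifted_sums (steps I))))"
      by (rule readable_nth[of 5]) (simp_all add: nth_arrays J)
    show "readable F (\<lambda>I. pop_table (g I))"
      by (rule readable_nth[of 6]) (simp_all add: nth_arrays J)
    show "readable F (\<lambda>I. heads (g I) (shifted_sums (steps I)))"
      by (rule readable_nth[of 7]) (simp_all add: nth_arrays J)
    show "readable F (\<lambda>I. chunk_ids (g I) (shifted_sums (steps I)))"
      by (rule readable_nth[of 8]) (simp_all add: nth_arrays J)
    show "readable F (\<lambda>I. chunk_codes (g I) (shifted_sums (steps I)))"
      by (rule readable_nth[of 9]) (simp_all add: nth_arrays J)
    show "readable F (\<lambda>I. select_table (g I))"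
      by (rule readable_nth[of 10]) (simp_all add: nth_arrays J)
    show "comp F g" by (rule comp_params)
    show "sorted_wrt (<) (shifted_sums (steps I))" for I by (rule shifted_sums_increasing)
    fix I assume I: "I \<in> F"
    show "0 < g I" by (rule sparse_set.g_bounds[OF sparse[OF I]])
    show "2 ^ g I * g I < 2 ^ wd I" using sparse_set.g_bounds(5)[OF sparse[OF I]] big[OF I] by linarith
    show "x < 2 ^ wd I" if "x \<in> set (shifted_sums (steps I))" for x
      using shifted_sums_less[OF that] size[OF I] by linarith
    show "length (shifted_sums (steps I)) < 2 ^ wd I" using size[OF I] by (simp add: shifted_sums_def del: upt_Suc)
  qed
  from readable_prefix_sums[OF this] show ?thesis
    by (rule readable_cong) (use size in \<open>auto simp: sparse_set.psums_def[OF sparse] intro: less_trans[OF _ size]\<close>)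
qed

lemma length_psums: "I \<in> F \<Longrightarrow> length (psums I) = 3 * 2 ^ L I + n I + sum_list (sparse_set.gaps (S I) (h I)) + 1"
  by (simp add: sparse_set.psums_def[OF sparse] prefix_sums_def sparse_set.length_steps[OF sparse] del: upt_Suc)

lemma length_psums_less: "I \<in> F \<Longrightarrow> length (psums I) \<le> 128 * 2 ^ L I"
  using sparse_set.steps_size[OF sparse] length_psums sparse_set.length_steps[OF sparse] by fastforce

lemma psums_less: "I \<in> F \<Longrightarrow> i < length (psums I) \<Longrightarrow> psums I ! i < 2 ^ wd I"
proof -
  assume I: "I \<in> F" "i < length (psums I)"
  interpret sp: sparse_set "u I" "S I" "h I" k using sparse[OF I(1)] .
  have i: "i \<le> length (steps I)" using I length_psums sp.length_steps by simp
  have "psums I ! i = sum_list (take i (steps I))" using sp.psums_nth[OF i] .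
  also have "\<dots> \<le> sum_list (take (length (steps I)) (steps I))" using i by (rule sum_take_mono)
  finally show ?thesis using sp.steps_size big[OF I(1)] by simp
qed

lemma comp_psum:
  "comp F i \<Longrightarrow> (\<And>I. I \<in> F \<Longrightarrow> i I < length (psums I)) \<Longrightarrow> comp F (\<lambda>I. psums I ! i I)"
  by (rule readableD[OF readable_psums])

lemma comp_psum_diff:
  assumes "comp F i" "comp F j" "\<And>I. I \<in> F \<Longrightarrow> i I < length (psums I)" "\<And>I. I \<in> F \<Longrightarrow> j I < length (psums I)"
    "\<And>I. I \<in> F \<Longrightarrow> psums I ! j I \<le> psums I ! i I"
  shows "comp F (\<lambda>I. psums I ! i I - psums I ! j I)"
  by (rule comp_diff[OF comp_psum[OF assms(1,3)] comp_psum[OF assms(2,4)] assms(5) psums_less[OF _ assms(3)]])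

lemma L_less: "I \<in> F \<Longrightarrow> L I < wd I"
proof -
  assume "I \<in> F"
  then have "(2::nat) ^ L I < 2 ^ wd I" by (rule le_less_trans[OF _ big, rotated]) simp
  then show ?thesis by simp
qed

lemma comp_table_end: "comp F (\<lambda>I. 3 * 2 ^ L I)"
  by (rule comp_mult[OF small_const comp_power2[OF comp_params(2)]]) (use big L_less in fastforce)+

lemma readable_elems: "readable F elems"
  unfolding readable_def
proof (intro allI impI)
  fix i assume i: "comp F i" "\<forall>I\<in>F. i I < length (elems I)"
  have il: "i I < n I" if "I \<in> F" for I
    using i(2)[rule_format, OF that] sparse_set.elems(1)[OF sparse[OF that]] by simp
  have len: "3 * 2 ^ L I + (i I + 1) < length (psums I)" if "I \<in> F" for I
    using il[OF that] length_psums[OF that] by simp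
  have lenw: "3 * 2 ^ L I + (i I + 1) < 2 ^ wd I" if "I \<in> F" for I
    using len[OF that] length_psums_less[OF that] big[OF that] by linarith
  have "comp F (\<lambda>I. 3 * 2 ^ L I + (i I + 1))"
    by (rule comp_add[OF comp_table_end comp_add[OF i(1) small_const]]) (use lenw in fastforce)+
  then have "comp F (\<lambda>I. psums I ! (3 * 2 ^ L I + (i I + 1)) - psums I ! (3 * 2 ^ L I))"
    by (rule comp_psum_diff[OF _ comp_table_end len add_lessD1[OF len]])
       (use sparse_set.lookup_high(2)[OF sparse il] in auto)
  then have hi: "comp F (\<lambda>I. elems I ! i I div 2 ^ low_bits I)"
    by (rule comp_cong) (use sparse_set.lookup_high(1)[OF sparse il] in auto)
  have em: "elems I ! i I < 2 ^ wd I" if "I \<in> F" for I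
    using sparse_set.elems_less[OF sparse[OF that] il[OF that]] u_less[OF that] by simp
  have "readable F lows" by (rule readable_nth[of 2]) (simp_all add: nth_arrays J)
  then have "comp F (\<lambda>I. lows I ! i I)"
    by (rule readableD[OF _ i(1)]) (use i(2) in \<open>simp add: sparse_set.lows_def[OF sparse]\<close>)
  then have lo: "comp F (\<lambda>I. elems I ! i I mod 2 ^ low_bits I)"
    by (rule comp_cong) (use i(2) in \<open>simp add: sparse_set.lows_def[OF sparse]\<close>)
  have split: "elems I ! i I div 2 ^ low_bits I * 2 ^ low_bits I mod 2 ^ wd I + elems I ! i I mod 2 ^ low_bits I = elems I ! i I"
    if "I \<in> F" for I
  proof -
    have "elems I ! i I div 2 ^ low_bits I * 2 ^ low_bits I \<le> elems I ! i I" by simp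
    then have "elems I ! i I div 2 ^ low_bits I * 2 ^ low_bits I < 2 ^ wd I" using em[OF that] by (rule le_less_trans)
    then show ?thesis by (simp only: mod_less div_mult_mod_eq)
  qed
  have "comp F (\<lambda>I. elems I ! i I div 2 ^ low_bits I * 2 ^ low_bits I mod 2 ^ wd I + elems I ! i I mod 2 ^ low_bits I)"
    by (rule comp_add[OF comp_shl[OF hi comp_params(3)] lo]) (simp add: split em)
  then show "comp F (\<lambda>I. elems I ! i I)" by (rule comp_cong) (rule split)
qed

text \<open>This has to succeed for every query, in \<open>S\<close> or not, since membership is
  decided only afterwards. All index bounds therefore rest on \<open>bucket_less\<close> and
  \<open>place_less\<close>, which hold for any argument.\<close>

lemma comp_slot: "comp F (\<lambda>I. slot I (qry I))"
proof -
  let ?x = qry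
  let ?i = "\<lambda>I. bucket (h I) (L I) (?x I)"
  have key: "comp F (\<lambda>I. key (h I) (?x I))"
    unfolding key_def by (rule comp_mod[OF comp_mod[OF comp_qry comp_params(4)] comp_params(5)])
  have kb: "key_bits (h I) \<le> wd I" if "I \<in> F" for I
    using array_fits(1)[OF that, of 1] nth_arrays(2)[OF that] J by simp
  have i: "comp F ?i" unfolding bucket_def
    by (rule comp_mshift[OF comp_params(6,7,2) key kb]) (use L_less in \<open>auto intro: less_imp_le\<close>)
  have il: "?i I < 2 ^ L I" if "I \<in> F" for I by (rule sparse_set.bucket_less[OF sparse[OF that]])
  have len: "3 * ?i I + 3 < length (psums I)" if "I \<in> F" for I
    using il[OF that] length_psums[OF that] by simp
  have lenw: "3 * ?i I + 3 < (2::nat) ^ wd I" if "I \<in> F" for I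
    using len[OF that] length_psums_less[OF that] big[OF that] by linarith
  have idx: "comp F (\<lambda>I. 3 * ?i I + c)" if "c \<le> 3" for c
    by (rule comp_add[OF comp_mult[OF small_const i] small_const]) (use lenw that in fastforce)+
  have lt: "3 * ?i I + c < length (psums I)" if "I \<in> F" "c \<le> 3" for I c using len that by fastforce
  note lk = sparse_set.lookup[OF sparse il]
  have "comp F (\<lambda>I. psums I ! (3 * ?i I + 2) - psums I ! (3 * ?i I + 1))"
    by (rule comp_psum_diff[OF idx idx lt lt]) (use lk(4) in auto)
  then have size: "comp F (\<lambda>I. lg_size (h I) (?i I))" by (rule comp_cong) (use lk(2) in auto)
  have "comp F (\<lambda>I. psums I ! (3 * ?i I + 3) - psums I ! (3 * ?i I + 2))"
    by (rule comp_psum_diff[OF idx idx lt lt]) (use lk(5) in auto)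
  then have ix: "comp F (\<lambda>I. seed_index (h I) (?i I))" by (rule comp_cong) (use lk(3) in auto)
  have "readable F (\<lambda>I. seeds (h I))"
    by (rule readable_nth[of 1]) (simp_all add: nth_arrays(2)[unfolded One_nat_def] J)
  then have sd: "comp F (\<lambda>I. seeds (h I) ! seed_index (h I) (?i I))"
    by (rule readableD[OF _ ix]) (use sparse_set.hash_facts(10)[OF sparse il] in auto)
  have sw: "lg_size (h I) (?i I) \<le> wd I" if "I \<in> F" for I
  proof -
    interpret sp: sparse_set "u I" "S I" "h I" k using sparse[OF that] .
    have "(2::nat) ^ lg_size (h I) (?i I) \<le> sum_list (take (3 * ?i I + 1) sp.gaps)"
      using sp.sum_gaps_step(1)[OF il[OF that]] by simp
    also have "\<dots> = psums I ! (3 * ?i I + 1)" using sp.psums_gaps[of "3 * ?i I + 1"] il[OF that] by simp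
    also have "\<dots> < 2 ^ wd I" by (rule psums_less[OF that lt[OF that]]) simp
    finally show ?thesis by simp
  qed
  have place: "comp F (\<lambda>I. place (h I) (L I) (?x I))" unfolding place_def Let_def
    by (rule comp_mshift[OF comp_params(6) sd size key kb sw])
  have base: "comp F (\<lambda>I. psums I ! (3 * ?i I))"
    using comp_psum[OF idx[of 0]] len by fastforce
  have pos_lt: "pos I (?x I) < sum_list (sparse_set.gaps (S I) (h I))" if "I \<in> F" for I
    by (rule sparse_set.pos_range[OF sparse[OF that]])
  have pos_eq: "psums I ! (3 * ?i I) + place (h I) (L I) (?x I) = pos I (?x I)" if "I \<in> F" for I
    unfolding sparse_set.pos_def[OF sparse[OF that]] lk(1)[OF that that] ..
  have tot: "3 * 2 ^ L I + n I + pos I (?x I) < length (psums I)" if "I \<in> F" for I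
    using pos_lt[OF that] length_psums[OF that] by simp
  have totw: "3 * 2 ^ L I + n I + pos I (?x I) < 2 ^ wd I" if "I \<in> F" for I
    using tot[OF that] length_psums_less[OF that] big[OF that] by linarith
  have "comp F (\<lambda>I. psums I ! (3 * ?i I) + place (h I) (L I) (?x I))"
    by (rule comp_add[OF base place]) (use pos_eq totw in fastforce)
  then have pos: "comp F (\<lambda>I. pos I (?x I))" by (rule comp_cong) (rule pos_eq)
  have e: "comp F (\<lambda>I. 3 * 2 ^ L I + n I)"
    by (rule comp_add[OF comp_table_end comp_params(1)]) (use totw in fastforce)
  have "comp F (\<lambda>I. 3 * 2 ^ L I + n I + pos I (?x I))" by (rule comp_add[OF e pos totw])
  from comp_psum_diff[OF this e tot]
  have "comp F (\<lambda>I. psums I ! (3 * 2 ^ L I + n I + pos I (?x I)) - psums I ! (3 * 2 ^ L I + n I))"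
    using sparse_set.lookup_slot(2)[OF sparse] tot by fastforce
  then show ?thesis by (rule comp_cong) (use sparse_set.lookup_slot(1)[OF sparse] in auto)
qed

definition "block I = blocks I ! slot I (qry I)"

lemma block_less: "I \<in> F \<Longrightarrow> block I * 2 ^ k + 2 ^ k \<le> 2 ^ wd I"
proof -
  assume I: "I \<in> F"
  interpret sp: sparse_set "u I" "S I" "h I" k using sparse[OF I] .
  have "block I \<in> set (blocks I)"
    unfolding block_def using sp.slot_le by (intro nth_mem) (simp add: sp.blocks_def le_imp_less_Suc del: upt_Suc)
  then have "block I + 1 \<le> 2 ^ (L I - k)" using sp.blocks_less by fastforce
  then have "(block I + 1) * 2 ^ k \<le> 2 ^ (L I - k) * 2 ^ k" by (rule mult_le_mono1)
  also have "\<dots> = 2 ^ ((L I - k) + k)" by (simp only: power_add)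
  also have "\<dots> \<le> 2 ^ wd I" using L_less[OF I] k[OF I] by (intro power_increasing) auto
  finally show ?thesis by simp
qed

lemma comp_block: "comp F (\<lambda>I. block I * 2 ^ k)"
proof -
  have "readable F blocks" by (rule readable_nth[of 3]) (simp_all add: nth_arrays J)
  then have "comp F block" unfolding block_def
    by (rule readableD[OF _ comp_slot])
       (use sparse_set.slot_le[OF sparse] in \<open>simp add: sparse_set.blocks_def[OF sparse] le_imp_less_Suc del: upt_Suc\<close>)
  moreover have "comp F (\<lambda>_. 2 ^ k)" by (rule comp_const) (use k in simp)
  ultimately show ?thesis
  proof (rule comp_mult)
    fix I assume "I \<in> F"
    then have "block I * 2 ^ k + 2 ^ k \<le> 2 ^ wd I" by (rule block_less)
    moreover have "(0::nat) < 2 ^ k" by simp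
    ultimately show "block I * 2 ^ k < 2 ^ wd I" by linarith
  qed
qed

text \<open>The candidates of a block are compared with the query from the last one down; unrolled,
  this is an expression of constant size because \<open>k\<close> is fixed. The test against
  \<open>n\<close> guards the access, and the default is the word for -1.\<close>

primrec scan :: "nat \<Rightarrow> 'a \<Rightarrow> nat" where
  "scan 0 I = 2 ^ wd I - 1"
| "scan (Suc d) I = (if block I * 2 ^ k + d < n I
     then if elems I ! (block I * 2 ^ k + d) = qry I then block I * 2 ^ k + d else scan d I else scan d I)"

lemma sparse_ram_subset: "F' \<subseteq> F \<Longrightarrow> sparse_ram wd dat F' arrs J u S k h"
  unfolding sparse_ram_def sparse_ram_axioms_def dict_ram_def dict_ram_axioms_def stored_def
  using dat fits len S u_less wd k J sparse arrs by blast

lemma comp_scan: "d \<le> 2 ^ k \<Longrightarrow> comp F (scan d)"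
proof (induction d)
  case 0
  have "comp F (\<lambda>I. 2 ^ wd I - 1)" by (rule comp_minus_one) (use wd in fastforce)
  then show ?case by simp
next
  case (Suc d)
  have c: "comp F (\<lambda>I. block I * 2 ^ k + d)"
  proof (rule comp_add[OF comp_block comp_const])
    fix I assume "I \<in> F"
    then have "block I * 2 ^ k + 2 ^ k \<le> 2 ^ wd I" by (rule block_less)
    then show "block I * 2 ^ k + d < 2 ^ wd I" "d < 2 ^ wd I" using Suc.prems by linarith+
  qed
  have IH: "comp F (scan d)" using Suc by simp
  let ?F = "{I\<in>F. block I * 2 ^ k + d < n I}"
  have sub: "?F \<subseteq> F" by blast
  \<comment> \<open>On all of \<open>F\<close> the index may be out of range, so readability is
    applied on the guarded subfamily.\<close>
  interpret sub: sparse_ram wd dat qry ?F arrs J u S k h using sparse_ram_subset[OF sub] .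
  have "comp ?F (\<lambda>I. elems I ! (block I * 2 ^ k + d))"
    by (rule readableD[OF sub.readable_elems comp_subset[OF c sub]]) (simp add: sparse_set.elems(1)[OF sparse])
  from comp_if_eq[OF this comp_qry comp_subset[OF c] comp_subset[OF IH]]
  have "comp ?F (\<lambda>I. if elems I ! (block I * 2 ^ k + d) = qry I then block I * 2 ^ k + d else scan d I)"
    by blast
  from comp_if_less[OF c comp_params(1) this comp_subset[OF IH]]
  show ?case unfolding scan.simps by blast
qed

text \<open>For a member only the candidate equal to its rank passes the comparison, as the elements
  are distinct. For a non-member none does, whatever block was read.\<close>

lemma scan_correct: assumes I: "I \<in> F" shows "scan (2 ^ k) I = rank_word (wd I) (S I) (qry I)"
proof -
  interpret sp: sparse_set "u I" "S I" "h I" k using sparse[OF I] .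
  let ?c = "\<lambda>d. block I * 2 ^ k + d"
  have none: "scan d I = 2 ^ wd I - 1" if "\<And>e. e < d \<Longrightarrow> ?c e < n I \<Longrightarrow> elems I ! ?c e \<noteq> qry I" for d
    using that by (induction d) auto
  show ?thesis
  proof (cases "qry I \<in> S I")
    case False
    have "scan (2 ^ k) I = 2 ^ wd I - 1"
      by (rule none) (use False sp.elems nth_mem in metis)
    then show ?thesis using False by (simp add: rank_word_def)
  next
    case True
    define r where "r = sp.rank_of (qry I)"
    have r: "r < n I" "elems I ! r = qry I" using sp.rank_of[OF True] by (auto simp: r_def)
    have dist: "distinct (elems I)" by (simp add: sp.elems_def)
    have b: "block I = r div 2 ^ k" unfolding block_def r_def by (rule sp.blocks_slot[OF True])
    have rc: "?c (r mod 2 ^ k) = r" by (simp only: b div_mult_mod_eq)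
    have "r mod 2 ^ k < d \<Longrightarrow> scan d I = r" for d
    proof (induction d)
      case (Suc d)
      show ?case
      proof (cases "r mod 2 ^ k = d")
        case True
        then show ?thesis using r rc by simp
      next
        case False
        then have "scan d I = r" using Suc by simp
        moreover have "elems I ! ?c d \<noteq> qry I" if "?c d < n I"
        proof
          assume "elems I ! ?c d = qry I"
          then have "?c d = r" using nth_eq_iff_index_eq[OF dist, of "?c d" r] that r sp.elems(1) by simp
          then show False using rc False by linarith
        qed
        ultimately show ?thesis by simp
      qed
    qed simp
    then have "scan (2 ^ k) I = r" by simp
    then show ?thesis using True by (simp add: rank_word_def r_def sp.rank_of_def)
  qed
qed

lemma comp_rank: "comp F (\<lambda>I. rank_word (wd I) (S I) (qry I))"
  using comp_scan[of "2 ^ k"] by (rule comp_cong) (auto simp: scan_correct)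

lemma comp_select:
  assumes "\<And>I. I \<in> F \<Longrightarrow> 1 \<le> qry I \<and> qry I \<le> card (S I)"
  shows "comp F (\<lambda>I. set_select (qry I) (S I))"
proof -
  have "comp F (\<lambda>I. qry I - 1)"
  proof (rule comp_diff[OF comp_qry small_const])
    fix I assume I: "I \<in> F"
    show "1 \<le> qry I" using assms[OF I] by simp
    have "card (S I) \<le> u I" using card_mono[OF _ S[OF I]] by simp
    then show "qry I < 2 ^ wd I" using assms[OF I] u_less[OF I] by simp
  qed simp
  then have "comp F (\<lambda>I. elems I ! (qry I - 1))"
    by (rule readableD[OF readable_elems])
       (use assms in \<open>fastforce simp: sparse_set.elems(1)[OF sparse] sparse_set.n_def[OF sparse]\<close>)
  then show ?thesis
    by (rule comp_cong) (simp add: set_select_def sparse_set.elems_def[OF sparse])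
qed

end

section \<open>Dense sets\<close>

definition dense_g :: "nat \<Rightarrow> nat" where
  "dense_g m = floorlog 2 m div 2 + 1"

definition dense_ranks :: "nat \<Rightarrow> nat set \<Rightarrow> nat list" where
  "dense_ranks m S = map (\<lambda>x. card {y \<in> S. y < x}) [0..<m]"

definition dense_params :: "nat \<Rightarrow> nat set \<Rightarrow> nat list" where
  "dense_params m S = [1, card S, dense_g m]"

definition dense_arrays :: "nat \<Rightarrow> nat set \<Rightarrow> (nat \<times> nat list) list" where
  "dense_arrays m S = (width (dense_params m S), dense_params m S) #
     rank_arrays (dense_g m) (floorlog 2 m) (dense_ranks m S) @
     increasing_arrays (dense_g m) (floorlog 2 m) (sorted_list_of_set S)"

lemma dense_table_less:
  assumes "m < 2 ^ w" "1024 \<le> w" shows "2 ^ dense_g m * dense_g m < 2 ^ w"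
proof -
  define v where "v = w - dense_g m"
  have "floorlog 2 m \<le> w" by (rule floorlog_le[OF assms(1)])
  then have gv: "dense_g m \<le> v + 2" "w = v + dense_g m" "3 \<le> v" using assms(2) by (auto simp: dense_g_def v_def)
  have "e + 5 < (8::nat) * 2 ^ e" for e by (induction e) auto
  from this[of "v - 3"] have "v + 2 < 2 ^ v" using gv(3) power_add[of "2::nat" "v - 3" 3] by simp
  then have "2 ^ dense_g m * dense_g m < 2 ^ dense_g m * (2 ^ v :: nat)" using gv(1) by simp
  then show ?thesis unfolding gv(2) by (simp add: power_add mult.commute)
qed

lemma slow_dense_ranks: "finite S \<Longrightarrow> slow (dense_ranks m S)"
proof -
  assume "finite S"
  moreover have "{y \<in> S. y < Suc i} = {y \<in> S. y < i} \<union> (if i \<in> S then {i} else {})" for i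
    by (auto simp: less_Suc_eq)
  ultimately show ?thesis by (auto simp: slow_def dense_ranks_def)
qed

lemma dense_ranks_less:
  assumes "x \<in> set (dense_ranks m S)" shows "x < m"
proof -
  obtain y where y: "y < m" "x = card {z \<in> S. z < y}" using assms by (auto simp: dense_ranks_def)
  have "x \<le> card {..<y}" unfolding y(2) by (intro card_mono) auto
  then show ?thesis using y by simp
qed

locale dense_set =
  fixes m :: nat and S :: "nat set"
  assumes S: "S \<subseteq> {..<m}" and m: "0 < m"
begin

lemma finite_S: "finite S" using S finite_subset by blast

lemma sorted_elems: "sorted_wrt (<) (sorted_list_of_set S)" "x \<in> set (sorted_list_of_set S) \<Longrightarrow> x < m"
  using finite_S S by auto

lemma card_le: "card S \<le> m"
  using card_mono[OF _ S] by simp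

lemma L_bounds: "m < 2 ^ floorlog 2 m" "2 ^ floorlog 2 m \<le> 2 * m"
  using less_floorlog floorlog_power_le[OF m] by auto

lemma g_bounds: "0 < dense_g m" "floorlog 2 m \<le> 2 * dense_g m" "dense_g m \<le> 2 ^ floorlog 2 m"
  "2 ^ dense_g m * (dense_g m)\<^sup>2 \<le> 8 * 2 ^ floorlog 2 m" "2 ^ dense_g m * dense_g m \<le> 8 * 2 ^ floorlog 2 m"
proof -
  show g: "0 < dense_g m" "floorlog 2 m \<le> 2 * dense_g m" by (auto simp: dense_g_def)
  have "floorlog 2 m < 2 ^ floorlog 2 m" by simp
  then show "dense_g m \<le> 2 ^ floorlog 2 m" unfolding dense_g_def by linarith
  show b: "2 ^ dense_g m * (dense_g m)\<^sup>2 \<le> 8 * 2 ^ floorlog 2 m" unfolding dense_g_def by (rule table_bits)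
  have "2 ^ dense_g m * dense_g m \<le> 2 ^ dense_g m * (dense_g m)\<^sup>2" using g by (simp add: power2_eq_square)
  then show "2 ^ dense_g m * dense_g m \<le> 8 * 2 ^ floorlog 2 m" using b by (rule order_trans)
qed

lemma sized:
  assumes "width (dense_params m S) \<le> B" "floorlog 2 m \<le> B" "dense_g m \<le> B"
    "3 \<le> X" "m \<le> X" "2 ^ dense_g m * dense_g m \<le> X"
  shows "well_sized B X (dense_arrays m S)"
proof -
  have "well_sized B X (rank_arrays (dense_g m) (floorlog 2 m) (dense_ranks m S))"
    using assms dense_ranks_less[of _ m S] L_bounds(1) g_bounds(1)
    by (intro rank_arrays_sized) (auto simp: dense_ranks_def[THEN arg_cong[where f = length]] intro: less_trans)
  moreover have "well_sized B X (increasing_arrays (dense_g m) (floorlog 2 m) (sorted_list_of_set S))"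
    using assms sorted_elems L_bounds(1) g_bounds(1) by (intro increasing_arrays_sized[where M = m]) auto
  ultimately show ?thesis using assms less_width
    by (auto simp: well_sized_def dense_arrays_def dense_params_def)
qed

lemma bits: "length (layout (dense_arrays m S)) \<le> 300 * m"
proof -
  let ?L = "floorlog 2 m" let ?g = "dense_g m"
  have L: "?L < 2 ^ ?L" "1 \<le> (2::nat) ^ ?L" by auto
  have L1: "1 \<le> ?L" using L_bounds(1) m by (cases ?L) auto
  have wp: "width (dense_params m S) \<le> ?L + 1"
  proof (rule width_le)
    fix x assume "x \<in> set (dense_params m S)"
    then have "x \<le> 2 ^ ?L" using card_le L_bounds(1) g_bounds(3) L(2) by (auto simp: dense_params_def)
    also have "(2::nat) ^ ?L < 2 ^ (?L + 1)" by simp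
    finally show "x < 2 ^ (?L + 1)" .
  qed
  have "length (layout (dense_arrays m S)) \<le> (3 + 2 * length (dense_arrays m S)) * (?L + 4) + 1 + array_bits (dense_arrays m S)"
  proof (rule layout_bits_le[OF sized[of "8 * 2 ^ ?L" "8 * 2 ^ ?L"]])
    show "8 * 2 ^ ?L < (2::nat) ^ (?L + 4)" "8 * 2 ^ ?L < (2::nat) ^ (?L + 4)" by (simp_all add: power_add)
  qed (use wp L g_bounds L_bounds in linarith)+
  also have "length (dense_arrays m S) = 11" by (simp add: dense_arrays_def increasing_arrays_def rank_arrays_def)
  finally have 1: "length (layout (dense_arrays m S)) \<le> 25 * (?L + 4) + 1 + array_bits (dense_arrays m S)" by simp
  have 2: "array_bits (rank_arrays ?g ?L (dense_ranks m S)) \<le> (m + ?g) * (2 + 1) + 2 ^ ?g * ?g\<^sup>2"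
    using rank_arrays_bits[OF g_bounds(1,2), of "dense_ranks m S"] by (simp add: dense_ranks_def)
  have 3: "array_bits (increasing_arrays ?g ?L (sorted_list_of_set S)) \<le> (m + ?g) * (3 * 2 + 2) + 2 * (2 ^ ?g * ?g\<^sup>2)"
    using increasing_arrays_bits[OF g_bounds(1) sorted_elems g_bounds(2)] by simp
  have 4: "array_bits (dense_arrays m S) = width (dense_params m S) * 3 + array_bits (rank_arrays ?g ?L (dense_ranks m S))
    + array_bits (increasing_arrays ?g ?L (sorted_list_of_set S))"
    by (simp add: array_bits_def dense_arrays_def dense_params_def)
  define p t where "p = (2::nat) ^ ?L" and "t = 2 ^ ?g * ?g\<^sup>2"
  have "?g \<le> p" "t \<le> 8 * p" "p \<le> 2 * m" "?L < p" using g_bounds L_bounds L by (auto simp: p_def t_def)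
  then show ?thesis using 1 2 3 4 wp m unfolding t_def[symmetric] by simp
qed

end

locale dense_ram = dict_ram +
  assumes u: "I \<in> F \<Longrightarrow> 0 < u I" and arrs: "I \<in> F \<Longrightarrow> arrs I = dense_arrays (u I) (S I)"
begin

abbreviation "g I \<equiv> dense_g (u I)"
abbreviation "elems I \<equiv> sorted_list_of_set (S I)"
abbreviation "ranks I \<equiv> dense_ranks (u I) (S I)"

lemma dense: "I \<in> F \<Longrightarrow> dense_set (u I) (S I)"
  using S u by unfold_locales auto

lemma nth_arrays:
  assumes "I \<in> F"
  shows "snd (arrs I ! 0) = dense_params (u I) (S I)"
    "snd (arrs I ! Suc 0) = rank_base (g I) (ranks I)" "snd (arrs I ! 2) = rank_code (g I) (ranks I)"
    "snd (arrs I ! 3) = pop_table (g I)"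
    "snd (arrs I ! 4) = rank_base (g I) (segments (g I) (elems I))"
    "snd (arrs I ! 5) = rank_code (g I) (segments (g I) (elems I))"
    "snd (arrs I ! 7) = heads (g I) (elems I)"
    "snd (arrs I ! 8) = chunk_ids (g I) (elems I)"
    "snd (arrs I ! 9) = chunk_codes (g I) (elems I)"
    "snd (arrs I ! 10) = select_table (g I)"
  unfolding arrs[OF assms] dense_arrays_def increasing_arrays_def rank_arrays_def by simp_all

lemma comp_params: "comp F (\<lambda>I. card (S I))" "comp F g"
proof -
  have "readable F (\<lambda>I. dense_params (u I) (S I))"
    by (rule readable_nth[of 0]) (simp_all add: nth_arrays J)
  then have *: "comp F (\<lambda>I. dense_params (u I) (S I) ! j)" if "j < 3" for j
    by (rule readableD) (use that in \<open>auto intro!: small_const simp: dense_params_def\<close>)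
  show "comp F (\<lambda>I. card (S I))" by (rule comp_cong[OF *[of 1]]) (simp_all add: dense_params_def)
  show "comp F g" by (rule comp_cong[OF *[of 2]]) (simp_all add: dense_params_def)
qed

lemma table_less: "I \<in> F \<Longrightarrow> 2 ^ g I * g I < 2 ^ wd I"
  by (rule dense_table_less[OF u_less wd])

lemma readable_ranks: "readable F ranks"
proof (rule readable_slow)
  show "readable F (\<lambda>I. rank_base (g I) (ranks I))"
    by (rule readable_nth[of "Suc 0"]) (simp_all add: nth_arrays J)
  show "readable F (\<lambda>I. rank_code (g I) (ranks I))"
    by (rule readable_nth[of 2]) (simp_all add: nth_arrays J)
  show "readable F (\<lambda>I. pop_table (g I))"
    by (rule readable_nth[of 3]) (simp_all add: nth_arrays J)
  fix I assume I: "I \<in> F"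
  show "0 < g I" by (rule dense_set.g_bounds[OF dense[OF I]])
  show "slow (ranks I)" by (rule slow_dense_ranks[OF dense_set.finite_S[OF dense[OF I]]])
  show "x < 2 ^ wd I" if "x \<in> set (ranks I)" for x
    using dense_ranks_less[OF that] u_less[OF I] by simp
qed (use comp_params table_less in auto)

lemma readable_elems: "readable F elems"
proof (rule readable_increasing)
  show "readable F (\<lambda>I. rank_base (g I) (segments (g I) (elems I)))"
    by (rule readable_nth[of 4]) (simp_all add: nth_arrays J)
  show "readable F (\<lambda>I. rank_code (g I) (segments (g I) (elems I)))"
    by (rule readable_nth[of 5]) (simp_all add: nth_arrays J)
  show "readable F (\<lambda>I. pop_table (g I))"
    by (rule readable_nth[of 3]) (simp_all add: nth_arrays J)
  show "readable F (\<lambda>I. heads (g I) (elems I))"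
    by (rule readable_nth[of 7]) (simp_all add: nth_arrays J)
  show "readable F (\<lambda>I. chunk_ids (g I) (elems I))"
    by (rule readable_nth[of 8]) (simp_all add: nth_arrays J)
  show "readable F (\<lambda>I. chunk_codes (g I) (elems I))"
    by (rule readable_nth[of 9]) (simp_all add: nth_arrays J)
  show "readable F (\<lambda>I. select_table (g I))"
    by (rule readable_nth[of 10]) (simp_all add: nth_arrays J)
  fix I assume I: "I \<in> F"
  show "0 < g I" by (rule dense_set.g_bounds[OF dense[OF I]])
  show "x < 2 ^ wd I" if "x \<in> set (elems I)" for x
    using dense_set.sorted_elems(2)[OF dense[OF I] that] u_less[OF I] by simp
  show "length (elems I) < 2 ^ wd I" using dense_set.card_le[OF dense[OF I]] u_less[OF I] by simp
qed (use comp_params table_less in auto)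

lemma dense_ram_subset: "F' \<subseteq> F \<Longrightarrow> dense_ram wd dat F' arrs J u S k"
  unfolding dense_ram_def dense_ram_axioms_def dict_ram_def dict_ram_axioms_def stored_def
  using dat fits len S u_less wd k J u arrs by blast

text \<open>A query belongs to the set iff it equals the element selected at the number of smaller
  elements. If all elements are smaller there is nothing to select, hence the first test.\<close>

lemma comp_rank:
  assumes "\<And>I. I \<in> F \<Longrightarrow> qry I < u I"
  shows "comp F (\<lambda>I. rank_word (wd I) (S I) (qry I))"
proof -
  have "comp F (\<lambda>I. ranks I ! qry I)"
    by (rule readableD[OF readable_ranks comp_qry]) (use assms in \<open>simp add: dense_ranks_def\<close>)
  then have r: "comp F (\<lambda>I. card {y \<in> S I. y < qry I})"
    by (rule comp_cong) (use assms in \<open>simp add: dense_ranks_def\<close>)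
  have none: "comp F (\<lambda>I. 2 ^ wd I - 1)" by (rule comp_minus_one) (use wd in fastforce)
  let ?F = "{I\<in>F. card {y \<in> S I. y < qry I} < card (S I)}"
  have sub: "?F \<subseteq> F" by blast
  interpret sub: dense_ram wd dat qry ?F arrs J u S k using dense_ram_subset[OF sub] .
  have "comp ?F (\<lambda>I. elems I ! card {y \<in> S I. y < qry I})"
    by (rule readableD[OF sub.readable_elems comp_subset[OF r sub]]) simp
  from comp_if_eq[OF this comp_qry comp_subset[OF r] comp_subset[OF none]]
  have "comp ?F (\<lambda>I. if elems I ! card {y \<in> S I. y < qry I} = qry I then card {y \<in> S I. y < qry I} else 2 ^ wd I - 1)"
    by blast
  from comp_if_less[OF r comp_params(1) this comp_subset[OF none]]
  have "comp F (\<lambda>I. if card {y \<in> S I. y < qry I} < card (S I) then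
    if elems I ! card {y \<in> S I. y < qry I} = qry I then card {y \<in> S I. y < qry I} else 2 ^ wd I - 1 else 2 ^ wd I - 1)"
    by blast
  then show ?thesis
  proof (rule comp_cong)
    fix I assume I: "I \<in> F"
    have fin: "finite (S I)" by (rule dense_set.finite_S[OF dense[OF I]])
    show "(if card {y \<in> S I. y < qry I} < card (S I) then
      if elems I ! card {y \<in> S I. y < qry I} = qry I then card {y \<in> S I. y < qry I} else 2 ^ wd I - 1 else 2 ^ wd I - 1)
      = rank_word (wd I) (S I) (qry I)"
    proof (cases "qry I \<in> S I")
      case True
      then show ?thesis using finite_sorted_nth_card[OF fin True] by (simp add: rank_word_def)
    next
      case False
      then have "elems I ! c \<noteq> qry I" if "c < card (S I)" for c
        using nth_mem[of c "elems I"] that fin by auto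
      then show ?thesis using False by (simp add: rank_word_def)
    qed
  qed
qed

lemma comp_select:
  assumes "\<And>I. I \<in> F \<Longrightarrow> 1 \<le> qry I \<and> qry I \<le> card (S I)"
  shows "comp F (\<lambda>I. set_select (qry I) (S I))"
proof -
  have "comp F (\<lambda>I. qry I - 1)"
  proof (rule comp_diff[OF comp_qry small_const])
    fix I assume I: "I \<in> F"
    show "1 \<le> qry I" using assms[OF I] by simp
    show "qry I < 2 ^ wd I" using assms[OF I] dense_set.card_le[OF dense[OF I]] u_less[OF I] by simp
  qed simp
  then have "comp F (\<lambda>I. elems I ! (qry I - 1))"
    by (rule readableD[OF readable_elems]) (use assms in fastforce)
  then show ?thesis by (rule comp_cong) (simp add: set_select_def)
qed

end

section \<open>The dictionary\<close>

lemma rank_word_less: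
  assumes "S \<subseteq> {..<m}" "m < 2 ^ w" shows "rank_word w S x < 2 ^ w"
proof -
  have "card {y \<in> S. y < x} \<le> card {..<m}" using assms(1) by (intro card_mono) auto
  then show ?thesis using assms(2) by (simp add: rank_word_def)
qed

lemma word_of_set_rank:
  assumes "S \<subseteq> {..<m}" "m < 2 ^ w"
  shows "word_of_integer w (set_rank x S) = rank_word w S x"
proof (cases "x \<in> S")
  case True
  then have "card {y \<in> S. y < x} < 2 ^ w" using rank_word_less[OF assms, of x] by (simp add: rank_word_def)
  then have "int (card {y \<in> S. y < x}) < int (2 ^ w)" by (simp only: of_nat_less_iff)
  then show ?thesis using True by (simp add: word_of_integer_def set_rank_def rank_word_def)
next
  case False
  have "(- 1 :: int) mod 2 ^ w = 2 ^ w - 1" by (simp add: zmod_minus1)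
  then show ?thesis using False by (simp add: word_of_integer_def set_rank_def rank_word_def nat_diff_distrib nat_power_eq)
qed

lemma answers_within_mono: "answers_within w P D T q a \<Longrightarrow> T \<le> T' \<Longrightarrow> answers_within w P D T' q a"
  unfolding answers_within_def using le_trans by blast

definition hash_for :: "nat \<Rightarrow> nat set \<Rightarrow> hash_data" where
  "hash_for m S = (SOME h. hash_ok m (clog m) S h)"

lemma sparse_set_hash_for:
  "S \<subseteq> {..<m} \<Longrightarrow> 0 < m \<Longrightarrow> 512 * card S \<le> m \<Longrightarrow> sparse_set m S (hash_for m S)"
  unfolding sparse_set_def hash_for_def
  using someI_ex[OF hash_exists[OF _ clog_ge]] by blast

definition dict_arrays :: "nat \<Rightarrow> nat \<Rightarrow> nat set \<Rightarrow> (nat \<times> nat list) list" where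
  "dict_arrays k m S = (if 512 * card S \<le> m then sparse_set.arrays m S (hash_for m S) k else dense_arrays m S)"

text \<open>The other formats are shown to fit only words of at least 1024 bits. Below the threshold
  \<open>m\<close> is bounded, and a plain table with one word per cell costs a constant number of
  bits.\<close>

definition dict :: "nat \<Rightarrow> nat \<Rightarrow> nat \<Rightarrow> nat \<Rightarrow> nat set \<Rightarrow> bool list" where
  "dict t k w m S = (if w < 2 ^ t then encode w (map (rank_word w S) [0..<m]) else layout (dict_arrays k m S))"

lemma fitsI:
  assumes "64 \<le> w" "well_sized w X arrs" "X < 2 ^ w" "length (layout arrs) + 2 * w \<le> w * 2 ^ w"
  shows "fits w arrs"
  using assms by (fastforce simp: fits_def well_sized_def)

lemma fits_sparse:
  assumes "S \<subseteq> {..<m}" "0 < m" "512 * card S \<le> m" "m < 2 ^ w" "1024 \<le> w"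
  shows "fits w (sparse_set.arrays m S (hash_for m S) k)"
proof -
  interpret sparse_set m S "hash_for m S" k using sparse_set_hash_for[OF assms(1-3)] .
  let ?h = "hash_for m S"
  have p1: "(2::nat) ^ 16 \<le> 2 ^ w" using assms(5) by (intro power_increasing) auto
  have w: "w < 2 ^ w" by simp
  have clw: "clog m \<le> w" unfolding clog_def by (rule floorlog_le) (use assms(4) in simp)
  have kb: "key_bits ?h \<le> w" unfolding key_bits_def
    by (rule floorlog_le) (use hash_facts(2,5) assms(4) in linarith)
  have big: "128 * 2 ^ L < (2::nat) ^ w"
  proof (cases "n = 0")
    case True
    then show ?thesis using p1 by (simp add: L_def)
  next
    case False
    then have "2 ^ L \<le> 2 * n" unfolding L_def by (intro floorlog_power_le) simp
    then show ?thesis using assms(3,4) by (simp add: n_def)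
  qed
  have "(2::nat) ^ (L + 7) < 2 ^ w" using big by (simp add: power_add mult.commute)
  then have Lw: "L + 7 < w" by simp
  have wp: "width params \<le> w"
  proof (rule width_le)
    have "n < 2 ^ w" "L < 2 ^ w" "g < 2 ^ w" using n_less g_bounds(3) less_exp[of L] big by linarith+
    moreover have "low_bits < 2 ^ w" using clw w diff_le_self[of "clog m" L] unfolding low_bits_def by linarith
    moreover have "mod1 ?h < 2 ^ w" "mod2 ?h < 2 ^ w" using hash_facts(2,5) assms(4) by linarith+
    moreover have "key_bits ?h < 2 ^ w" using kb w by linarith
    moreover have "seed ?h < 2 ^ w" by (rule less_le_trans[OF hash_facts(7)]) (use kb in simp)
    ultimately show "x < 2 ^ w" if "x \<in> set params" for x using that p1 by (auto simp: params_def)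
  qed
  have sized: "well_sized w (128 * 2 ^ L) arrays"
    by (rule arrays_sized[OF wp kb]) (use clw Lw in \<open>auto simp: low_bits_def\<close>)
  show ?thesis
  proof (rule fitsI[OF _ sized big])
    define P where "P = (2::nat) ^ w"
    have "n * low_bits + n * (L - k) \<le> n * clog m"
      unfolding distrib_left[symmetric] L_clog[symmetric] by (intro mult_le_mono2) simp
    also have "\<dots> \<le> n * w" using clw by (rule mult_le_mono2)
    finally have 1: "n * low_bits + n * (L - k) \<le> n * w" .
    have "floorlog 2 (clog m) \<le> clog m" by (rule floorlog_le) simp
    then have zw: "z \<le> w" using clw by (simp add: z_def)
    have n: "512 * n \<le> P" using assms(3,4) by (simp add: n_def P_def)
    \<comment> \<open>The inequality is scaled so that 512 n <= 2^w applies without a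
      division.\<close>
    have "512 * (length (layout arrays) + 2 * w) \<le> 512 * (n * w + 7000 * n + 40 * w + 4000 + 2 * w)"
      using layout_bits 1 zw by (intro mult_le_mono2) linarith
    also have "\<dots> = (512 * n) * (w + 7000) + 512 * (42 * w + 4000)" by (simp add: algebra_simps)
    also have "\<dots> \<le> P * (8 * w) + 512 * (46 * w)"
      using n assms(5) by (intro add_mono mult_le_mono) auto
    also have "512 * (46 * w) \<le> P * w" using mult_le_mono1[of "512 * 46" P w] p1 by (simp add: P_def)
    also have "P * (8 * w) + P * w \<le> 512 * (w * P)" by simp
    finally show "length (layout arrays) + 2 * w \<le> w * 2 ^ w" by (simp add: P_def)
  qed (use assms in simp)
qed

lemma fits_dense:
  assumes "S \<subseteq> {..<m}" "0 < m" "m < 2 ^ w" "1024 \<le> w"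
  shows "fits w (dense_arrays m S)"
proof -
  interpret dense_set m S using assms by unfold_locales
  have p1: "(2::nat) ^ 16 \<le> 2 ^ w" using assms(4) by (intro power_increasing) auto
  have Lw: "floorlog 2 m \<le> w" by (rule floorlog_le[OF assms(3)])
  have gw: "dense_g m \<le> w" using Lw assms(4) by (simp add: dense_g_def)
  have w: "w < 2 ^ w" by simp
  have wp: "width (dense_params m S) \<le> w"
    by (rule width_le) (use card_le assms(3) le_less_trans[OF gw w] p1 in \<open>auto simp: dense_params_def\<close>)
  have tab: "2 ^ dense_g m * dense_g m < 2 ^ w" by (rule dense_table_less[OF assms(3,4)])
  let ?X = "max 3 (max m (2 ^ dense_g m * dense_g m))"
  have X: "?X < 2 ^ w" using tab assms(3) p1 by simp
  show ?thesis
  proof (rule fitsI[OF _ sized[OF wp Lw gw] X])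
    have "length (layout (dense_arrays m S)) + 2 * w \<le> 300 * 2 ^ w + 2 * 2 ^ w" using bits assms(3) w by linarith
    also have "\<dots> \<le> w * 2 ^ w" using mult_le_mono1[of 302 w "2 ^ w"] assms(4) by simp
    finally show "length (layout (dense_arrays m S)) + 2 * w \<le> w * 2 ^ w" .
  qed (use assms in auto)
qed

type_synonym instance_data = "nat \<times> nat set \<times> nat"

section \<open>Programs that cover all three formats\<close>

locale dictionary =
  fixes W :: "nat \<Rightarrow> nat" and t k :: nat
  assumes W: "1 \<le> m \<Longrightarrow> m < 2 ^ W m" and t: "k < 2 ^ t" "1024 \<le> (2::nat) ^ t"
begin

abbreviation "ubound (I :: instance_data) \<equiv> fst I"
abbreviation "the_set (I :: instance_data) \<equiv> fst (snd I)"
abbreviation "query (I :: instance_data) \<equiv> snd (snd I)"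
abbreviation "ws (I :: instance_data) \<equiv> W (ubound I)"
abbreviation "store (I :: instance_data) \<equiv> dict t k (W (ubound I)) (ubound I) (the_set I)"

sublocale ram ws store query .

definition valid :: "instance_data set \<Rightarrow> bool" where
  "valid F \<longleftrightarrow> (\<forall>I\<in>F. 1 \<le> ubound I \<and> the_set I \<subseteq> {..<ubound I})"

lemma validD: "valid F \<Longrightarrow> I \<in> F \<Longrightarrow> 1 \<le> ubound I \<and> the_set I \<subseteq> {..<ubound I}"
  by (simp add: valid_def)

lemma wd_pos: "valid F \<Longrightarrow> I \<in> F \<Longrightarrow> 1 \<le> ws I"
  using W[of "ubound I"] validD[of F I] by (cases "ws I") auto

lemma one: "valid F \<Longrightarrow> comp F (\<lambda>_. 1)"
  by (intro comp_const one_less_power) (use wd_pos in fastforce)+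

definition "small F = {I\<in>F. ws I < 2 ^ t}"
definition "sparse F = {I\<in>F. \<not> ws I < 2 ^ t \<and> 512 * card (the_set I) \<le> ubound I}"
definition "dense F = {I\<in>F. \<not> ws I < 2 ^ t \<and> \<not> 512 * card (the_set I) \<le> ubound I}"

lemma dict_ram_big:
  assumes "valid F" "\<And>I. I \<in> F \<Longrightarrow> \<not> ws I < 2 ^ t"
  shows "dict_ram ws store F
    (\<lambda>I. dict_arrays k (ubound I) (the_set I)) 11 ubound the_set k"
proof unfold_locales
  fix I assume I: "I \<in> F"
  note v = validD[OF assms(1) I]
  have w: "2 ^ t \<le> ws I" using assms(2)[OF I] by simp
  show "ubound I < 2 ^ ws I" using W v by blast
  show w1: "1024 \<le> ws I" "k < ws I" using w t by auto
  show "the_set I \<subseteq> {..<ubound I}" using v by blast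
  show "store I = layout (dict_arrays k (ubound I) (the_set I))"
    using assms(2)[OF I] by (simp add: dict_def)
  show "fits (ws I) (dict_arrays k (ubound I) (the_set I))"
    unfolding dict_arrays_def using v w1 W[of "ubound I"] by (auto intro!: fits_sparse fits_dense)
  show "length (dict_arrays k (ubound I) (the_set I)) = 11"
  proof (cases "512 * card (the_set I) \<le> ubound I")
    case True
    then have "sparse_set (ubound I) (the_set I) (hash_for (ubound I) (the_set I))"
      using v by (intro sparse_set_hash_for) auto
    then show ?thesis using True
      by (simp add: dict_arrays_def sparse_set.arrays_def increasing_arrays_def rank_arrays_def)
  next
    case False
    then show ?thesis by (simp add: dict_arrays_def dense_arrays_def increasing_arrays_def rank_arrays_def)
  qed
qed simp_all

lemma sparse_ram: assumes "valid F"
  shows "sparse_ram ws store (sparse F)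
    (\<lambda>I. dict_arrays k (ubound I) (the_set I)) 11 ubound the_set k (\<lambda>I. hash_for (ubound I) (the_set I))"
proof -
  have v: "valid (sparse F)" using assms by (auto simp: valid_def sparse_def)
  show ?thesis unfolding sparse_ram_def sparse_ram_axioms_def
  proof (intro conjI allI impI)
    show "dict_ram ws store (sparse F)
      (\<lambda>I. dict_arrays k (ubound I) (the_set I)) 11 ubound the_set k"
      by (rule dict_ram_big[OF v]) (auto simp: sparse_def)
    fix I assume I: "I \<in> sparse F"
    show "sparse_set (ubound I) (the_set I) (hash_for (ubound I) (the_set I))"
      using validD[OF v I] I by (intro sparse_set_hash_for) (auto simp: sparse_def)
    show "dict_arrays k (ubound I) (the_set I) = sparse_set.arrays (ubound I) (the_set I) (hash_for (ubound I) (the_set I)) k"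
      using I by (simp add: dict_arrays_def sparse_def)
  qed
qed

lemma dense_ram: assumes "valid F"
  shows "dense_ram ws store (dense F)
    (\<lambda>I. dict_arrays k (ubound I) (the_set I)) 11 ubound the_set k"
proof -
  have v: "valid (dense F)" using assms by (auto simp: valid_def dense_def)
  show ?thesis unfolding dense_ram_def dense_ram_axioms_def
  proof (intro conjI allI impI)
    show "dict_ram ws store (dense F)
      (\<lambda>I. dict_arrays k (ubound I) (the_set I)) 11 ubound the_set k"
      by (rule dict_ram_big[OF v]) (auto simp: dense_def)
    fix I assume I: "I \<in> dense F"
    show "0 < ubound I" using validD[OF v I] by simp
    show "dict_arrays k (ubound I) (the_set I) = dense_arrays (ubound I) (the_set I)"
      using I by (simp add: dict_arrays_def dense_def)
  qed
qed

text \<open>The program recognizes its format from the word size and then from the flag at the start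
  of the first array.\<close>

lemma comp_cases:
  assumes "valid F" "comp (small F) \<phi>" "comp (sparse F) \<phi>" "comp (dense F) \<phi>"
  shows "comp F \<phi>"
proof -
  \<comment> \<open>The constant 2^t, and even \<open>t\<close>, may not fit a small word, so the
    quotient is formed by \<open>t\<close> shifts by one position.\<close>
  have div: "comp F (\<lambda>I. ws I div 2 ^ i)" for i
  proof (induction i)
    case 0
    then show ?case using comp_wd by simp
  next
    case (Suc i)
    from comp_shr[OF this one[OF assms(1)]] show ?case
      by (rule comp_cong) (simp add: div_mult2_eq[symmetric] mult.commute)
  qed
  have zero: "comp F (\<lambda>_. 0)" by (rule comp_const) simp
  let ?B = "{I\<in>F. \<not> ws I div 2 ^ t = 0}"
  have vB: "valid ?B" using assms(1) by (auto simp: valid_def)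
  interpret big: dict_ram ws store query ?B
    "\<lambda>I. dict_arrays k (ubound I) (the_set I)" 11 ubound the_set k
    by (rule dict_ram_big[OF vB]) auto
  let ?flag = "\<lambda>I. snd (dict_arrays k (ubound I) (the_set I) ! 0) ! 0"
  have flag: "?flag I = (if 512 * card (the_set I) \<le> ubound I then 0 else 1)"
    "0 < length (snd (dict_arrays k (ubound I) (the_set I) ! 0))" if "I \<in> F" for I
  proof -
    have "sparse_set (ubound I) (the_set I) (hash_for (ubound I) (the_set I))" if "512 * card (the_set I) \<le> ubound I"
      using validD[OF assms(1) \<open>I \<in> F\<close>] that by (intro sparse_set_hash_for) auto
    then show "?flag I = (if 512 * card (the_set I) \<le> ubound I then 0 else 1)"
      "0 < length (snd (dict_arrays k (ubound I) (the_set I) ! 0))"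
      by (simp_all add: dict_arrays_def sparse_set.arrays_def sparse_set.params_def dense_arrays_def dense_params_def)
  qed
  have cf: "comp ?B ?flag"
    by (rule readableD[OF big.readable_array comp_subset[OF zero]]) (use flag(2) in auto)
  \<comment> \<open>Both branches have the value \<open>\<phi> I\<close>. The conditional only
    chooses between the two expressions that compute it on their subfamilies.\<close>
  have "comp ?B (\<lambda>I. if ?flag I = 0 then \<phi> I else \<phi> I)"
  proof (rule comp_if_eq[OF cf comp_subset[OF zero]])
    show "comp {I \<in> ?B. ?flag I = 0} \<phi>"
      by (rule comp_subset[OF assms(3)]) (use flag(1) in \<open>auto simp: sparse_def split: if_splits\<close>)
    show "comp {I \<in> ?B. ?flag I \<noteq> 0} \<phi>"
      by (rule comp_subset[OF assms(4)]) (use flag(1) in \<open>auto simp: dense_def split: if_splits\<close>)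
  qed auto
  then have B: "comp ?B \<phi>" by simp
  have "comp F (\<lambda>I. if ws I div 2 ^ t = 0 then \<phi> I else \<phi> I)"
    by (rule comp_if_eq[OF div zero comp_subset[OF assms(2)] B]) (auto simp: small_def div_eq_0_iff)
  then show ?thesis by simp
qed

lemma small_cell:
  assumes "valid F" "I \<in> small F" "x < ubound I"
  shows "pack (ws I) (store I) x = rank_word (ws I) (the_set I) x"
proof -
  let ?w = "ws I" let ?A = "map (rank_word ?w (the_set I)) [0..<ubound I]"
  have v: "1 \<le> ubound I" "the_set I \<subseteq> {..<ubound I}" using validD[OF assms(1)] assms(2) by (auto simp: small_def)
  have "field (encode ?w ?A @ []) (x * ?w) ?w = ?A ! x"
    by (rule field_encode) (use assms(3) rank_word_less[OF v(2) W[OF v(1)]] in auto)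
  then show ?thesis using assms(2,3) by (simp add: pack_eq_field dict_def small_def)
qed

lemma comp_rank:
  assumes "valid F" "\<And>I. I \<in> F \<Longrightarrow> query I < ubound I"
  shows "comp F (\<lambda>I. rank_word (ws I) (the_set I) (query I))"
proof (rule comp_cases[OF assms(1)])
  show "comp (small F) (\<lambda>I. rank_word (ws I) (the_set I) (query I))"
    by (rule comp_cong[OF comp_load[OF comp_qry]]) (use small_cell[OF assms(1)] assms(2) in \<open>auto simp: small_def\<close>)
  show "comp (sparse F) (\<lambda>I. rank_word (ws I) (the_set I) (query I))"
    by (rule sparse_ram.comp_rank[OF sparse_ram[OF assms(1)]])
  show "comp (dense F) (\<lambda>I. rank_word (ws I) (the_set I) (query I))"
    by (rule dense_ram.comp_rank[OF dense_ram[OF assms(1)]]) (use assms(2) in \<open>auto simp: dense_def\<close>)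
qed

text \<open>Linear search in the rank table, unrolled a constant number of times. The machine
  reduces constants modulo 2^w, so \<open>j\<close> is reduced here as well; the answer is found
  before it wraps around.\<close>

primrec seek :: "nat \<Rightarrow> nat \<Rightarrow> instance_data \<Rightarrow> nat" where
  "seek 0 j I = 0"
| "seek (Suc N) j I =
     (if pack (ws I) (store I) (j mod 2 ^ ws I) = query I - 1
      then j mod 2 ^ ws I else seek N (Suc j) I)"

lemma comp_seek:
  assumes "comp F (\<lambda>I. query I - 1)"
  shows "comp F (seek N j)"
proof (induction N arbitrary: j)
  case 0
  have "comp F (\<lambda>_. 0)" by (rule comp_const) simp
  then show ?case by simp
next
  case (Suc N)
  have j: "comp F (\<lambda>I. j mod 2 ^ ws I)" unfolding comp_def by (intro exI[of _ "Cst j"]) simp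
  have "comp F (\<lambda>I. if pack (ws I) (store I) (j mod 2 ^ ws I) = query I - 1
    then j mod 2 ^ ws I else seek N (Suc j) I)"
    by (rule comp_if_eq[OF comp_load[OF j] assms comp_subset[OF j] comp_subset[OF Suc]]) auto
  then show ?case by simp
qed

lemma seek_correct:
  assumes "valid F" "I \<in> small F" "1 \<le> query I" "query I \<le> card (the_set I)"
  shows "seek (2 ^ 2 ^ t) 0 I = set_select (query I) (the_set I)"
proof -
  let ?w = "ws I" let ?S = "the_set I" let ?q = "query I"
  have v: "1 \<le> ubound I" "?S \<subseteq> {..<ubound I}" using validD[OF assms(1)] assms(2) by (auto simp: small_def)
  have fin: "finite ?S" using v(2) finite_subset by blast
  define x where "x = set_select ?q ?S"
  have xS: "x \<in> ?S" unfolding x_def set_select_def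
    using assms(3,4) fin nth_mem[of "?q - 1" "sorted_list_of_set ?S"] by auto
  have rx: "card {y \<in> ?S. y < x} = ?q - 1"
  proof -
    have "sorted_list_of_set ?S ! card {y \<in> ?S. y < x} = sorted_list_of_set ?S ! (?q - 1)"
      using finite_sorted_nth_card(1)[OF fin xS] by (simp add: x_def set_select_def)
    then show ?thesis using nth_eq_iff_index_eq[of "sorted_list_of_set ?S" "card {y \<in> ?S. y < x}" "?q - 1"]
      finite_sorted_nth_card(2)[OF fin xS] assms(3,4) fin by auto
  qed
  have um: "ubound I < 2 ^ ?w" using W[OF v(1)] .
  have xu: "x < ubound I" using xS v(2) by auto
  \<comment> \<open>Cells of non-members contain 2^w - 1, which must not match the rank that is
    sought.\<close>
  have qn: "?q - 1 \<noteq> 2 ^ ?w - 1" using assms(3,4) card_mono[OF _ v(2)] um by simp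
  have ne: "rank_word ?w ?S j \<noteq> ?q - 1" if "j < x" for j
  proof (cases "j \<in> ?S")
    case True
    have "card {y \<in> ?S. y < j} < card {y \<in> ?S. y < x}"
      using fin True that by (intro psubset_card_mono) auto
    then show ?thesis using True rx by (simp add: rank_word_def)
  qed (use qn in \<open>simp add: rank_word_def\<close>)
  have "j \<le> x \<Longrightarrow> x < j + N \<Longrightarrow> seek N j I = x" for N j
  proof (induction N arbitrary: j)
    case (Suc N)
    have j: "j mod 2 ^ ?w = j" "j < ubound I" using Suc.prems xu um by auto
    note cell = small_cell[OF assms(1,2) j(2)]
    show ?case
    proof (cases "j = x")
      case True
      then show ?thesis using cell j rx xS by (simp add: rank_word_def)
    next
      case False
      then show ?thesis using cell j ne[of j] Suc by simp
    qed
  qed simp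
  moreover have "x < 2 ^ 2 ^ t"
  proof -
    have "x < 2 ^ ?w" using xu um by simp
    also have "(2::nat) ^ ?w \<le> 2 ^ 2 ^ t" using assms(2) by (intro power_increasing) (auto simp: small_def)
    finally show ?thesis .
  qed
  ultimately show ?thesis by (simp add: x_def)
qed

lemma comp_select:
  assumes "valid F" "\<And>I. I \<in> F \<Longrightarrow> 1 \<le> query I \<and> query I \<le> card (the_set I)"
  shows "comp F (\<lambda>I. set_select (query I) (the_set I))"
proof (rule comp_cases[OF assms(1)])
  have v: "valid (small F)" using assms(1) by (auto simp: valid_def small_def)
  have "comp (small F) (\<lambda>I. query I - 1)"
  proof (rule comp_diff[OF comp_qry one[OF v]])
    fix I assume I: "I \<in> small F"
    then have IF: "I \<in> F" by (simp add: small_def)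
    show "1 \<le> query I" using assms(2)[OF IF] by simp
    show "query I < 2 ^ ws I"
      using assms(2)[OF IF] card_mono[of "{..<ubound I}" "the_set I"] validD[OF v I] W[of "ubound I"] by simp
  qed
  from comp_seek[OF this] show "comp (small F) (\<lambda>I. set_select (query I) (the_set I))"
    by (rule comp_cong) (use seek_correct[OF assms(1)] assms(2) in \<open>auto simp: small_def\<close>)
  show "comp (sparse F) (\<lambda>I. set_select (query I) (the_set I))"
    by (rule sparse_ram.comp_select[OF sparse_ram[OF assms(1)]]) (use assms(2) in \<open>auto simp: sparse_def\<close>)
  show "comp (dense F) (\<lambda>I. set_select (query I) (the_set I))"
    by (rule dense_ram.comp_select[OF dense_ram[OF assms(1)]]) (use assms(2) in \<open>auto simp: dense_def\<close>)
qed

lemma programs_exist: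
  "\<exists>P_rank P_select T. \<forall>m S. 1 \<le> m \<longrightarrow> S \<subseteq> {..<m} \<longrightarrow>
     indexable_dictionary (W m) P_rank P_select T m S (dict t k (W m) m S)"
proof -
  define V where "V = {I :: instance_data. 1 \<le> ubound I \<and> the_set I \<subseteq> {..<ubound I}}"
  define F1 where "F1 = {I\<in>V. query I < ubound I}"
  define F2 where "F2 = {I\<in>V. 1 \<le> query I \<and> query I \<le> card (the_set I)}"
  have "comp F1 (\<lambda>I. rank_word (ws I) (the_set I) (query I))"
    by (rule comp_rank) (auto simp: valid_def F1_def V_def)
  then obtain e1 where e1: "\<And>I. I \<in> F1 \<Longrightarrow>
    ev (ws I) (pack (ws I) (store I)) (query I) e1
    = rank_word (ws I) (the_set I) (query I)"
    unfolding comp_def by blast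
  have "comp F2 (\<lambda>I. set_select (query I) (the_set I))"
    by (rule comp_select) (auto simp: valid_def F2_def V_def)
  then obtain e2 where e2: "\<And>I. I \<in> F2 \<Longrightarrow>
    ev (ws I) (pack (ws I) (store I)) (query I) e2
    = set_select (query I) (the_set I)"
    unfolding comp_def by blast
  let ?T = "max (code_size e1 + 1) (code_size e2 + 1)"
  have "indexable_dictionary (W m) (program e1) (program e2) ?T m S (dict t k (W m) m S)"
    if mS: "1 \<le> m" "S \<subseteq> {..<m}" for m S
    unfolding indexable_dictionary_def
  proof (intro conjI allI impI ballI)
    fix x assume "x < m"
    then have "ev (W m) (pack (W m) (dict t k (W m) m S)) x e1 = rank_word (W m) S x"
      using e1[of "(m, S, x)"] mS by (simp add: F1_def V_def)
    then show "answers_within (W m) (program e1) (dict t k (W m) m S) ?T x (word_of_integer (W m) (set_rank x S))"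
      using program_answers[of "W m" e1 "dict t k (W m) m S" x] word_of_set_rank[OF mS(2) W[OF mS(1)]]
      by (auto intro: answers_within_mono)
  next
    fix i assume "i \<in> {1..card S}"
    then have "ev (W m) (pack (W m) (dict t k (W m) m S)) i e2 = set_select i S"
      using e2[of "(m, S, i)"] mS by (simp add: F2_def V_def)
    then show "answers_within (W m) (program e2) (dict t k (W m) m S) ?T i (set_select i S)"
      using program_answers[of "W m" e2 "dict t k (W m) m S" i] by (auto intro: answers_within_mono)
  qed
  then show ?thesis by blast
qed

end

text \<open>For \<open>card S >= N\<close> the \<open>k\<close> bits saved per element pay for all
  linear and constant terms. They also pay for the 80 on the left, which covers 40 times the
  rounding error 2 in lg lg m. For \<open>card S < N\<close> constants suffice:
  \<open>N * 2 ^ t\<close> bounds the plain table, and 160000 exceeds both 7000 and 300 *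
  512.\<close>

lemma dict_bits:
  fixes t k :: nat
  defines "N \<equiv> 2 ^ 2 ^ t :: nat"
  assumes "S \<subseteq> {..<m}" "1 \<le> m" "m < 2 ^ w" "200000 \<le> k" "k < 2 ^ t"
  shows "length (dict t k w m S) + (if card S < N then 0 else 80) \<le>
    card S * clog m + (if card S < N then N * 2 ^ t + 160000 * N + 4000 else 0) + 40 * floorlog 2 (clog m)"
proof -
  define c where "c = card S"
  have cm: "c \<le> m" using card_mono[OF _ assms(2)] by (simp add: c_def)
  have kN: "2 ^ k \<le> N" unfolding N_def using assms(6) by (intro power_increasing) auto
  have ck: "c * 200000 \<le> c * k" using assms(5) by (rule mult_le_mono2)
  show ?thesis
  proof (cases "w < 2 ^ t")
    case True
    then have "(2::nat) ^ w \<le> N" unfolding N_def by (intro power_increasing) auto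
    then have mN: "m < N" using assms(4) by linarith
    have "length (dict t k w m S) = m * w" using True by (simp add: dict_def)
    also have "\<dots> \<le> N * 2 ^ t" using mN True by (intro mult_le_mono) auto
    finally show ?thesis using mN cm by (simp add: c_def)
  next
    case big: False
    show ?thesis
    proof (cases "512 * card S \<le> m")
      case True
      interpret sparse_set m S "hash_for m S" k using assms True by (intro sparse_set_hash_for) auto
      have 1: "length (dict t k w m S) \<le> c * low_bits + c * (L - k) + 7000 * c + 40 * floorlog 2 (clog m) + 4000"
        using layout_bits big True by (simp add: dict_def dict_arrays_def n_def z_def c_def)
      have 2: "c * clog m = c * low_bits + c * L" unfolding L_clog[symmetric] by (simp add: algebra_simps)
      have 3: "c * (L - k) \<le> c * L" by simp
      have 4: "c * (L - k) + c * k = c * L" "0 < c" if "\<not> c < N"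
      proof -
        \<comment> \<open>From 2^k <= N <= n < 2^L the subtraction \<open>L - k\<close> does not
          truncate, so the full \<open>k\<close> bits per element are gained.\<close>
        have "(2::nat) ^ k < 2 ^ L" using that kN n_less unfolding n_def c_def by linarith
        then have "k < L" by simp
        then show "c * (L - k) + c * k = c * L" by (simp add: distrib_left[symmetric])
        show "0 < c" using that by (cases c) (auto simp: N_def)
      qed
      have "D + (if c < N then 0 else 80) \<le> x5 + (if c < N then x6 + 160000 * N + 4000 else 0) + 40 * v"
        if "D \<le> x1 + x2 + 7000 * c + 40 * v + 4000" "x5 = x1 + x3" "x2 \<le> x3" "\<not> c < N \<Longrightarrow> x2 + x4 = x3"
          "\<not> c < N \<Longrightarrow> 0 < c" "c * 200000 \<le> x4" for D v x1 x2 x3 x4 x5 x6 :: nat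
        using that by (cases "c < N") auto
      from this[OF 1 2 3 4 ck] show ?thesis unfolding c_def .
    next
      case False
      interpret dense_set m S using assms by unfold_locales auto
      have 1: "length (dict t k w m S) \<le> 300 * m" using bits big False by (simp add: dict_def dict_arrays_def)
      have 2: "m < 512 * c" using False by (simp add: c_def)
      have 3: "c * 200000 \<le> c * clog m" if "\<not> c < N"
      proof (rule order_trans[OF ck mult_le_mono2])
        \<comment> \<open>A large dense set has lg m >= k, so n lg m alone exceeds the 300 * 512 n
          bits of its structure.\<close>
        have "(2::nat) ^ k \<le> 2 ^ clog m" using that kN cm clog_ge[of m] by linarith
        then show "k \<le> clog m" by simp
      qed
      have "D + (if c < N then 0 else 80) \<le> x + (if c < N then y + 160000 * N + 4000 else 0) + 40 * v"
        if "D \<le> 300 * m" "m < 512 * c" "\<not> c < N \<Longrightarrow> c * 200000 \<le> x" for D x y v :: nat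
        using that by (cases "c < N") auto
      from this[OF 1 2 3] show ?thesis unfolding c_def .
    qed
  qed
qed

lemma clog_le_ceiling: assumes "1 \<le> m" shows "real (clog m) \<le> of_int \<lceil>log 2 (real m)\<rceil>"
proof (cases "clog m = 0")
  case True
  have "0 \<le> log 2 (real m)" using assms by simp
  then have "0 \<le> \<lceil>log 2 (real m)\<rceil>" by linarith
  then show ?thesis using True by simp
next
  case False
  then have "0 < m - 1" by (cases "m - 1 = 0") (auto simp: clog_def)
  then have "2 ^ (clog m - 1) \<le> m - 1" using floorlog_bounds[of "m - 1" 2] by (simp add: clog_def)
  then have "2 ^ (clog m - 1) < m" using \<open>0 < m - 1\<close> by linarith
  then have "real (2 ^ (clog m - 1)) < real m" by (simp only: of_nat_less_iff)
  then have "2 powr real (clog m - 1) < real m" by (simp add: powr_realpow)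
  then have "real (clog m - 1) < log 2 (real m)" using assms by (simp add: less_log_iff)
  also have "\<dots> \<le> of_int \<lceil>log 2 (real m)\<rceil>" by simp
  finally have "int (clog m - 1) < \<lceil>log 2 (real m)\<rceil>" by linarith
  then have "int (clog m) \<le> \<lceil>log 2 (real m)\<rceil>" using False by linarith
  then show ?thesis by (metis of_int_le_iff of_int_of_nat_eq)
qed

text \<open>For \<open>m = 1\<close> the iterated logarithm is \<open>log 2 0 = 0\<close>.\<close>

lemma floorlog_clog_le: assumes "1 \<le> m" shows "real (floorlog 2 (clog m)) \<le> log 2 (log 2 (real m)) + 2"
proof (cases "m = 1")
  case True
  then show ?thesis by (simp add: clog_def log_def)
next
  case False
  then have m: "2 \<le> m" using assms by simp
  define l where "l = log 2 (real m)"
  have l: "1 \<le> l" unfolding l_def using m by (subst one_le_log_cancel_iff) auto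
  have "real (clog m) \<le> of_int \<lceil>l\<rceil>" unfolding l_def by (rule clog_le_ceiling[OF assms])
  also have "\<dots> \<le> 2 * l" using l by linarith
  finally have c: "real (clog m) \<le> 2 * l" .
  show ?thesis
  proof (cases "clog m = 0")
    case True
    then show ?thesis using l zero_le_log_cancel_iff[of 2 l] by (simp add: l_def)
  next
    case False
    then have "2 ^ (floorlog 2 (clog m) - 1) \<le> clog m" using floorlog_bounds[of "clog m" 2] by simp
    then have "real (2 ^ (floorlog 2 (clog m) - 1)) \<le> real (clog m)" by (simp only: of_nat_le_iff)
    then have "real (2 ^ (floorlog 2 (clog m) - 1)) \<le> 2 * l" using c by (rule order_trans)
    then have "2 powr real (floorlog 2 (clog m) - 1) \<le> 2 * l" by (simp add: powr_realpow)
    then have "real (floorlog 2 (clog m) - 1) \<le> log 2 (2 * l)" using l by (subst le_log_iff) auto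
    also have "\<dots> = 1 + log 2 l" using l by (subst log_mult) auto
    finally show ?thesis unfolding l_def by linarith
  qed
qed

theorem theorem3p1:
  fixes W :: "nat \<Rightarrow> nat"
  assumes "(\<lambda>m. real (W m)) \<in> \<Theta>(\<lambda>m. log 2 (real m))"
    and "\<And>m. 1 \<le> m \<Longrightarrow> m < 2 ^ W m"
  shows "\<exists>(f :: nat \<Rightarrow> real) (C :: real) (P_rank :: prog) (P_select :: prog) (T :: nat).
    f \<in> o(\<lambda>n. real n) \<and>
    (\<forall>m n S. 1 \<le> m \<longrightarrow> n \<le> m \<longrightarrow> S \<subseteq> {..<m} \<longrightarrow> card S = n \<longrightarrow>
      (\<exists>D :: bool list.
        indexable_dictionary (W m) P_rank P_select T m S D \<and>
        real (length D) \<le>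
          real n * of_int \<lceil>log 2 (real m)\<rceil> + f n + C * log 2 (log 2 (real m))))"
proof -
  \<comment> \<open>The largest linear coefficient is that of dense sets, 300 * 512 = 153600 bits
    per element.\<close>
  obtain k :: nat where k: "200000 \<le> k" by blast
  obtain t :: nat where kt: "k < 2 ^ t" using less_exp[of k] by blast
  interpret dictionary W t k using assms(2) kt k by unfold_locales auto
  obtain P_rank P_select T where P: "\<And>m S. 1 \<le> m \<Longrightarrow> S \<subseteq> {..<m} \<Longrightarrow>
     indexable_dictionary (W m) P_rank P_select T m S (dict t k (W m) m S)"
    using programs_exist by blast
  define N where "N = (2::nat) ^ 2 ^ t"
  define F where "F = real (N * 2 ^ t + 160000 * N + 4000) + 80"
  \<comment> \<open>Being eventually 0, \<open>f\<close> is o(n). For small \<open>n\<close> its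
    value includes the 80 bits lost by rounding lg lg m.\<close>
  define f where "f = (\<lambda>n. if n < N then F else 0)"
  have "\<forall>\<^sub>F n in at_top. f n = 0"
    using eventually_ge_at_top[of N] by eventually_elim (simp add: f_def)
  then have f: "f \<in> o(\<lambda>n. real n)"
    by (rule landau_o.small.in_cong[THEN iffD2]) simp
  have "real (length (dict t k (W m) m S)) \<le>
      real n * of_int \<lceil>log 2 (real m)\<rceil> + f n + 40 * log 2 (log 2 (real m))"
    if mS: "1 \<le> m" "S \<subseteq> {..<m}" "card S = n" for m n S
  proof -
    let ?D = "length (dict t k (W m) m S)"
    have "?D + (if n < N then 0 else 80) \<le>
      n * clog m + (if n < N then N * 2 ^ t + 160000 * N + 4000 else 0) + 40 * floorlog 2 (clog m)"
      using dict_bits[OF mS(2,1) assms(2)[OF mS(1)] k kt, folded N_def] unfolding mS(3) .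
    then have "real (?D + (if n < N then 0 else 80)) \<le>
      real (n * clog m + (if n < N then N * 2 ^ t + 160000 * N + 4000 else 0) + 40 * floorlog 2 (clog m))"
      by (simp only: of_nat_le_iff)
    then have "real ?D + 80 \<le> real n * real (clog m) + f n + 40 * real (floorlog 2 (clog m))"
      by (cases "n < N") (auto simp: f_def F_def)
    moreover have "real n * real (clog m) \<le> real n * of_int \<lceil>log 2 (real m)\<rceil>"
      using clog_le_ceiling[OF mS(1)] by (rule mult_left_mono) simp
    moreover have "40 * real (floorlog 2 (clog m)) \<le> 40 * log 2 (log 2 (real m)) + 80"
      using floorlog_clog_le[OF mS(1)] by simp
    ultimately show ?thesis by linarith
  qed
  with P f show ?thesis by blast
qed

end
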